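(* (Mimicking counterfactual outcomes.) Let $Y$, $Z$, $Y^{(t)}$ be as in the context, and let $y_1$ and $y_2$ be the lower and upper limit of the support of $Y$, assumed finite. Suppose that there exists a collection of versions of the conditional distribution functions $F_{Y^{(t+h)}|\overline{Z}_t}$ such that all of the following conditions are satisfied. 1. (Support) (a) All $F_{Y^{(t+h)}|\overline{Z}_t}$ for all $t\ge 0$ and for $h\ge 0$ have the same bounded support $[y_1,y_2]$. (b) All $F_{Y^{(t+h)}|\overline{Z}_t}(y)$ for all $t\ge0$ and for $h\ge0$ have a continuous non-zero density $f_{Y^{(t+h)}|\overline{Z}_t}(y)$ on $y\in[y_1,y_2]$. (c) There exists an $\varepsilon>0$ such that $f_{Y^{(t)}|\overline{Z}_t}(y)\ge\varepsilon$ for all $y\in[y_1,y_2]$, $\omega\in\Omega$ and $t\in[0,\tau]$. 2. (Continuous derivatives) For $\omega\in\Omega$ fixed: (a) $F_{Y^{(t+h)}|\overline{Z}_t}(y)$ is $C^1$ in $(h,y)$ for $y\in[y_1,y_2]$ and $h\ge 0$. (b) If $Z$ does not jump in $(t_1,t_2)$, then both $\left.\frac{\partial}{\partial h}\right|_{h=0}F_{Y^{(t+h)}|\overline{Z}_t}(y)$ and $\frac{\partial}{\partial y}F_{Y^{(t)}|\overline{Z}_t}(y)$ are continuous in $(y,t)$ on $[y_1,y_2]\times[t_1,t_2)$ and can be continuously extended to $[y_1,y_2]\times[t_1,t_2]$. 3. (Bounded derivatives) There exist constants $C_1,C_2$ such that for all $\omega\in\Omega$, $t$, $h\ge0$ and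 $y\in[y_1,y_2]$: $\frac{\partial}{\partial y}F_{Y^{(t+h)}|\overline{Z}_t}(y)\le C_1$ and $\left|\frac{\partial}{\partial h}F_{Y^{(t+h)}|\overline{Z}_t}(y)\right|\le C_2$. 4. (Lipschitz continuity) There exist constants $L_1,L_2$ such that for all $\omega\in\Omega$, $t$ and $y,z\in[y_1,y_2]$: $\left|\frac{\partial}{\partial y}F_{Y^{(t)}|\overline{Z}_t}(y)-\frac{\partial}{\partial z}F_{Y^{(t)}|\overline{Z}_t}(z)\right|\le L_1|y-z|$ and $\left|\left.\frac{\partial}{\partial h}\right|_{h=0}F_{Y^{(t+h)}|\overline{Z}_t}(y)-\left.\frac{\partial}{\partial h}\right|_{h=0}F_{Y^{(t+h)}|\overline{Z}_t}(z)\right|\le L_2|y-z|$. Then $$D(y,t;\overline{Z}_t)=\left.\frac{\partial}{\partial h}\right|_{h=0}\left(F^{-1}_{Y^{(t+h)}|\overline{Z}_t}\circ F_{Y^{(t)}|\overline{Z}_t}\right)(y)$$ exists. Furthermore, for every $\omega\in\Omega$ there exists exactly one continuous solution $X(t)$ to $dX(t)/dt=D(X(t),t;\overline{Z}_t)$ with final condition $X(\tau)=Y$. If also $Y^{(\tau)}$ has the same distribution as $Y$ given $\overline{Z}_\tau$ (consistency), then this $X(t)$ has the same distribution as $Y^{(t)}$ given $\overline{Z}_t$ for all $t\in[0,\tau]$.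
   Context: $(\Omega,\mathcal F,P)$ is a probability space and $[0,\tau]$ a fixed time interval with $\tau$ finite. $Z=(Z(t))_{t\in[0,\tau]}$ is an $\mathbb R^m$-valued process (covariates and treatment) with cadlag sample paths which with probability one have only finitely many jumps; for every fixed $t$, except possibly finitely many, $P(Z\text{ jumps at }t)=0$. $\overline{Z}_t=(Z(s):0\le s\le t)$ is a random element of the space of cadlag functions $[0,t]\to\mathbb R^m$ with the $\sigma$-algebra generated by the coordinate projections. $Y$ (observed outcome) and $Y^{(t)}$, $t\in[0,\tau]$ (counterfactual outcome had treatment been switched to a baseline regime from time $t$ onwards) are real random variables on $(\Omega,\mathcal F,P)$; after $\tau$ no treatment is given, and $Y^{(s)}$ with $s>\tau$, where it occurs, is understood in the same way. No assumption is made on the joint distribution of the $Y^{(t)}$. $F_{Y^{(t+h)}|\overline{Z}_t}$ denotes a conditional distribution function of $Y^{(t+h)}$ given $\overline{Z}_t$; it depends on $\omega$ through $\overline{Z}_t(\omega)$. The versions satisfying the conditions are used everywhere, including in the definition of $D$. Only $h\ge0$ is considered, so the derivative with respect to $h$ at $h=0$ is always the right-hand derivative. $F^{-1}(p)=\inf\{x:F(x)\ge p\}$ for $p\in(0,1)$; where needed, $F^{-1}(0)$ and $F^{-1}(1)$ are the lower and upper endpoints of the support of $F$. The support of a random variable $X$ is the set of those $x$ such that $P(X\in U)>0$ for every open set $U$ containing $x$. Since $D$ may be discontinuous in $t$ at the jump times of $Z$, a continuous solution of the differential equation is a continuous function of $t\in[0,\tau]$ satisfying the equation on the intervals $[t_1,t_2]$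 between successive jump times of $Z$, where at the right endpoint $t_2$ the left limit $\lim_{t\uparrow t_2}D(y,t;\overline{Z}_t)$ is used in place of $D$ if $D$ jumps there. "Same distribution given $\overline{Z}_t$" means that the conditional distributions given $\overline{Z}_t$ agree almost surely.
   Formalization: Existence and uniqueness of the continuous solution is claimed for every ω whose path Z has finitely many jumps (almost every ω), not for every ω: on a null set of paths with, say, dense jumps there are no intervals between successive jump times and uniqueness fails. *)

theory Defs
  imports "HOL-Probability.Probability"
begin

section \<open>Cadlag paths and their histories\<close>

definition cadlag_on :: "real \<Rightarrow> real \<Rightarrow> (real \<Rightarrow> 'b::topological_space) \<Rightarrow> bool" where
  "cadlag_on a b z \<longleftrightarrow>
     (\<forall>t\<in>{a..<b}. (z \<longlongrightarrow> z t) (at_right t)) \<and>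
     (\<forall>t\<in>{a<..b}. \<exists>l. (z \<longlongrightarrow> l) (at_left t))"

text \<open>A path on \<open>[0, T]\<close> has no left limit at 0, hence never jumps there.\<close>

definition jump_times :: "real \<Rightarrow> (real \<Rightarrow> 'b::topological_space) \<Rightarrow> real set" where
  "jump_times T z = {t \<in> {0<..T}. \<not> (z \<longlongrightarrow> z t) (at_left t)}"

text \<open>The product \<open>\<sigma>\<close>-algebra is generated by the coordinate projections; the path space carries
  its trace, so it is irrelevant that the set of cadlag functions is not measurable itself.\<close>

definition cadlag_space :: "real \<Rightarrow> (real \<Rightarrow> real ^ 'm) measure" where
  "cadlag_space t = restrict_space (PiM {0..t} (\<lambda>_. borel)) {z. cadlag_on 0 t z}"

definition history :: "(real \<Rightarrow> 'a \<Rightarrow> real ^ 'm) \<Rightarrow> real \<Rightarrow> 'a \<Rightarrow> (real \<Rightarrow> real ^ 'm)" where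
  "history Z t \<omega> = restrict (\<lambda>s. Z s \<omega>) {0..t}"

section \<open>Support, quantiles, conditional distributions\<close>

definition support_of :: "real measure \<Rightarrow> real set" where
  "support_of \<mu> = {x. \<forall>U. open U \<longrightarrow> x \<in> U \<longrightarrow> measure \<mu> U > 0}"

definition quantile :: "real measure \<Rightarrow> real \<Rightarrow> real" where
  "quantile \<mu> p =
     (if p = 0 then Inf (support_of \<mu>)
      else if p = 1 then Sup (support_of \<mu>)
      else Inf {x. p \<le> cdf \<mu> x})"

text \<open>\<open>\<kappa>\<close> is a version of the conditional distribution of \<open>X\<close> given the random element \<open>V\<close> of the
  measurable space \<open>N\<close>. The conditional distribution function of \<open>X\<close> given \<open>V\<close> at \<open>\<omega>\<close> is then
  \<open>cdf (\<kappa> (V \<omega>))\<close>.\<close>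

definition is_cond_distr ::
  "'a measure \<Rightarrow> 'b measure \<Rightarrow> ('a \<Rightarrow> 'b) \<Rightarrow> ('a \<Rightarrow> real) \<Rightarrow> ('b \<Rightarrow> real measure) \<Rightarrow> bool" where
  "is_cond_distr M N V X \<kappa> \<longleftrightarrow>
     V \<in> M \<rightarrow>\<^sub>M N \<and> X \<in> borel_measurable M \<and> \<kappa> \<in> N \<rightarrow>\<^sub>M prob_algebra borel \<and>
     (\<forall>B\<in>sets borel. AE \<omega> in M.
        measure (\<kappa> (V \<omega>)) B =
        real_cond_exp M (vimage_algebra (space M) V N) (indicator (X -` B \<inter> space M)) \<omega>)"

definition same_cond_distr ::
  "'a measure \<Rightarrow> 'b measure \<Rightarrow> ('a \<Rightarrow> 'b) \<Rightarrow> ('a \<Rightarrow> real) \<Rightarrow> ('a \<Rightarrow> real) \<Rightarrow> bool" where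
  "same_cond_distr M N V X X' \<longleftrightarrow>
     (\<exists>\<kappa> \<kappa>'. is_cond_distr M N V X \<kappa> \<and> is_cond_distr M N V X' \<kappa>' \<and>
        (AE \<omega> in M. \<kappa> (V \<omega>) = \<kappa>' (V \<omega>)))"

section \<open>Partial derivatives of distribution functions\<close>

text \<open>In this section \<open>\<mu> h\<close>, for \<open>h \<ge> 0\<close>, plays the role of the conditional law of \<open>Y\<^sup>(\<^sup>t\<^sup>+\<^sup>h\<^sup>)\<close> given the
  history up to \<open>t\<close>, with \<open>t\<close> and the history fixed. Derivatives are one-sided at the boundary of
  \<open>[0, \<infinity>) \<times> [y\<^sub>1, y\<^sub>2]\<close>. They are meaningful only where they exist; existence is always asserted
  separately.\<close>

definition dcdf_h :: "(real \<Rightarrow> real measure) \<Rightarrow> real \<Rightarrow> real \<Rightarrow> real" where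
  "dcdf_h \<mu> h y = vector_derivative (\<lambda>k. cdf (\<mu> k) y) (at h within {0..})"

definition dcdf_y :: "real \<Rightarrow> real \<Rightarrow> (real \<Rightarrow> real measure) \<Rightarrow> real \<Rightarrow> real \<Rightarrow> real" where
  "dcdf_y y1 y2 \<mu> h y = vector_derivative (cdf (\<mu> h)) (at y within {y1..y2})"

definition cdf_C1 :: "real \<Rightarrow> real \<Rightarrow> (real \<Rightarrow> real measure) \<Rightarrow> bool" where
  "cdf_C1 y1 y2 \<mu> \<longleftrightarrow>
     (\<forall>h\<ge>0. \<forall>y\<in>{y1..y2}.
        (\<lambda>k. cdf (\<mu> k) y) differentiable (at h within {0..}) \<and>
        cdf (\<mu> h) differentiable (at y within {y1..y2})) \<and>
     continuous_on ({0..} \<times> {y1..y2}) (\<lambda>(h, y). dcdf_h \<mu> h y) \<and>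
     continuous_on ({0..} \<times> {y1..y2}) (\<lambda>(h, y). dcdf_y y1 y2 \<mu> h y)"

definition continuous_extendable ::
  "'a::topological_space set \<Rightarrow> 'a set \<Rightarrow> ('a \<Rightarrow> real) \<Rightarrow> bool" where
  "continuous_extendable A B g \<longleftrightarrow>
     continuous_on A g \<and> (\<exists>G. continuous_on B G \<and> (\<forall>p\<in>A. G p = g p))"

definition quantile_shift :: "(real \<Rightarrow> real measure) \<Rightarrow> real \<Rightarrow> real \<Rightarrow> real" where
  "quantile_shift \<mu> y h = quantile (\<mu> h) (cdf (\<mu> 0) y)"

text \<open>The function \<open>D(y, t)\<close> of the differential equation. The convention for quantiles at 0 and 1
  makes it defined, and equal to 0, also for \<open>y\<close> outside the common support, where null sets of
  outcomes may lie.\<close>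

definition D_shift :: "(real \<Rightarrow> real measure) \<Rightarrow> real \<Rightarrow> real" where
  "D_shift \<mu> y = vector_derivative (quantile_shift \<mu> y) (at 0 within {0..})"

section \<open>Continuous solutions of the differential equation\<close>

text \<open>Here \<open>\<mu> t\<close> stands for the family of laws \<open>\<lambda>h. \<mu> t h\<close> at time \<open>t\<close> along one sample path, and
  \<open>J\<close> is the finite set of jump times of that path. The endpoints 0 and \<open>T\<close> delimit the first and the
  last interval. At a right endpoint the left limit of \<open>D_shift\<close> is used throughout; it is the value of \<open>D_shift\<close>
  if \<open>D_shift\<close> does not jump there.\<close>

definition continuous_solution ::
  "real \<Rightarrow> real set \<Rightarrow> (real \<Rightarrow> real \<Rightarrow> real measure) \<Rightarrow> real \<Rightarrow> (real \<Rightarrow> real) \<Rightarrow> bool" where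
  "continuous_solution T J \<mu> y x \<longleftrightarrow>
     continuous_on {0..T} x \<and> x T = y \<and>
     (\<forall>t1\<in>insert 0 (insert T J). \<forall>t2\<in>insert 0 (insert T J).
        t1 < t2 \<longrightarrow> {t1<..<t2} \<inter> J = {} \<longrightarrow>
          (\<forall>t\<in>{t1..<t2}. (x has_real_derivative D_shift (\<mu> t) (x t)) (at t within {t1..t2})) \<and>
          (\<exists>d. ((\<lambda>t. D_shift (\<mu> t) (x t2)) \<longlongrightarrow> d) (at_left t2) \<and>
               (x has_real_derivative d) (at t2 within {t1..t2})))"

end

theory Submission
  imports Defs
begin

text \<open>
  Write \<open>F h = cdf (\<mu> h)\<close> for the conditional distribution functions at a time \<open>t\<close>. Differentiating
  \<open>F h (quantile_shift \<mu> y h) = F 0 y\<close> at \<open>h = 0\<close> gives \<open>D = - (\<partial>F/\<partial>h) / (\<partial>F/\<partial>y)\<close>, which is bounded and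
  Lipschitz in \<open>y\<close>, vanishes outside the support and is right-continuous in \<open>t\<close>. Hence the backward
  equation has a unique flow, and \<open>X t\<close> is the flow from \<open>\<tau>\<close> to \<open>t\<close> started at \<open>Y\<close>.

  For an event \<open>A\<close> of the history up to \<open>t\<close> and a Lipschitz test function \<open>\<psi>\<close> consider
  \<open>U s = E [1\<^sub>A \<psi> (flow from s to t of Yc s)]\<close> for \<open>s \<in> [t, \<tau>]\<close>. Over a short step the flow from \<open>s + h\<close> to
  \<open>s\<close> is \<open>y - h D y + o(h)\<close>, while given the history up to \<open>s\<close> the law of \<open>Yc (s + h)\<close> is the image of
  that of \<open>Yc s\<close> under the quantile transform \<open>y + h D y + o(h)\<close>. The two effects cancel, so \<open>U\<close> has
  right derivative 0; being Lipschitz, it is constant. Under consistency \<open>U \<tau> = E [1\<^sub>A \<psi> (X t)]\<close>, and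
  \<open>U t = E [1\<^sub>A \<psi> (Yc t)]\<close>. Only dominated convergence is needed, so no uniformity in \<open>t\<close> or \<open>\<omega>\<close>.
\<close>

section \<open>Differential equations with right-continuous right-hand side\<close>

text \<open>Conditioning on the history up to \<open>s\<close> requires integrands measurable with
  respect to it, but the flow from \<open>s + h\<close> to \<open>s\<close> depends on the path
  after \<open>s\<close>. The increment of \<open>U\<close> is therefore split at
  \<open>q_step\<close>, where this piece of the flow is replaced by one Euler step with the field
  at \<open>s\<close>. The replacement error is estimated path by path at the actual value of
  \<open>Yc (s + h)\<close>; what remains depends on that value and on the history up to
  \<open>s\<close>, so the conditional law at \<open>s\<close> determines its mean. Every term
  contains a single outcome variable, which is why no joint law of the outcomes enters; the quantile
  transform moves conditional laws, not random variables. Jumps leave the field only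
  right-continuous in time, hence the one-sided derivative of \<open>U\<close>. Paths with
  infinitely many jumps form a null set that need not belong to the histories, so the flow is
  defined by explicit limits that are measurable over all paths and solve the equation on almost all
  of them. Lipschitz test functions are used because the flow is Lipschitz in its final value:
  errors of order o(h) in the state stay o(h) in the mean.\<close>

definition right_grid :: "nat \<Rightarrow> real \<Rightarrow> real" where
  "right_grid k u = (real_of_int \<lfloor>real (Suc k) * u\<rfloor> + 1) / real (Suc k)"

text \<open>Floor plus one instead of a ceiling moves grid points to the right as well; the strict
  inequality lets the samples converge through \<open>at_right u\<close>.\<close>

lemma right_grid_gt: "u < right_grid k u"
proof -
  have "real (Suc k) * u < real_of_int \<lfloor>real (Suc k) * u\<rfloor> + 1"
    by linarith
  then show ?thesis
    unfolding right_grid_def by (subst pos_less_divide_eq) (auto simp: mult.commute)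
qed

lemma right_grid_le: "right_grid k u \<le> u + 1 / real (Suc k)"
proof -
  have "real_of_int \<lfloor>real (Suc k) * u\<rfloor> + 1 \<le> real (Suc k) * u + 1"
    by linarith
  then have "right_grid k u \<le> (real (Suc k) * u + 1) / real (Suc k)"
    unfolding right_grid_def by (intro divide_right_mono) auto
  also have "\<dots> = u + 1 / real (Suc k)"
    by (simp add: field_simps del: of_nat_Suc)
  finally show ?thesis .
qed

lemma right_grid_LIMSEQ: "(\<lambda>k. right_grid k u) \<longlonglongrightarrow> u"
proof (rule tendsto_sandwich)
  show "\<forall>\<^sub>F k in sequentially. u \<le> right_grid k u"
    by (simp add: less_imp_le right_grid_gt)
  show "\<forall>\<^sub>F k in sequentially. right_grid k u \<le> u + 1 / real (Suc k)"
    by (simp add: right_grid_le del: of_nat_Suc)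
  have "(\<lambda>k. u + 1 / real (Suc k)) \<longlonglongrightarrow> u + 0"
    by (intro tendsto_add tendsto_const LIMSEQ_Suc lim_1_over_n)
  then show "(\<lambda>k. u + 1 / real (Suc k)) \<longlonglongrightarrow> u" by simp
qed simp

lemma filterlim_right_grid: "filterlim (\<lambda>k. right_grid k u) (at_right u) sequentially"
  unfolding filterlim_at using right_grid_gt[of u] right_grid_LIMSEQ[of u]
  by (auto intro!: always_eventually simp: less_imp_neq[THEN not_sym])

text \<open>Sampling the field on grids from the right, but never later than \<open>s\<close>, makes the solution
  measurable with respect to the history up to \<open>s\<close>, on exceptional paths as well.\<close>

definition reg :: "(real \<Rightarrow> real \<Rightarrow> real) \<Rightarrow> real \<Rightarrow> real \<Rightarrow> real \<Rightarrow> real" where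
  "reg D s u y = lim (\<lambda>k. D (min s (right_grid k u)) y)"

text \<open>Iterates of the integral equation with final value \<open>y\<close> at time
  \<open>s\<close>. The Lebesgue integral is total, so they are also defined and measurable on paths
  where the field is irregular.\<close>

primrec picard :: "(real \<Rightarrow> real \<Rightarrow> real) \<Rightarrow> real \<Rightarrow> nat \<Rightarrow> real \<Rightarrow> real \<Rightarrow> real" where
  "picard D s 0 t y = y"
| "picard D s (Suc n) t y = y - (LBINT u:{t..s}. reg D s u (picard D s n u y))"

text \<open>Value at time \<open>t\<close> of the solution that ends in \<open>y\<close> at time
  \<open>s\<close>. Since \<open>lim\<close> is total, measurability survives where the iterates
  diverge.\<close>

definition flow :: "(real \<Rightarrow> real \<Rightarrow> real) \<Rightarrow> real \<Rightarrow> real \<Rightarrow> real \<Rightarrow> real" where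
  "flow D s t y = lim (\<lambda>n. picard D s n t y)"

text \<open>Rounding \<open>z x\<close> to a grid leaves countably many values, and for each of them
  the second argument is fixed. Continuity in that argument removes the rounding.\<close>

lemma borel_measurable_caratheodory:
  fixes F :: "'x \<Rightarrow> real \<Rightarrow> real"
  assumes F: "\<And>y. (\<lambda>x. F x y) \<in> borel_measurable N"
    and cont: "\<And>x. x \<in> space N \<Longrightarrow> continuous_on UNIV (F x)"
    and z[measurable]: "z \<in> borel_measurable N"
  shows "(\<lambda>x. F x (z x)) \<in> borel_measurable N"
proof (rule borel_measurable_LIMSEQ_metric)
  fix k
  show "(\<lambda>x. F x (right_grid k (z x))) \<in> borel_measurable N"
    unfolding right_grid_def
    by (rule measurable_compose_countable[where
          g = "\<lambda>x. \<lfloor>real (Suc k) * z x\<rfloor>" and f = "\<lambda>i x. F x ((real_of_int i + 1) / real (Suc k))"])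
      (use F in auto)
next
  fix x assume "x \<in> space N"
  then have "continuous_on UNIV (F x)" by (rule cont)
  then show "(\<lambda>k. F x (right_grid k (z x))) \<longlonglongrightarrow> F x (z x)"
    by (rule continuous_on_tendsto_compose[OF _ right_grid_LIMSEQ]) auto
qed

text \<open>Now the time is rounded too. Because \<open>reg\<close> clips the samples at
  \<open>s\<close>, measurability at times \<open>v \<le> s\<close> is enough, and that is what
  adaptedness to the history up to \<open>s\<close> provides.\<close>

lemma borel_measurable_reg:
  fixes F :: "'x \<Rightarrow> real \<Rightarrow> real \<Rightarrow> real"
  assumes F: "\<And>v y. v \<le> s \<Longrightarrow> (\<lambda>x. F x v y) \<in> borel_measurable N"
    and cont: "\<And>x v. x \<in> space N \<Longrightarrow> continuous_on UNIV (F x v)"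
    and g[measurable]: "g \<in> borel_measurable N" and z[measurable]: "z \<in> borel_measurable N"
  shows "(\<lambda>x. reg (F x) s (g x) (z x)) \<in> borel_measurable N"
  unfolding reg_def
proof (rule borel_measurable_lim_metric)
  fix k
  have "(\<lambda>x. F x (min s v) (z x)) \<in> borel_measurable N" for v
    by (rule borel_measurable_caratheodory[where F = "\<lambda>x. F x (min s v)"]) (use F cont in auto)
  then show "(\<lambda>x. F x (min s (right_grid k (g x))) (z x)) \<in> borel_measurable N"
    unfolding right_grid_def
    by (intro measurable_compose_countable[where g = "\<lambda>x. \<lfloor>real (Suc k) * g x\<rfloor>" and
          f = "\<lambda>i x. F x (min s ((real_of_int i + 1) / real (Suc k))) (z x)"]) auto
qed

text \<open>The induction needs joint measurability in path, time and value, because each iterate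
  integrates the previous one over time.\<close>

lemma borel_measurable_picard:
  fixes F :: "'x \<Rightarrow> real \<Rightarrow> real \<Rightarrow> real"
  assumes F: "\<And>v y. v \<le> s \<Longrightarrow> (\<lambda>x. F x v y) \<in> borel_measurable N"
    and cont: "\<And>x v. x \<in> space N \<Longrightarrow> continuous_on UNIV (F x v)"
  shows "(\<lambda>p. picard (F (fst p)) s n (fst (snd p)) (snd (snd p)))
    \<in> borel_measurable (N \<Otimes>\<^sub>M (borel \<Otimes>\<^sub>M borel))"
proof (induction n)
  case 0
  have "(\<lambda>p. snd (snd p)) \<in> borel_measurable (N \<Otimes>\<^sub>M (borel \<Otimes>\<^sub>M borel))"
    by measurable
  then show ?case by simp
next
  case (Suc n)
  let ?P = "(N \<Otimes>\<^sub>M (borel \<Otimes>\<^sub>M borel)) \<Otimes>\<^sub>M lborel"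
  have fstM: "(\<lambda>q. fst (fst q)) \<in> ?P \<rightarrow>\<^sub>M N" by measurable
  have "(\<lambda>q. (fst (fst q), snd q, snd (snd (fst q)))) \<in> ?P \<rightarrow>\<^sub>M N \<Otimes>\<^sub>M (borel \<Otimes>\<^sub>M borel)"
    by measurable
  from measurable_compose[OF this Suc]
  have *: "(\<lambda>q. picard (F (fst (fst q))) s n (snd q) (snd (snd (fst q)))) \<in> borel_measurable ?P"
    by simp
  have [measurable]: "(\<lambda>q. reg (F (fst (fst q))) s (snd q)
      (picard (F (fst (fst q))) s n (snd q) (snd (snd (fst q))))) \<in> borel_measurable ?P"
  proof (rule borel_measurable_reg[OF _ _ _ *])
    show "(\<lambda>q. F (fst (fst q)) v y) \<in> borel_measurable ?P" if "v \<le> s" for v y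
      by (rule measurable_compose[OF fstM F[OF that]])
    show "continuous_on UNIV (F (fst (fst q)) v)" if "q \<in> space ?P" for q v
      using that by (intro cont) (auto simp: space_pair_measure)
  qed measurable
  \<comment> \<open>The domain of integration depends on the parameter \<open>t\<close>; writing it
    as a condition inside the integrand leaves an integral over the fixed measure
    \<open>lborel\<close>.\<close>
  have "(\<lambda>p. \<integral>u. (if fst (snd p) \<le> u \<and> u \<le> s then
       reg (F (fst p)) s u (picard (F (fst p)) s n u (snd (snd p))) else 0) \<partial>lborel)
     \<in> borel_measurable (N \<Otimes>\<^sub>M (borel \<Otimes>\<^sub>M borel))"
    by (rule lborel.borel_measurable_lebesgue_integral) (simp add: case_prod_beta)
  moreover have "(if t \<le> u \<and> u \<le> s then r else 0) = indicator {t..s} u *\<^sub>R (r::real)" for t u r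
    by (auto simp: indicator_def)
  ultimately show ?case
    by (simp add: set_lebesgue_integral_def)
qed

lemma borel_measurable_flow:
  fixes F :: "'x \<Rightarrow> real \<Rightarrow> real \<Rightarrow> real"
  assumes F: "\<And>v y. v \<le> s \<Longrightarrow> (\<lambda>x. F x v y) \<in> borel_measurable N"
    and cont: "\<And>x v. x \<in> space N \<Longrightarrow> continuous_on UNIV (F x v)"
    and z[measurable]: "z \<in> borel_measurable N"
  shows "(\<lambda>x. flow (F x) s t (z x)) \<in> borel_measurable N"
  unfolding flow_def
proof (rule borel_measurable_lim_metric)
  fix n
  have "(\<lambda>x. (x, t, z x)) \<in> N \<rightarrow>\<^sub>M N \<Otimes>\<^sub>M (borel \<Otimes>\<^sub>M borel)" by measurable
  from measurable_compose[OF this borel_measurable_picard[of s F N n, OF F cont]]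
  show "(\<lambda>x. picard (F x) s n t (z x)) \<in> borel_measurable N" by simp
qed

section \<open>Integrals of bounded functions and a backward Gronwall inequality\<close>

lemma set_integrable_bounded_Icc:
  fixes f :: "real \<Rightarrow> real"
  assumes [measurable]: "f \<in> borel_measurable borel" and B: "\<And>u. u \<in> {a..b} \<Longrightarrow> \<bar>f u\<bar> \<le> B"
  shows "set_integrable lborel {a..b} f"
  unfolding set_integrable_def
proof (rule integrableI_bounded_set_indicator[where B = B])
  show "AE x in lborel. x \<in> {a..b} \<longrightarrow> norm (f x) \<le> B" using B by auto
qed (auto simp: emeasure_lborel_Icc_eq)

lemma integrable_on_bounded_Icc:
  fixes f :: "real \<Rightarrow> real"
  assumes "f \<in> borel_measurable borel" "\<And>u. u \<in> {a..b} \<Longrightarrow> \<bar>f u\<bar> \<le> B"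
  shows "f integrable_on {a..b}" "(LBINT u:{a..b}. f u) = integral {a..b} f"
  using set_borel_integral_eq_integral[OF set_integrable_bounded_Icc[OF assms]] by auto

lemma abs_integral_le_Icc:
  fixes f :: "real \<Rightarrow> real"
  assumes "f integrable_on {a..b}" "a \<le> b" "\<And>u. u \<in> {a..b} \<Longrightarrow> \<bar>f u\<bar> \<le> B"
  shows "\<bar>integral {a..b} f\<bar> \<le> B * (b - a)"
proof -
  have "\<bar>integral {a..b} f\<bar> \<le> integral {a..b} (\<lambda>_. B)"
    using assms integral_norm_bound_integral[of f "{a..b}" "\<lambda>_. B"] by auto
  then show ?thesis using \<open>a \<le> b\<close> by (simp add: mult.commute)
qed

lemma has_integral_exp_weight:
  fixes L s t :: real
  assumes "0 < L" "t \<le> s"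
  shows "((\<lambda>u. exp (2 * L * (s - u))) has_integral (exp (2 * L * (s - t)) - 1) / (2 * L)) {t..s}"
proof -
  have "((\<lambda>u. exp (2 * L * (s - u))) has_integral
      (- exp (2 * L * (s - s)) / (2 * L)) - (- exp (2 * L * (s - t)) / (2 * L))) {t..s}"
    using \<open>0 < L\<close>
    by (intro fundamental_theorem_of_calculus \<open>t \<le> s\<close>)
      (auto simp flip: has_real_derivative_iff_has_vector_derivative
        intro!: derivative_eq_intros)
  then show ?thesis by (simp add: diff_divide_distrib)
qed

text \<open>Comparing with the weight \<open>exp (2 * L * (s - t))\<close> makes the integral operator a contraction
  by the factor 1/2.\<close>

lemma gronwall_backward:
  fixes d :: "real \<Rightarrow> real"
  assumes int: "d integrable_on {r..s}" and "0 < L" "0 \<le> c"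
    and bd: "\<And>u. u \<in> {r..s} \<Longrightarrow> 0 \<le> d u \<and> d u \<le> K"
    and le: "\<And>t. t \<in> {r..s} \<Longrightarrow> d t \<le> c + L * integral {t..s} d"
    and t: "t \<in> {r..s}"
  shows "d t \<le> 2 * c * exp (2 * L * (s - t))"
proof -
  define w where "w t = exp (2 * L * (s - t))" for t
  have w1: "1 \<le> w u" if "u \<in> {r..s}" for u
    using that \<open>0 < L\<close> unfolding w_def by simp
  \<comment> \<open>\<open>m\<close> will be the smallest constant with \<open>d \<le> m * w\<close>
    on the interval. The a priori bound \<open>K\<close> makes it finite, so that
    \<open>m \<le> c + m / 2\<close> can be absorbed into \<open>m \<le> 2 * c\<close>.\<close>
  define A where "A = (\<lambda>t. d t / w t) ` {r..s}"
  define m where "m = Sup A"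
  have bdd: "bdd_above A"
  proof (rule bdd_aboveI[of _ K], unfold A_def, safe)
    fix u assume u: "u \<in> {r..s}"
    have "d u / w u \<le> d u / 1"
      using w1[OF u] bd[OF u] by (intro divide_left_mono) auto
    then show "d u / w u \<le> K" using bd[OF u] by auto
  qed
  have dm: "d u \<le> m * w u" if u: "u \<in> {r..s}" for u
  proof -
    have "d u / w u \<le> m"
      unfolding m_def using u by (intro cSup_upper bdd) (auto simp: A_def)
    then show ?thesis using w1[OF u] by (simp add: divide_le_eq)
  qed
  have m0: "0 \<le> m"
  proof -
    have "0 \<le> d t / w t" using bd[OF t] w1[OF t] by simp
    also have "\<dots> \<le> m" unfolding m_def using t by (intro cSup_upper bdd) (auto simp: A_def)
    finally show ?thesis .
  qed
  have "x \<le> c + m / 2" if "x \<in> A" for x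
  proof -
    from that obtain u where u: "u \<in> {r..s}" and x: "x = d u / w u" by (auto simp: A_def)
    have wi: "(w has_integral (w u - 1) / (2 * L)) {u..s}"
      unfolding w_def using has_integral_exp_weight[OF \<open>0 < L\<close>, of u s] u by auto
    have "integral {u..s} d \<le> integral {u..s} (\<lambda>v. m * w v)"
    proof (rule integral_le)
      show "d integrable_on {u..s}"
        using integrable_on_subinterval[OF int, of u s] u by auto
      show "(\<lambda>v. m * w v) integrable_on {u..s}"
        using has_integral_mult_right[OF wi] by blast
    qed (use u dm in auto)
    also have "\<dots> = m * ((w u - 1) / (2 * L))"
      using integral_unique[OF has_integral_mult_right[OF wi]] by simp
    finally have "L * integral {u..s} d \<le> L * (m * ((w u - 1) / (2 * L)))"
      using \<open>0 < L\<close> by (intro mult_left_mono) auto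
    also have "\<dots> = m / 2 * (w u - 1)" using \<open>0 < L\<close> by (simp add: field_simps)
    also have "\<dots> \<le> m / 2 * w u" using m0 by (simp add: algebra_simps)
    finally have "d u \<le> c + m / 2 * w u" using le[OF u] by linarith
    also have "\<dots> \<le> c * w u + m / 2 * w u"
      using mult_left_mono[OF w1[OF u] \<open>0 \<le> c\<close>] by simp
    finally show ?thesis
      unfolding x using w1[OF u] by (subst pos_divide_le_eq) (auto simp: algebra_simps)
  qed
  then have "m \<le> c + m / 2"
    unfolding m_def using t by (intro cSup_least) (auto simp: A_def)
  then have "m \<le> 2 * c" by linarith
  then have "m * w t \<le> 2 * c * w t" using w1[OF t] by (intro mult_right_mono) auto
  then show ?thesis using dm[OF t] unfolding w_def by linarith
qed

locale rc_field =
  fixes D :: "real \<Rightarrow> real \<Rightarrow> real" and B L :: real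
  assumes bound: "\<bar>D u y\<bar> \<le> B"
    and lipschitz: "\<bar>D u y - D u z\<bar> \<le> L * \<bar>y - z\<bar>"
    and L_pos: "0 < L"
    and right_cont: "0 < e \<Longrightarrow> \<forall>\<^sub>F v in at_right u. \<forall>y. \<bar>D v y - D u y\<bar> \<le> e"
begin

section \<open>Picard iteration for a right-continuous Lipschitz field\<close>

lemma B_nonneg: "0 \<le> B"
  using bound[of 0 0] by linarith

lemma continuous_D: "continuous_on A (D u)"
proof (rule continuous_onI)
  fix y e :: real assume "0 < e"
  show "\<exists>d>0. \<forall>z\<in>A. dist z y < d \<longrightarrow> dist (D u z) (D u y) \<le> e"
  proof (intro exI[of _ "e / L"] conjI ballI impI)
    fix z assume "dist z y < e / L"
    then have "L * \<bar>z - y\<bar> \<le> e"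
      using L_pos by (simp add: dist_real_def field_simps)
    then show "dist (D u z) (D u y) \<le> e"
      using lipschitz[of u z y] by (simp add: dist_real_def)
  qed (use \<open>0 < e\<close> L_pos in auto)
qed

lemma tendsto_right: "((\<lambda>v. D v y) \<longlongrightarrow> D u y) (at_right u)"
proof (rule tendstoI)
  fix e :: real assume "0 < e"
  show "\<forall>\<^sub>F v in at_right u. dist (D v y) (D u y) < e"
    using right_cont[of "e / 2" u] \<open>0 < e\<close>
    by (auto elim!: eventually_mono simp: dist_real_def dest!: spec[of _ y])
qed

text \<open>Before \<open>s\<close> the samples eventually lie between \<open>u\<close> and
  \<open>s\<close>, where right-continuity applies; from \<open>s\<close> on every sample is clipped
  to \<open>s\<close>. On regular paths the sampling thus changes nothing up to
  \<open>s\<close>.\<close>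

lemma reg_eq: "reg D s u y = D (min s u) y"
proof (cases "u < s")
  case True
  have "(\<lambda>k. D (right_grid k u) y) \<longlonglongrightarrow> D u y"
    by (rule filterlim_compose[OF tendsto_right filterlim_right_grid])
  moreover have "\<forall>\<^sub>F k in sequentially. right_grid k u < s"
    by (rule order_tendstoD(2)[OF right_grid_LIMSEQ True])
  then have "\<forall>\<^sub>F k in sequentially. D (min s (right_grid k u)) y = D (right_grid k u) y"
    by (rule eventually_mono) simp
  ultimately have "(\<lambda>k. D (min s (right_grid k u)) y) \<longlonglongrightarrow> D u y"
    by (subst tendsto_cong) auto
  then show ?thesis using True unfolding reg_def by (simp add: limI)
next
  case False
  then have "min s (right_grid k u) = s" for k
    using right_grid_gt[of u k] by simp
  then show ?thesis using False unfolding reg_def by (simp add: limI min_def)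
qed

text \<open>Measurability comes from \<open>reg\<close>, which freezes the field after its final
  time. Letting that time run through the naturals recovers the field at every
  \<open>u\<close>.\<close>

lemma borel_measurable_D:
  assumes [measurable]: "x \<in> borel_measurable borel"
  shows "(\<lambda>u. D u (x u)) \<in> borel_measurable borel"
proof (rule borel_measurable_LIMSEQ_metric)
  fix n :: nat
  have "(\<lambda>u. reg D (real n) u (x u)) \<in> borel_measurable borel"
    by (rule borel_measurable_reg[where F = "\<lambda>_. D" and g = "\<lambda>u. u"])
      (auto intro: continuous_D)
  then show "(\<lambda>u. D (min (real n) u) (x u)) \<in> borel_measurable borel"
    by (simp add: reg_eq)
next
  fix u :: real
  have "\<forall>\<^sub>F n in sequentially. u \<le> real n"
    using filterlim_real_sequentially by (auto simp: filterlim_at_top)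
  then have "\<forall>\<^sub>F n in sequentially. D (min (real n) u) (x u) = D u (x u)"
    by (rule eventually_mono) (simp add: min_def)
  then show "(\<lambda>n. D (min (real n) u) (x u)) \<longlonglongrightarrow> D u (x u)"
    by (rule tendsto_eventually)
qed

lemma D_integrable:
  assumes "x \<in> borel_measurable borel"
  shows "(\<lambda>u. D u (x u)) integrable_on {a..b}"
  by (rule integrable_on_bounded_Icc[OF borel_measurable_D[OF assms] bound])

lemma picard_measurable: "(\<lambda>t. picard D s n t y) \<in> borel_measurable borel"
proof -
  have "(\<lambda>t. (undefined, t, y)) \<in> borel \<rightarrow>\<^sub>M count_space UNIV \<Otimes>\<^sub>M (borel \<Otimes>\<^sub>M borel)"
    by measurable
  from measurable_compose[OF this borel_measurable_picard[of s "\<lambda>_. D" "count_space UNIV" n]]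
  show ?thesis by (simp add: continuous_D)
qed

lemma picard_Suc: "picard D s (Suc n) t y = y - integral {t..s} (\<lambda>u. D u (picard D s n u y))"
proof -
  have "picard D s (Suc n) t y = y - (LBINT u:{t..s}. D (min s u) (picard D s n u y))"
    by (simp add: reg_eq)
  also have "(LBINT u:{t..s}. D (min s u) (picard D s n u y))
      = (LBINT u:{t..s}. D u (picard D s n u y))"
    by (rule set_lebesgue_integral_cong) (auto simp: min_def)
  also have "\<dots> = integral {t..s} (\<lambda>u. D u (picard D s n u y))"
    by (rule integrable_on_bounded_Icc[OF borel_measurable_D[OF picard_measurable] bound])
  finally show ?thesis .
qed

text \<open>Relative to the weight \<open>exp (2 * L * (s - t))\<close> one iteration contracts by
  1/2 on intervals of any length. The constant \<open>B / (2 * L)\<close> stems from the first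
  difference, by \<open>B * (s - t) = B / (2 * L) * (2 * L * (s - t))\<close> and
  \<open>x \<le> exp x\<close>.\<close>

lemma picard_diff:
  assumes "t \<le> s"
  shows "\<bar>picard D s (Suc n) t y - picard D s n t y\<bar>
    \<le> B / (2 * L) * (1 / 2) ^ n * exp (2 * L * (s - t))"
  using assms
proof (induction n arbitrary: t)
  case 0
  have "\<bar>picard D s (Suc 0) t y - picard D s 0 t y\<bar> = \<bar>integral {t..s} (\<lambda>u. D u y)\<bar>"
    using picard_Suc[of s 0 t y] by simp
  also have "\<dots> \<le> B * (s - t)"
    by (rule abs_integral_le_Icc[OF D_integrable 0 bound]) simp
  also have "\<dots> = B / (2 * L) * (2 * L * (s - t))"
    using L_pos by simp
  also have "\<dots> \<le> B / (2 * L) * exp (2 * L * (s - t))"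
    using L_pos B_nonneg exp_ge_add_one_self[of "2 * L * (s - t)"]
    by (intro mult_left_mono) (linarith, simp)
  finally show ?case by simp
next
  case (Suc n)
  let ?p = "\<lambda>n u. picard D s n u y" and ?c = "B / (2 * L) * (1 / 2) ^ n"
  have "\<bar>?p (Suc (Suc n)) t - ?p (Suc n) t\<bar>
      = \<bar>integral {t..s} (\<lambda>u. D u (?p n u) - D u (?p (Suc n) u))\<bar>"
    unfolding picard_Suc[of s "Suc n" t y] picard_Suc[of s n t y]
    by (subst Henstock_Kurzweil_Integration.integral_diff)
      (auto intro!: D_integrable picard_measurable simp del: picard.simps)
  also have "\<dots> \<le> integral {t..s} (\<lambda>u. L * ?c * exp (2 * L * (s - u)))"
  proof (rule integral_norm_bound_integral[where 'a = real, simplified real_norm_def])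
    show "(\<lambda>u. D u (?p n u) - D u (?p (Suc n) u)) integrable_on {t..s}"
      by (intro integrable_diff D_integrable picard_measurable)
    show "(\<lambda>u. L * ?c * exp (2 * L * (s - u))) integrable_on {t..s}"
      using has_integral_mult_right[OF has_integral_exp_weight[OF L_pos Suc.prems]] by blast
    show "\<bar>D u (?p n u) - D u (?p (Suc n) u)\<bar> \<le> L * ?c * exp (2 * L * (s - u))"
      if "u \<in> {t..s}" for u
    proof -
      have "\<bar>D u (?p n u) - D u (?p (Suc n) u)\<bar> \<le> L * \<bar>?p (Suc n) u - ?p n u\<bar>"
        using lipschitz[of u "?p n u" "?p (Suc n) u"] by (simp only: abs_minus_commute)
      also have "\<dots> \<le> L * (?c * exp (2 * L * (s - u)))"
        using Suc.IH[of u] that L_pos by (intro mult_left_mono) (auto simp del: picard.simps)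
      finally show ?thesis by (simp only: mult.assoc)
    qed
  qed
  also have "\<dots> = L * ?c * ((exp (2 * L * (s - t)) - 1) / (2 * L))"
    using integral_unique[OF has_integral_mult_right[OF has_integral_exp_weight[OF L_pos Suc.prems]]]
    by blast
  also have "\<dots> = ?c / 2 * (exp (2 * L * (s - t)) - 1)"
    using L_pos by (simp add: field_simps)
  also have "\<dots> \<le> ?c / 2 * exp (2 * L * (s - t))"
    using L_pos B_nonneg by (intro mult_left_mono) auto
  finally show ?case by simp
qed

lemma picard_tendsto:
  assumes "t \<le> s"
  shows "(\<lambda>n. picard D s n t y) \<longlonglongrightarrow> flow D s t y"
proof -
  have "summable (\<lambda>n. B / (2 * L) * (1 / 2) ^ n * exp (2 * L * (s - t)))"
    by (intro summable_mult summable_mult2 summable_geometric) simp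
  then have "summable (\<lambda>n. picard D s (Suc n) t y - picard D s n t y)"
    by (rule summable_comparison_test'[where N = 0])
      (use picard_diff[OF assms] in \<open>auto simp del: picard.simps\<close>)
  then have "convergent (\<lambda>n. \<Sum>i<n. picard D s (Suc i) t y - picard D s i t y)"
    by (simp add: summable_iff_convergent del: picard.simps)
  then have "convergent (\<lambda>n. picard D s n t y - picard D s 0 t y)"
    by (subst (asm) sum_lessThan_telescope)
  then have "convergent (\<lambda>n. (picard D s n t y - picard D s 0 t y) + y)"
    by (intro convergent_add convergent_const)
  then have "convergent (\<lambda>n. picard D s n t y)" by simp
  then show ?thesis by (simp add: flow_def convergent_LIMSEQ_iff)
qed

lemma flow_beyond: "s \<le> t \<Longrightarrow> flow D s t y = y"
proof -
  assume "s \<le> t"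
  then have "picard D s n t y = y" for n
    by (cases n; cases "s = t") (auto simp: picard_Suc simp del: picard.simps(2))
  then show ?thesis by (simp add: flow_def limI)
qed

section \<open>The flow as a solution of the integral equation\<close>

lemma flow_measurable: "(\<lambda>t. flow D s t y) \<in> borel_measurable borel"
  unfolding flow_def by (intro borel_measurable_lim_metric picard_measurable)

lemma flow_integral_equation:
  assumes "t \<le> s"
  shows "flow D s t y = y - integral {t..s} (\<lambda>u. D u (flow D s u y))"
proof -
  have "(\<lambda>n. integral {t..s} (\<lambda>u. D u (picard D s n u y)))
      \<longlonglongrightarrow> integral {t..s} (\<lambda>u. D u (flow D s u y))"
  proof (rule dominated_convergence(2)[where h = "\<lambda>_. B"])
    show "(\<lambda>u. D u (picard D s n u y)) integrable_on {t..s}" for n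
      by (intro D_integrable picard_measurable)
    show "(\<lambda>n. D u (picard D s n u y)) \<longlonglongrightarrow> D u (flow D s u y)" if "u \<in> {t..s}" for u
      using that
      by (intro continuous_on_tendsto_compose[OF continuous_D[of UNIV]] picard_tendsto) auto
  qed (auto simp: bound)
  then have "(\<lambda>n. picard D s (Suc n) t y) \<longlonglongrightarrow> y - integral {t..s} (\<lambda>u. D u (flow D s u y))"
    unfolding picard_Suc by (intro tendsto_intros)
  then show ?thesis
    using LIMSEQ_unique LIMSEQ_Suc[OF picard_tendsto[OF assms]] by blast
qed

lemma flow_increment:
  assumes "r \<le> t" "t \<le> s"
  shows "flow D s t y - flow D s r y = integral {r..t} (\<lambda>u. D u (flow D s u y))"
proof -
  have "integral {r..t} (\<lambda>u. D u (flow D s u y)) + integral {t..s} (\<lambda>u. D u (flow D s u y))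
      = integral {r..s} (\<lambda>u. D u (flow D s u y))"
    using assms by (intro Henstock_Kurzweil_Integration.integral_combine D_integrable flow_measurable) auto
  then show ?thesis
    using flow_integral_equation[of t s y] flow_integral_equation[of r s y] assms by simp
qed

lemma flow_lipschitz_time:
  assumes "r \<le> t" "t \<le> s"
  shows "\<bar>flow D s t y - flow D s r y\<bar> \<le> B * (t - r)"
  unfolding flow_increment[OF assms]
  by (rule abs_integral_le_Icc[OF D_integrable[OF flow_measurable] \<open>r \<le> t\<close> bound])

lemma continuous_flow: "continuous_on {..s} (\<lambda>t. flow D s t y)"
proof (rule continuous_onI)
  fix t e :: real assume "0 < e" "t \<in> {..s}"
  show "\<exists>d>0. \<forall>z\<in>{..s}. dist z t < d \<longrightarrow> dist (flow D s z y) (flow D s t y) \<le> e"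
  proof (intro exI[of _ "e / (B + 1)"] conjI ballI impI)
    fix z assume z: "z \<in> {..s}" "dist z t < e / (B + 1)"
    then have "(B + 1) * \<bar>z - t\<bar> \<le> e"
      using B_nonneg by (simp add: dist_real_def field_simps)
    moreover have "\<bar>flow D s z y - flow D s t y\<bar> \<le> B * \<bar>z - t\<bar>"
      using flow_lipschitz_time[of z t s y] flow_lipschitz_time[of t z s y] z \<open>t \<in> {..s}\<close>
      by (cases "z \<le> t") (auto simp: abs_minus_commute)
    moreover have "B * \<bar>z - t\<bar> \<le> (B + 1) * \<bar>z - t\<bar>"
      by (intro mult_right_mono) auto
    ultimately show "dist (flow D s z y) (flow D s t y) \<le> e"
      by (simp add: dist_real_def)
  qed (use \<open>0 < e\<close> B_nonneg in auto)
qed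

text \<open>Formulated for arbitrary integral solutions instead of flows: the same estimate then
  gives Lipschitz dependence on the final value, uniqueness and the semigroup property.\<close>

lemma solution_stability:
  assumes contx: "continuous_on {r..s} x" and contz: "continuous_on {r..s} z"
    and intx: "(\<lambda>u. D u (x u)) integrable_on {r..s}"
    and intz: "(\<lambda>u. D u (z u)) integrable_on {r..s}"
    and x: "\<And>t. t \<in> {r..s} \<Longrightarrow> x t = a - integral {t..s} (\<lambda>u. D u (x u))"
    and z: "\<And>t. t \<in> {r..s} \<Longrightarrow> z t = b - integral {t..s} (\<lambda>u. D u (z u))"
    and t: "t \<in> {r..s}"
  shows "\<bar>x t - z t\<bar> \<le> 2 * \<bar>a - b\<bar> * exp (2 * L * (s - t))"
proof -
  have cont: "continuous_on {r..s} (\<lambda>t. \<bar>x t - z t\<bar>)"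
    by (intro continuous_intros contx contz)
  then have dint: "(\<lambda>t. \<bar>x t - z t\<bar>) integrable_on {r..s}"
    by (rule integrable_continuous_real)
  \<comment> \<open>Compactness supplies the a priori bound that the Gronwall argument needs for its
    supremum.\<close>
  obtain K where K: "\<And>u. u \<in> {r..s} \<Longrightarrow> norm \<bar>x u - z u\<bar> \<le> K"
    using compact_imp_bounded[OF compact_continuous_image[OF cont compact_Icc]]
    unfolding bounded_iff by blast
  have le: "\<bar>x u - z u\<bar> \<le> \<bar>a - b\<bar> + L * integral {u..s} (\<lambda>v. \<bar>x v - z v\<bar>)"
    if u: "u \<in> {r..s}" for u
  proof -
    have sub: "f integrable_on {u..s}" if "f integrable_on {r..s}" for f :: "real \<Rightarrow> real"
      using integrable_on_subinterval[OF that, of u s] u by auto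
    have "x u - z u = (a - b) - integral {u..s} (\<lambda>v. D v (x v) - D v (z v))"
      using x[OF u] z[OF u]
      by (simp add: Henstock_Kurzweil_Integration.integral_diff[OF sub[OF intx] sub[OF intz]])
    moreover have "\<bar>integral {u..s} (\<lambda>v. D v (x v) - D v (z v))\<bar>
        \<le> integral {u..s} (\<lambda>v. L * \<bar>x v - z v\<bar>)"
      using lipschitz
      by (intro integral_norm_bound_integral[where 'a = real, simplified real_norm_def]
          integrable_diff sub[OF intx] sub[OF intz] integrable_on_mult_right sub[OF dint])
    ultimately show ?thesis by simp
  qed
  show ?thesis
    by (rule gronwall_backward[OF dint L_pos _ _ le t]) (use K in auto)
qed

lemma continuous_flow_Icc: "t \<le> s \<Longrightarrow> continuous_on {r..t} (\<lambda>t. flow D s t y)"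
  by (rule continuous_on_subset[OF continuous_flow]) auto

lemma flow_lipschitz:
  assumes "t \<le> s"
  shows "\<bar>flow D s t y - flow D s t z\<bar> \<le> 2 * exp (2 * L * (s - t)) * \<bar>y - z\<bar>"
proof -
  have "\<bar>flow D s t y - flow D s t z\<bar> \<le> 2 * \<bar>y - z\<bar> * exp (2 * L * (s - t))"
    by (rule solution_stability[where r = t])
      (use assms in \<open>auto intro!: continuous_flow_Icc D_integrable flow_measurable
        flow_integral_equation\<close>)
  then show ?thesis by (simp add: mult_ac)
qed

text \<open>The finite set \<open>S\<close> absorbs the jump times, where the two one-sided
  derivatives may differ. Continuity of \<open>x\<close> lets the fundamental theorem of calculus
  pass over them.\<close>

lemma flow_unique:
  assumes cont: "continuous_on {r..s} x" and "finite S"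
    and der: "\<And>u. u \<in> {r<..<s} - S \<Longrightarrow> (x has_real_derivative D u (x u)) (at u)"
    and t: "t \<in> {r..s}"
  shows "x t = flow D s t (x s)"
proof -
  have hi: "((\<lambda>u. D u (x u)) has_integral x s - x u) {u..s}" if u: "u \<in> {r..s}" for u
    by (rule fundamental_theorem_of_calculus_interior_strong[OF \<open>finite S\<close>])
      (use u der continuous_on_subset[OF cont] in
        \<open>auto simp flip: has_real_derivative_iff_has_vector_derivative\<close>)
  have "\<bar>x t - flow D s t (x s)\<bar> \<le> 2 * \<bar>x s - x s\<bar> * exp (2 * L * (s - t))"
  proof (rule solution_stability[OF cont _ _ _ _ _ t])
    show "(\<lambda>u. D u (x u)) integrable_on {r..s}"
      using hi[of r] t by auto
    show "x u = x s - integral {u..s} (\<lambda>v. D v (x v))" if "u \<in> {r..s}" for u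
      using integral_unique[OF hi[OF that]] by simp
  qed (auto intro!: continuous_flow_Icc D_integrable flow_measurable flow_integral_equation)
  then show ?thesis by simp
qed

text \<open>Before \<open>t\<close> the flow from \<open>s\<close> solves the integral equation with
  final value \<open>flow D s t y\<close> at \<open>t\<close>, so stability with equal final values
  applies.\<close>

lemma flow_semigroup:
  assumes "r \<le> t" "t \<le> s"
  shows "flow D s r y = flow D t r (flow D s t y)"
proof -
  have "\<bar>flow D s r y - flow D t r (flow D s t y)\<bar>
      \<le> 2 * \<bar>flow D s t y - flow D s t y\<bar> * exp (2 * L * (t - r))"
  proof (rule solution_stability[where r = r])
    show "flow D s u y = flow D s t y - integral {u..t} (\<lambda>v. D v (flow D s v y))"
      if "u \<in> {r..t}" for u
      using flow_increment[of u t s y] that assms by simp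
  qed (use assms in \<open>auto intro!: continuous_flow_Icc D_integrable flow_measurable
        flow_integral_equation\<close>)
  then show ?thesis by simp
qed

text \<open>\<open>G\<close> continues the field to \<open>t2\<close> by its left limit. The single
  time \<open>t2\<close> does not affect the integral, so the flow is an integral of a continuous
  function, and its derivative at \<open>t2\<close> from inside the interval is the value of
  \<open>G\<close>, even if the field jumps there.\<close>

lemma flow_derivative:
  assumes "t1 < t2" "t2 \<le> s"
    and G: "continuous_on ({t1..t2} \<times> UNIV) (\<lambda>(u, y). G u y)"
    and eq: "\<And>u y. u \<in> {t1..<t2} \<Longrightarrow> G u y = D u y"
    and t: "t \<in> {t1..t2}"
  shows "((\<lambda>t. flow D s t y) has_real_derivative G t (flow D s t y)) (at t within {t1..t2})"
proof -
  let ?x = "\<lambda>t. flow D s t y"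
  have "continuous_on {t1..t2} (\<lambda>u. (\<lambda>(u, y). G u y) (u, ?x u))"
    by (rule continuous_on_compose2[OF G])
      (auto intro!: continuous_intros continuous_flow_Icc \<open>t2 \<le> s\<close>)
  then have cont: "continuous_on {t1..t2} (\<lambda>u. G u (?x u))" by simp
  have "((\<lambda>u. integral {t1..u} (\<lambda>v. G v (?x v))) has_real_derivative G t (?x t)) (at t within {t1..t2})"
    by (rule integral_has_real_derivative[OF cont t])
  then have "((\<lambda>u. ?x t1 + integral {t1..u} (\<lambda>v. G v (?x v))) has_real_derivative G t (?x t))
      (at t within {t1..t2})"
    by (auto intro!: derivative_eq_intros)
  then show ?thesis
  proof (rule has_field_derivative_transform_within[OF _ zero_less_one t])
    fix u assume u: "u \<in> {t1..t2}"
    have "integral {t1..u} (\<lambda>v. G v (?x v)) = integral {t1..u} (\<lambda>v. D v (?x v))"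
      by (rule integral_spike[of "{t2}"]) (use u eq in auto)
    then show "?x t1 + integral {t1..u} (\<lambda>v. G v (?x v)) = ?x u"
      using flow_increment[of t1 u s y] u \<open>t2 \<le> s\<close> by simp
  qed
qed

text \<open>The state moves by at most \<open>B * h\<close> during the step, which changes the field
  by at most \<open>L * B * h\<close>; \<open>e\<close> covers its variation in time. The bound
  \<open>e\<close> is asked for only after \<open>s\<close>, as right-continuity provides
  it.\<close>

lemma flow_expansion:
  assumes "0 \<le> h" and e: "\<And>u z. u \<in> {s<..s + h} \<Longrightarrow> \<bar>D u z - D s z\<bar> \<le> e"
    and "0 \<le> e"
  shows "\<bar>flow D (s + h) s y - (y - h * D s y)\<bar> \<le> (L * B * h + e) * h"
proof -
  let ?x = "\<lambda>t. flow D (s + h) t y"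
  have "?x s - (y - h * D s y) = integral {s..s + h} (\<lambda>u. D s y - D u (?x u))"
    using flow_integral_equation[of s "s + h" y] \<open>0 \<le> h\<close>
    by (simp add: Henstock_Kurzweil_Integration.integral_diff[OF integrable_const_ivl
          D_integrable[OF flow_measurable]])
  also have "\<bar>\<dots>\<bar> \<le> (L * B * h + e) * ((s + h) - s)"
  proof (rule abs_integral_le_Icc)
    show "(\<lambda>u. D s y - D u (?x u)) integrable_on {s..s + h}"
      by (intro integrable_diff D_integrable flow_measurable) auto
    fix u assume u: "u \<in> {s..s + h}"
    have "\<bar>?x u - y\<bar> \<le> B * (s + h - u)"
      using flow_lipschitz_time[of u "s + h" "s + h" y] u
      by (simp add: flow_beyond abs_minus_commute)
    also have "\<dots> \<le> B * h" using u B_nonneg by (intro mult_left_mono) auto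
    finally have "L * \<bar>?x u - y\<bar> \<le> L * (B * h)" using L_pos by (intro mult_left_mono) auto
    then have "\<bar>D s (?x u) - D s y\<bar> \<le> L * B * h"
      using lipschitz[of s "?x u" y] by simp
    moreover have "\<bar>D u (?x u) - D s (?x u)\<bar> \<le> e"
      using e[of u "?x u"] u \<open>0 \<le> e\<close> by (cases "u = s") auto
    ultimately show "\<bar>D s y - D u (?x u)\<bar> \<le> L * B * h + e" by linarith
  qed (use \<open>0 \<le> h\<close> in auto)
  finally show ?thesis by simp
qed

end

section \<open>Quantile transforms between the conditional laws\<close>

lemma at_within_atLeast_eq_at_right: "at (a::real) within {a..} = at_right a"
  by (rule at_within_nhd[where S = UNIV]) auto

lemma LIMSEQ_inverse_Suc_at_right: "filterlim (\<lambda>n. 1 / real (Suc n)) (at_right 0) sequentially"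
  unfolding filterlim_at
  using LIMSEQ_Suc[OF lim_1_over_n[where 'a = real]] by (auto simp del: of_nat_Suc)

text \<open>The hypotheses at one time along one path. The lower bound \<open>\<epsilon>\<close> at
  step 0 is what the estimates use, since displacements in the state are always measured by
  \<open>F 0\<close>; at later steps strict monotonicity suffices.\<close>

locale shift_family =
  fixes mu :: "real \<Rightarrow> real measure" and y1 y2 \<epsilon> C L1 L2 :: real and f :: "real \<Rightarrow> real \<Rightarrow> real"
  assumes real_distr: "0 \<le> h \<Longrightarrow> real_distribution (mu h)"
    and supp: "0 \<le> h \<Longrightarrow> support_of (mu h) = {y1..y2}"
    and dens: "0 \<le> h \<Longrightarrow> mu h = density lborel (\<lambda>y. ennreal (indicator {y1..y2} y * f h y))"
    and f_cont: "0 \<le> h \<Longrightarrow> continuous_on {y1..y2} (f h)"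
    and eps: "0 < \<epsilon>" and f_ge: "y \<in> {y1..y2} \<Longrightarrow> \<epsilon> \<le> f 0 y"
    and C1: "cdf_C1 y1 y2 mu"
    and dcdf_h_bound: "0 \<le> h \<Longrightarrow> y \<in> {y1..y2} \<Longrightarrow> \<bar>dcdf_h mu h y\<bar> \<le> C"
    and dcdf_y_lipschitz: "y \<in> {y1..y2} \<Longrightarrow> z \<in> {y1..y2} \<Longrightarrow>
      \<bar>dcdf_y y1 y2 mu 0 y - dcdf_y y1 y2 mu 0 z\<bar> \<le> L1 * \<bar>y - z\<bar>"
    and dcdf_h_lipschitz: "y \<in> {y1..y2} \<Longrightarrow> z \<in> {y1..y2} \<Longrightarrow>
      \<bar>dcdf_h mu 0 y - dcdf_h mu 0 z\<bar> \<le> L2 * \<bar>y - z\<bar>"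
begin

abbreviation F :: "real \<Rightarrow> real \<Rightarrow> real" where "F h \<equiv> cdf (mu h)"

abbreviation T :: "real \<Rightarrow> real \<Rightarrow> real" where "T h y \<equiv> quantile_shift mu y h"

section \<open>Distribution functions, quantiles and the quantile transform\<close>

lemma density_measurable:
  assumes "0 \<le> h"
  shows "(\<lambda>y. ennreal (indicator {y1..y2} y * f h y)) \<in> borel_measurable lborel"
proof -
  have "(\<lambda>y. indicator {y1..y2} y *\<^sub>R f h y) \<in> borel_measurable borel"
    by (rule borel_measurable_continuous_on_indicator[OF _ f_cont[OF assms]]) auto
  then show ?thesis by simp
qed

lemma null_outside:
  assumes "0 \<le> h" "A \<in> sets borel" "A \<inter> {y1<..<y2} = {}"
  shows "emeasure (mu h) A = 0"
proof -
  have "emeasure (mu h) A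
      = (\<integral>\<^sup>+ y. ennreal (indicator {y1..y2} y * f h y) * indicator A y \<partial>lborel)"
    using assms density_measurable[of h] by (subst dens) (auto simp: emeasure_density)
  also have "\<dots> = (\<integral>\<^sup>+ (y::real). 0 \<partial>lborel)"
  proof (rule nn_integral_cong_AE)
    have "AE y in lborel. y \<noteq> y1" "AE y in lborel. y \<noteq> y2"
      by (rule AE_lborel_singleton)+
    then show "AE y in lborel. ennreal (indicator {y1..y2} y * f h y) * indicator A y = 0"
    proof eventually_elim
      case (elim y)
      then show ?case using assms(3) by (auto simp: indicator_def)
    qed
  qed
  finally show ?thesis by simp
qed

lemma AE_Icc: "AE y in mu 0. y \<in> {y1..y2}"
proof (rule AE_I)
  interpret real_distribution "mu 0" by (rule real_distr) simp
  show "emeasure (mu 0) (- {y1..y2}) = 0"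
    by (rule null_outside) (auto simp: disjoint_iff)
qed (use real_distr[of 0, THEN real_distribution.events_eq_borel] in auto)

lemma y1_less_y2: "y1 < y2"
proof (rule ccontr)
  assume "\<not> y1 < y2"
  interpret real_distribution "mu 0" by (rule real_distr) simp
  have "emeasure (mu 0) UNIV = 0"
    using null_outside[of 0 UNIV] \<open>\<not> y1 < y2\<close> by auto
  then show False using emeasure_space_1 by simp
qed

lemma F_below: "0 \<le> h \<Longrightarrow> y \<le> y1 \<Longrightarrow> F h y = 0"
  by (simp add: cdf_def measure_def null_outside disjoint_iff)

lemma F_above:
  assumes "0 \<le> h" "y2 \<le> y"
  shows "F h y = 1"
proof -
  interpret real_distribution "mu h" by (rule real_distr) fact
  have "measure (mu h) (UNIV - {y<..}) = 1 - measure (mu h) {y<..}"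
    using prob_compl[of "{y<..}"] by simp
  moreover have "measure (mu h) {y<..} = 0"
    using assms by (simp add: measure_def null_outside disjoint_iff)
  moreover have "UNIV - {y<..} = {..y}" by auto
  ultimately show ?thesis by (simp add: cdf_def)
qed

lemma continuous_F: "0 \<le> h \<Longrightarrow> isCont (F h) y"
proof -
  assume "0 \<le> h"
  interpret real_distribution "mu h" by (rule real_distr) fact
  have "emeasure (mu h) {y}
      = (\<integral>\<^sup>+ x. ennreal (indicator {y1..y2} x * f h x) * indicator {y} x \<partial>lborel)"
    using density_measurable[OF \<open>0 \<le> h\<close>]
    by (subst dens[OF \<open>0 \<le> h\<close>]) (auto simp: emeasure_density)
  also have "\<dots> = 0"
    by (subst nn_integral_null_set) (auto simp: null_sets_def)
  finally show ?thesis by (simp add: isCont_cdf measure_def)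
qed

lemma F_mono: "0 \<le> h \<Longrightarrow> a \<le> b \<Longrightarrow> F h a \<le> F h b"
proof -
  assume "0 \<le> h" "a \<le> b"
  interpret real_distribution "mu h" by (rule real_distr) fact
  show ?thesis by (rule cdf_nondecreasing) fact
qed

text \<open>The midpoint of \<open>a\<close> and \<open>b\<close> belongs to the support, so the
  open interval between them has positive mass.\<close>

lemma F_strict_mono:
  assumes "0 \<le> h" "y1 \<le> a" "a < b" "b \<le> y2"
  shows "F h a < F h b"
proof -
  interpret real_distribution "mu h" by (rule real_distr) fact
  have "(a + b) / 2 \<in> support_of (mu h)"
    using assms by (simp add: supp)
  then have "0 < measure (mu h) {a<..<b}"
    using \<open>a < b\<close> unfolding support_of_def by (auto dest!: spec[of _ "{a<..<b}"])
  also have "\<dots> \<le> measure (mu h) {a<..b}"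
    by (rule finite_measure_mono) auto
  also have "\<dots> = F h b - F h a"
    using cdf_diff_eq[OF \<open>a < b\<close>] by simp
  finally show ?thesis by simp
qed

lemma F_le_iff:
  assumes "0 \<le> h" "a \<in> {y1..y2}" "b \<in> {y1..y2}"
  shows "F h a \<le> F h b \<longleftrightarrow> a \<le> b"
  using F_strict_mono[of h b a] F_mono[of h a b] assms by (cases "a \<le> b") auto

lemma F_range: "0 \<le> h \<Longrightarrow> y \<in> {y1..y2} \<Longrightarrow> 0 \<le> F h y \<and> F h y \<le> 1"
  using F_mono[of h y1 y] F_mono[of h y y2] F_below[of h y1] F_above[of h y2] by auto

lemma F_surj:
  assumes "0 \<le> h" "0 \<le> p" "p \<le> 1"
  obtains x where "x \<in> {y1..y2}" "F h x = p"
proof -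
  have "\<exists>x\<ge>y1. x \<le> y2 \<and> F h x = p"
    using assms y1_less_y2 continuous_F F_below[of h y1] F_above[of h y2] by (intro IVT) auto
  then show ?thesis using that by auto
qed

text \<open>At the endpoints the quantile is given by the support; in the interior strict
  monotonicity identifies the set under the infimum as a closed half-line starting at
  \<open>x\<close>.\<close>

lemma quantile_eq:
  assumes "0 \<le> h" "x \<in> {y1..y2}"
  shows "quantile (mu h) (F h x) = x"
proof -
  consider "x = y1" | "x = y2" | "y1 < x" "x < y2" using assms by fastforce
  then show ?thesis
  proof cases
    case 1
    then show ?thesis
      using assms y1_less_y2 by (simp add: quantile_def F_below supp)
  next
    case 2
    then show ?thesis
      using assms y1_less_y2 by (simp add: quantile_def F_above supp)
  next
    case 3
    have "F h x \<noteq> 0" "F h x \<noteq> 1"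
      using F_strict_mono[of h y1 x] F_strict_mono[of h x y2] F_below[of h y1] F_above[of h y2]
        assms 3 by auto
    moreover have "F h x \<le> F h z \<longleftrightarrow> x \<le> z" for z
      using F_strict_mono[of h z x] F_strict_mono[of h y1 x] F_mono[of h z y1] F_mono[of h x z] assms 3
      by (cases "x \<le> z"; cases "y1 \<le> z") auto
    ultimately show ?thesis
      by (simp add: quantile_def cInf_eq_Min atLeast_def[symmetric])
  qed
qed

lemma T_below: "0 \<le> h \<Longrightarrow> y \<le> y1 \<Longrightarrow> T h y = y1"
  using y1_less_y2 by (simp add: quantile_shift_def quantile_def F_below supp)

lemma T_above: "0 \<le> h \<Longrightarrow> y2 \<le> y \<Longrightarrow> T h y = y2"
  using y1_less_y2 by (simp add: quantile_shift_def quantile_def F_above supp)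

lemma T_props:
  assumes "0 \<le> h" "y \<in> {y1..y2}"
  shows "T h y \<in> {y1..y2}" "F h (T h y) = F 0 y"
proof -
  obtain x where x: "x \<in> {y1..y2}" "F h x = F 0 y"
    using F_surj[OF \<open>0 \<le> h\<close>, of "F 0 y"] F_range[of 0 y] assms(2) by auto
  then have "T h y = x"
    using quantile_eq[of h x] assms by (simp add: quantile_shift_def)
  then show "T h y \<in> {y1..y2}" "F h (T h y) = F 0 y" using x by auto
qed

lemma T_zero: "y \<in> {y1..y2} \<Longrightarrow> T 0 y = y"
  by (simp add: quantile_shift_def quantile_eq)

text \<open>Sublevel sets being half-lines yields both the measurability of the transform and the
  distribution function of its image law. At \<open>x = y2\<close> the sublevel set is the whole
  line, hence the half-open range.\<close>

lemma T_le_set: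
  assumes "0 \<le> h" "x \<in> {y1..<y2}"
  obtains y where "y \<in> {y1..y2}" "F 0 y = F h x" "{z. T h z \<le> x} = {..y}"
proof -
  obtain y where y: "y \<in> {y1..y2}" "F 0 y = F h x"
    using F_surj[of 0 "F h x"] F_range[of h x] assms by auto
  have "T h z \<le> x \<longleftrightarrow> z \<le> y" for z
  proof -
    consider "z \<le> y1" | "y2 \<le> z" | "z \<in> {y1..y2}" by fastforce
    then show ?thesis
    proof cases
      case 1
      then show ?thesis using assms y T_below by simp
    next
      case 2
      moreover have "y \<noteq> y2"
        using y F_above[of 0 y2] F_above[of h y2] F_strict_mono[of h x y2] assms by auto
      ultimately show ?thesis using assms y T_above by auto
    next
      case 3
      have "T h z \<le> x \<longleftrightarrow> F h (T h z) \<le> F h x"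
        using F_le_iff[of h "T h z" x] T_props[OF assms(1) 3] assms by simp
      also have "\<dots> \<longleftrightarrow> F 0 z \<le> F 0 y"
        using T_props[OF assms(1) 3] y by simp
      also have "\<dots> \<longleftrightarrow> z \<le> y"
        using F_le_iff[of 0 z y] 3 y by simp
      finally show ?thesis .
    qed
  qed
  then show ?thesis using that[OF y] by auto
qed

lemma T_range: "0 \<le> h \<Longrightarrow> T h z \<in> {y1..y2}"
  using T_below[of h z] T_above[of h z] T_props(1)[of h z] y1_less_y2
  by (cases "z \<le> y1"; cases "y2 \<le> z") auto

lemma T_measurable:
  assumes "0 \<le> h"
  shows "(\<lambda>z. T h z) \<in> borel_measurable borel"
proof (rule borel_measurableI_le)
  fix x
  consider "x < y1" | "y2 \<le> x" | "x \<in> {y1..<y2}" by fastforce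
  then show "{z \<in> space borel. T h z \<le> x} \<in> sets borel"
  proof cases
    case 1
    have "\<not> T h z \<le> x" for z using T_range[OF assms, of z] 1 by auto
    then show ?thesis by simp
  next
    case 2
    have "T h z \<le> x" for z using T_range[OF assms, of z] 2 by auto
    then show ?thesis by simp
  next
    case 3
    obtain y where "{z. T h z \<le> x} = {..y}" using T_le_set[OF assms 3] by blast
    then show ?thesis by simp
  qed
qed

lemma distr_T:
  assumes "0 \<le> h"
  shows "distr (mu 0) borel (T h) = mu h"
proof (rule cdf_unique)
  interpret m0: real_distribution "mu 0" by (rule real_distr) simp
  have Tm: "T h \<in> borel_measurable (mu 0)"
    using T_measurable[OF assms] by (simp add: measurable_def m0.M_is_borel)
  show "real_distribution (distr (mu 0) borel (T h))"
    using Tm by (intro m0.real_distribution_distr) simp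
  show "real_distribution (mu h)" by (rule real_distr) fact
  show "cdf (distr (mu 0) borel (T h)) = F h"
  proof
    fix x
    have "cdf (distr (mu 0) borel (T h)) x = measure (mu 0) {z. T h z \<le> x}"
      unfolding cdf_def using Tm by (subst measure_distr) (auto simp: vimage_def)
    also have "\<dots> = F h x"
    proof -
      consider "x < y1" | "y2 \<le> x" | "x \<in> {y1..<y2}" by fastforce
      then show ?thesis
      proof cases
        case 1
        have "\<not> T h z \<le> x" for z using T_range[OF assms, of z] 1 by auto
        then show ?thesis using 1 assms F_below by simp
      next
        case 2
        have "T h z \<le> x" for z using T_range[OF assms, of z] 2 by auto
        then show ?thesis using 2 assms F_above m0.prob_space by simp
      next
        case 3
        show ?thesis by (rule T_le_set[OF assms 3]) (simp add: cdf_def)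
      qed
    qed
    finally show "cdf (distr (mu 0) borel (T h)) x = F h x" .
  qed
qed

section \<open>Displacement and derivative of the quantile transform\<close>

lemma F0_growth:
  assumes "y1 \<le> a" "a \<le> b" "b \<le> y2"
  shows "\<epsilon> * (b - a) \<le> F 0 b - F 0 a"
proof (cases "a = b")
  case False
  interpret real_distribution "mu 0" by (rule real_distr) simp
  have "ennreal (\<epsilon> * (b - a)) = (\<integral>\<^sup>+ x. ennreal \<epsilon> * indicator {a<..b} x \<partial>lborel)"
    using assms eps by (simp add: nn_integral_cmult_indicator ennreal_mult)
  also have "\<dots> \<le> (\<integral>\<^sup>+ x. ennreal (indicator {y1..y2} x * f 0 x) * indicator {a<..b} x \<partial>lborel)"
    using assms f_ge by (intro nn_integral_mono) (auto simp: indicator_def intro!: ennreal_leI)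
  also have "\<dots> = emeasure (mu 0) {a<..b}"
    using density_measurable[of 0] by (subst dens) (auto simp: emeasure_density)
  also have "\<dots> = ennreal (F 0 b - F 0 a)"
    using False assms by (simp add: emeasure_eq_measure cdf_diff_eq)
  finally show ?thesis
    using F_mono[of 0 a b] assms by (simp add: ennreal_le_iff)
qed simp

lemma dcdf_h_derivative:
  assumes "0 \<le> h" "y \<in> {y1..y2}"
  shows "((\<lambda>k. F k y) has_real_derivative dcdf_h mu h y) (at h within {0..})"
  using C1 assms unfolding cdf_C1_def dcdf_h_def
  by (auto simp: has_real_derivative_iff_has_vector_derivative vector_derivative_works)

lemma dcdf_y_derivative:
  assumes "0 \<le> h" "y \<in> {y1..y2}"
  shows "(F h has_real_derivative dcdf_y y1 y2 mu h y) (at y within {y1..y2})"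
  using C1 assms unfolding cdf_C1_def dcdf_y_def
  by (auto simp: has_real_derivative_iff_has_vector_derivative vector_derivative_works)

lemma F_mvt_h:
  assumes "0 < h" "y \<in> {y1..y2}"
  obtains k where "0 < k" "k < h" "F h y - F 0 y = h * dcdf_h mu k y"
proof -
  have "\<exists>k\<in>{0<..<h}. F h y - F 0 y = dcdf_h mu k y * (h - 0)"
  proof (rule mvt_simple[where f' = "\<lambda>k. (*) (dcdf_h mu k y)", OF \<open>0 < h\<close>])
    show "((\<lambda>a. F a y) has_derivative (*) (dcdf_h mu k y)) (at k within {0..h})" if "0 \<le> k" for k
      using dcdf_h_derivative[OF that assms(2)] unfolding has_field_derivative_def
      by (rule has_derivative_subset) auto
  qed
  then show ?thesis using that by (auto simp: mult.commute)
qed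

lemma F_h_lipschitz:
  assumes "0 \<le> h" "y \<in> {y1..y2}"
  shows "\<bar>F h y - F 0 y\<bar> \<le> C * h"
proof (cases "h = 0")
  case False
  then obtain k where "0 < k" "F h y - F 0 y = h * dcdf_h mu k y"
    using F_mvt_h[of h y] assms by auto
  then show ?thesis
    using mult_left_mono[OF dcdf_h_bound[of k y], of h] assms by (simp add: abs_mult mult.commute)
qed simp

lemma F_mvt_y:
  assumes "a \<in> {y1..y2}" "b \<in> {y1..y2}"
  obtains x where "x \<in> {y1..y2}" "\<bar>x - a\<bar> \<le> \<bar>b - a\<bar>" "F 0 b - F 0 a = dcdf_y y1 y2 mu 0 x * (b - a)"
proof -
  have *: "\<exists>x\<in>{u..v}. F 0 v - F 0 u = dcdf_y y1 y2 mu 0 x * (v - u)"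
    if "u \<le> v" "y1 \<le> u" "v \<le> y2" for u v
  proof (rule mvt_very_simple[where f' = "\<lambda>x. (*) (dcdf_y y1 y2 mu 0 x)", OF \<open>u \<le> v\<close>])
    fix x assume "u \<le> x" "x \<le> v"
    then have "x \<in> {y1..y2}" using that by simp
    from dcdf_y_derivative[OF order_refl this]
    show "(F 0 has_derivative (*) (dcdf_y y1 y2 mu 0 x)) (at x within {u..v})"
      unfolding has_field_derivative_def by (rule has_derivative_subset) (use that in auto)
  qed
  show ?thesis
  proof (cases "a \<le> b")
    case True
    then obtain x where "x \<in> {a..b}" "F 0 b - F 0 a = dcdf_y y1 y2 mu 0 x * (b - a)"
      using *[of a b] assms by auto
    then show ?thesis using assms that[of x] by auto
  next
    case False
    then obtain x where "x \<in> {b..a}" "F 0 a - F 0 b = dcdf_y y1 y2 mu 0 x * (a - b)"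
      using *[of b a] assms by auto
    then show ?thesis using assms that[of x] by (auto simp: algebra_simps)
  qed
qed

text \<open>Since \<open>F h (T h y) = F 0 y\<close>, the increment of \<open>F 0\<close> from
  \<open>y\<close> to \<open>T h y\<close> equals, up to sign, the change of the distribution
  function over \<open>h\<close> at the state \<open>T h y\<close>. The former is at least
  \<open>\<epsilon>\<close> times the displacement, the latter at most \<open>C * h\<close>.\<close>

lemma T_lipschitz_h:
  assumes "0 \<le> h" "y \<in> {y1..y2}"
  shows "\<bar>T h y - y\<bar> \<le> C / \<epsilon> * h"
proof -
  have "\<epsilon> * \<bar>T h y - y\<bar> \<le> \<bar>F 0 (T h y) - F 0 y\<bar>"
    using F0_growth[of "T h y" y] F0_growth[of y "T h y"] T_props(1)[OF assms] assms(2)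
    by (cases "T h y \<le> y") auto
  also have "\<dots> = \<bar>F h (T h y) - F 0 (T h y)\<bar>"
    using T_props(2)[OF assms] by simp
  also have "\<dots> \<le> C * h"
    by (rule F_h_lipschitz[OF assms(1) T_props(1)[OF assms]])
  finally show ?thesis using eps by (simp add: field_simps)
qed

text \<open>The derivative is not identified with the density: the difference quotients are bounded
  below by \<open>F0_growth\<close>, and the bound passes to the limit.\<close>

lemma dcdf_y_ge:
  assumes y: "y \<in> {y1..y2}"
  shows "\<epsilon> \<le> dcdf_y y1 y2 mu 0 y"
proof (rule tendsto_lowerbound)
  show "((\<lambda>z. (F 0 z - F 0 y) / (z - y)) \<longlongrightarrow> dcdf_y y1 y2 mu 0 y) (at y within {y1..y2})"
    using dcdf_y_derivative[OF order_refl y] by (simp add: has_field_derivative_iff)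
  show "\<forall>\<^sub>F z in at y within {y1..y2}. \<epsilon> \<le> (F 0 z - F 0 y) / (z - y)"
    unfolding eventually_at_filter
  proof (intro always_eventually allI impI)
    fix z assume "z \<noteq> y" "z \<in> {y1..y2}"
    then show "\<epsilon> \<le> (F 0 z - F 0 y) / (z - y)"
      using F0_growth[of y z] F0_growth[of z y] y
      by (cases "y < z") (auto simp: pos_le_divide_eq neg_le_divide_eq algebra_simps)
  qed
  show "at y within {y1..y2} \<noteq> bot"
    using y y1_less_y2 by (simp add: trivial_limit_within islimpt_Icc)
qed

text \<open>Implicit differentiation by hand: intermediate points \<open>k h\<close> in the step and
  \<open>x h\<close> in the state express the difference quotient exactly as a ratio of partial
  derivatives. Both points converge, and joint continuity is needed because step and state move
  together.\<close>

lemma T_derivative: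
  assumes y: "y \<in> {y1..y2}"
  shows "((\<lambda>h. (T h y - y) / h) \<longlongrightarrow> - dcdf_h mu 0 y / dcdf_y y1 y2 mu 0 y) (at_right 0)"
proof -
  have "\<exists>k. 0 < k \<and> k < h \<and> F h (T h y) - F 0 (T h y) = h * dcdf_h mu k (T h y)" if "0 < h" for h
    using F_mvt_h[OF that, of "T h y"] T_props(1)[of h y] that y by auto
  then obtain k where k: "\<And>h. 0 < h \<Longrightarrow> 0 < k h \<and> k h < h \<and>
      F h (T h y) - F 0 (T h y) = h * dcdf_h mu (k h) (T h y)"
    by metis
  then have k': "0 \<le> k h" "k h \<le> h" if "0 < h" for h
    using that by (auto intro: less_imp_le)
  have "\<exists>x. x \<in> {y1..y2} \<and> \<bar>x - y\<bar> \<le> \<bar>T h y - y\<bar> \<and>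
      F 0 (T h y) - F 0 y = dcdf_y y1 y2 mu 0 x * (T h y - y)" if "0 < h" for h
    using F_mvt_y[OF y, of "T h y"] T_props(1)[of h y] that y by (metis less_imp_le)
  then obtain x where x: "\<And>h. 0 < h \<Longrightarrow> x h \<in> {y1..y2} \<and> \<bar>x h - y\<bar> \<le> \<bar>T h y - y\<bar> \<and>
      F 0 (T h y) - F 0 y = dcdf_y y1 y2 mu 0 (x h) * (T h y - y)"
    by metis
  have pos: "\<forall>\<^sub>F h in at_right 0. (0::real) < h"
    by (simp add: eventually_at_filter)
  have Clim: "((\<lambda>h. C / \<epsilon> * h) \<longlongrightarrow> 0) (at_right 0)"
    by (rule tendsto_mult_right_zero) (auto intro: tendsto_ident_at)
  have Ty: "((\<lambda>h. T h y) \<longlongrightarrow> y) (at_right 0)"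
    by (rule LIM_zero_cancel, rule tendsto_rabs_zero_cancel, rule tendsto_sandwich[OF _ _ tendsto_const Clim])
      (use pos T_lipschitz_h y in \<open>auto elim!: eventually_mono\<close>)
  have xy: "(x \<longlongrightarrow> y) (at_right 0)"
  proof (rule LIM_zero_cancel, rule tendsto_rabs_zero_cancel, rule tendsto_sandwich[OF _ _ tendsto_const])
    show "((\<lambda>h. \<bar>T h y - y\<bar>) \<longlongrightarrow> 0) (at_right 0)"
      using Ty by (simp add: tendsto_rabs_zero_iff LIM_zero_iff)
    show "\<forall>\<^sub>F h in at_right 0. \<bar>x h - y\<bar> \<le> \<bar>T h y - y\<bar>"
      using pos by (rule eventually_mono) (use x in auto)
  qed auto
  have k0: "(k \<longlongrightarrow> 0) (at_right 0)"
    by (rule tendsto_sandwich[OF _ _ tendsto_const tendsto_ident_at])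
      (use k' in \<open>auto intro: eventually_mono[OF pos]\<close>)
  have ev: "\<forall>\<^sub>F h in at_right 0. (T h y - y) / h = - dcdf_h mu (k h) (T h y) / dcdf_y y1 y2 mu 0 (x h)"
    using pos
  proof eventually_elim
    case (elim h)
    have "dcdf_y y1 y2 mu 0 (x h) * (T h y - y) = F 0 (T h y) - F h (T h y)"
      using x[OF elim] T_props(2)[of h y] elim y by simp
    then have "dcdf_y y1 y2 mu 0 (x h) * (T h y - y) = - h * dcdf_h mu (k h) (T h y)"
      using k[OF elim] by simp
    moreover have "0 < dcdf_y y1 y2 mu 0 (x h)"
      using dcdf_y_ge[of "x h"] x[OF elim] eps by simp
    ultimately show ?case using elim by (simp add: field_simps)
  qed
  have ch: "((\<lambda>h. dcdf_h mu (k h) (T h y)) \<longlongrightarrow> dcdf_h mu 0 y) (at_right 0)"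
  proof -
    have c: "continuous_on ({0..} \<times> {y1..y2}) (\<lambda>(h, y). dcdf_h mu h y)"
      using C1 by (simp add: cdf_C1_def)
    have "((\<lambda>h. (\<lambda>(h, y). dcdf_h mu h y) (k h, T h y)) \<longlongrightarrow> (\<lambda>(h, y). dcdf_h mu h y) (0, y)) (at_right 0)"
      by (rule continuous_on_tendsto_compose[OF c tendsto_Pair[OF k0 Ty]])
        (use y k' T_props(1) in \<open>auto intro!: eventually_mono[OF pos]\<close>)
    then show ?thesis by simp
  qed
  have cy: "((\<lambda>h. dcdf_y y1 y2 mu 0 (x h)) \<longlongrightarrow> dcdf_y y1 y2 mu 0 y) (at_right 0)"
  proof -
    have c: "continuous_on ({0..} \<times> {y1..y2}) (\<lambda>(h, y). dcdf_y y1 y2 mu h y)"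
      using C1 by (simp add: cdf_C1_def)
    have "((\<lambda>h. (\<lambda>(h, y). dcdf_y y1 y2 mu h y) (0, x h)) \<longlongrightarrow> (\<lambda>(h, y). dcdf_y y1 y2 mu h y) (0, y)) (at_right 0)"
      by (rule continuous_on_tendsto_compose[OF c tendsto_Pair[OF tendsto_const xy]])
        (use y x in \<open>auto intro!: eventually_mono[OF pos]\<close>)
    then show ?thesis by simp
  qed
  have "((\<lambda>h. - dcdf_h mu (k h) (T h y) / dcdf_y y1 y2 mu 0 (x h))
      \<longlongrightarrow> - dcdf_h mu 0 y / dcdf_y y1 y2 mu 0 y) (at_right 0)"
    by (intro tendsto_intros ch cy) (use dcdf_y_ge[OF y] eps in auto)
  then show ?thesis
    using tendsto_cong[OF ev] by simp
qed

text \<open>At an endpoint of the common support the distribution function is 0 or 1 for every step.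
  Consequently the field vanishes there and its extension by zero is continuous.\<close>

lemma dcdf_h_zero:
  assumes "y = y1 \<or> y = y2" "0 \<le> h"
  shows "dcdf_h mu h y = 0"
proof -
  obtain c where c: "\<And>k. 0 \<le> k \<Longrightarrow> F k y = c"
    using assms F_below[of _ y1] F_above[of _ y2] by (cases "y = y1") auto
  have y: "y \<in> {y1..y2}" using assms y1_less_y2 by auto
  have "((\<lambda>k. c) has_real_derivative dcdf_h mu h y) (at h within {0..})"
  proof (rule has_field_derivative_transform_within[OF dcdf_h_derivative[OF \<open>0 \<le> h\<close> y] zero_less_one])
    show "F k y = c" if "k \<in> {0..}" for k using c that by simp
  qed (use \<open>0 \<le> h\<close> in simp)
  then have "((\<lambda>k. c) has_real_derivative dcdf_h mu h y) (at h within {h..})"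
    by (rule DERIV_subset) (use \<open>0 \<le> h\<close> in auto)
  moreover have "((\<lambda>k. c) has_real_derivative 0) (at h within {h..})"
    by simp
  ultimately show ?thesis
    by (rule has_field_derivative_unique) (simp add: at_within_atLeast_eq_at_right)
qed

lemma T_has_derivative:
  "((\<lambda>h. T h y) has_real_derivative
      (if y \<in> {y1..y2} then - dcdf_h mu 0 y / dcdf_y y1 y2 mu 0 y else 0)) (at 0 within {0..})"
proof (cases "y \<in> {y1..y2}")
  case True
  then show ?thesis
    using T_derivative[OF True] T_zero[OF True]
    by (simp add: has_field_derivative_iff at_within_atLeast_eq_at_right)
next
  case False
  then obtain c where c: "\<And>k. 0 \<le> k \<Longrightarrow> T k y = c"
    using T_below[of _ y] T_above[of _ y] by (cases "y \<le> y1") auto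
  have "((\<lambda>k. c) has_real_derivative 0) (at (0::real) within {0..})" by simp
  then have "((\<lambda>h. T h y) has_real_derivative 0) (at 0 within {0..})"
    by (rule has_field_derivative_transform_within[OF _ zero_less_one]) (auto simp: c)
  then show ?thesis by (subst if_not_P[OF False])
qed

lemma T_differentiable: "(\<lambda>h. T h y) differentiable (at 0 within {0..})"
  using T_has_derivative[of y] by (auto simp: real_differentiable_def)

section \<open>Bounds and measurability of the field\<close>

lemma D_shift_eq:
  "D_shift mu y = (if y \<in> {y1..y2} then - dcdf_h mu 0 y / dcdf_y y1 y2 mu 0 y else 0)"
  unfolding D_shift_def
  using T_has_derivative[of y]
  by (intro vector_derivative_within)
    (auto simp: at_within_atLeast_eq_at_right has_real_derivative_iff_has_vector_derivative)

lemma D_shift_outside: "y \<notin> {y1<..<y2} \<Longrightarrow> D_shift mu y = 0"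
  using dcdf_h_zero[of y 0] by (cases "y \<in> {y1..y2}") (auto simp: D_shift_eq)

lemma C_nonneg: "0 \<le> C"
  using dcdf_h_bound[of 0 y1] y1_less_y2 by auto

lemma D_shift_bound: "\<bar>D_shift mu y\<bar> \<le> C / \<epsilon>"
proof (cases "y \<in> {y1..y2}")
  case True
  have "\<bar>D_shift mu y\<bar> = \<bar>dcdf_h mu 0 y\<bar> / dcdf_y y1 y2 mu 0 y"
    using True dcdf_y_ge[OF True] eps by (simp add: D_shift_eq abs_divide)
  also have "\<dots> \<le> C / \<epsilon>"
    by (rule frac_le[OF C_nonneg dcdf_h_bound[OF order_refl True] eps dcdf_y_ge[OF True]])
  finally show ?thesis .
qed (use C_nonneg eps in \<open>auto simp: D_shift_eq\<close>)

lemma D_shift_lipschitz_Icc: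
  assumes y: "y \<in> {y1..y2}" and z: "z \<in> {y1..y2}"
  shows "\<bar>D_shift mu y - D_shift mu z\<bar> \<le> (L2 / \<epsilon> + C * L1 / \<epsilon>\<^sup>2) * \<bar>y - z\<bar>"
proof -
  let ?g = "dcdf_h mu 0" and ?f = "dcdf_y y1 y2 mu 0"
  have f: "\<epsilon> \<le> ?f y" "\<epsilon> \<le> ?f z" using dcdf_y_ge y z by auto
  \<comment> \<open>Numerator and denominator are varied separately: the first contributes
    \<open>L2 / \<epsilon>\<close>, the second \<open>C * L1 / \<epsilon>\<^sup>2\<close>.\<close>
  have "D_shift mu y - D_shift mu z = (?g z - ?g y) / ?f z + ?g y * (?f y - ?f z) / (?f y * ?f z)"
    using y z f eps by (simp add: D_shift_eq field_simps)
  then have "\<bar>D_shift mu y - D_shift mu z\<bar>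
      \<le> \<bar>?g z - ?g y\<bar> / \<bar>?f z\<bar> + \<bar>?g y\<bar> * \<bar>?f y - ?f z\<bar> / (\<bar>?f y\<bar> * \<bar>?f z\<bar>)"
    using abs_triangle_ineq[of "(?g z - ?g y) / ?f z" "?g y * (?f y - ?f z) / (?f y * ?f z)"]
    by (simp only: abs_divide abs_mult)
  also have "\<dots> \<le> L2 * \<bar>y - z\<bar> / \<epsilon> + C * (L1 * \<bar>y - z\<bar>) / (\<epsilon> * \<epsilon>)"
  proof (intro add_mono frac_le mult_mono)
    show "\<bar>?g z - ?g y\<bar> \<le> L2 * \<bar>y - z\<bar>"
      using dcdf_h_lipschitz[OF y z] by (simp add: abs_minus_commute)
  qed (use f eps dcdf_h_bound[of 0 y] dcdf_y_lipschitz[OF y z] C_nonneg y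
      abs_ge_zero[of "?f y - ?f z", THEN order_trans] in
      \<open>auto intro: order_trans[OF abs_ge_zero dcdf_h_lipschitz[OF y z]]\<close>)
  also have "\<dots> = (L2 / \<epsilon> + C * L1 / \<epsilon>\<^sup>2) * \<bar>y - z\<bar>"
    by (simp add: field_simps power2_eq_square)
  finally show ?thesis .
qed

text \<open>The signs of \<open>L1\<close> and \<open>L2\<close> are not prescribed; the estimate at
  the distinct points \<open>y1\<close> and \<open>y2\<close> forces the sign of the
  combination.\<close>

lemma lipschitz_constant_nonneg: "0 \<le> L2 / \<epsilon> + C * L1 / \<epsilon>\<^sup>2"
proof -
  have "0 \<le> (L2 / \<epsilon> + C * L1 / \<epsilon>\<^sup>2) * \<bar>y2 - y1\<bar>"
    using order_trans[OF abs_ge_zero D_shift_lipschitz_Icc[of y2 y1]] y1_less_y2 by simp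
  then show ?thesis using y1_less_y2 by (simp add: zero_le_mult_iff)
qed

text \<open>Clamping sends an outside state to an endpoint, where the field is zero too. As clamping
  does not increase distances, the Lipschitz estimate extends from the support to the line.\<close>

lemma D_shift_clamp: "D_shift mu y = D_shift mu (max y1 (min y2 y))"
  using D_shift_outside[of y] D_shift_outside[of y1] D_shift_outside[of y2] y1_less_y2
  by (auto simp: max_def min_def)

lemma D_shift_lipschitz:
  "\<bar>D_shift mu y - D_shift mu z\<bar> \<le> (L2 / \<epsilon> + C * L1 / \<epsilon>\<^sup>2) * \<bar>y - z\<bar>"
proof -
  let ?c = "\<lambda>y. max y1 (min y2 y)"
  have "\<bar>D_shift mu (?c y) - D_shift mu (?c z)\<bar> \<le> (L2 / \<epsilon> + C * L1 / \<epsilon>\<^sup>2) * \<bar>?c y - ?c z\<bar>"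
    using y1_less_y2 by (intro D_shift_lipschitz_Icc) auto
  also have "\<dots> \<le> (L2 / \<epsilon> + C * L1 / \<epsilon>\<^sup>2) * \<bar>y - z\<bar>"
    by (intro mult_left_mono lipschitz_constant_nonneg) (simp add: max_def min_def abs_if)
  finally show ?thesis
    using D_shift_clamp[of y] D_shift_clamp[of z] by simp
qed

text \<open>Expresses the field through countably many values of distribution functions, for
  measurability in the path. The difference quotient in the state is taken forwards, which fails at
  \<open>y2\<close>; there the field is zero.\<close>

lemma D_shift_lim:
  "D_shift mu y = (if y1 \<le> y \<and> y < y2 then
      - lim (\<lambda>n. (F (1 / real (Suc n)) y - F 0 y) * real (Suc n)) /
        lim (\<lambda>n. (F 0 (y + 1 / real (Suc n)) - F 0 y) * real (Suc n)) else 0)"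
proof (cases "y1 \<le> y \<and> y < y2")
  case True
  then have y: "y \<in> {y1..y2}" by simp
  have "((\<lambda>h. (F h y - F 0 y) / h) \<longlongrightarrow> dcdf_h mu 0 y) (at_right 0)"
    using dcdf_h_derivative[OF order_refl y]
    by (simp add: has_field_derivative_iff at_within_atLeast_eq_at_right)
  from filterlim_compose[OF this LIMSEQ_inverse_Suc_at_right]
  have g: "lim (\<lambda>n. (F (1 / real (Suc n)) y - F 0 y) * real (Suc n)) = dcdf_h mu 0 y"
    by (intro limI) (simp del: of_nat_Suc)
  have "(F 0 has_real_derivative dcdf_y y1 y2 mu 0 y) (at y within {y..y2})"
    by (rule DERIV_subset[OF dcdf_y_derivative[OF order_refl y]]) (use True in auto)
  moreover have "at y within {y..y2} = at_right y"
    using True by (intro at_within_nhd[where S = "{..<y2}"]) auto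
  ultimately have "((\<lambda>h. (F 0 (y + h) - F 0 y) / h) \<longlongrightarrow> dcdf_y y1 y2 mu 0 y) (at_right 0)"
    by (simp add: has_field_derivative_iff filterlim_at_right_to_0[of _ _ y] add.commute)
  from filterlim_compose[OF this LIMSEQ_inverse_Suc_at_right]
  have f: "lim (\<lambda>n. (F 0 (y + 1 / real (Suc n)) - F 0 y) * real (Suc n)) = dcdf_y y1 y2 mu 0 y"
    by (intro limI) (simp del: of_nat_Suc)
  show ?thesis unfolding f g using True by (simp add: D_shift_eq)
next
  case False
  then show ?thesis using D_shift_outside[of y] by auto
qed

end

section \<open>Conditional laws\<close>

text \<open>Conditional law given a sub-\<sigma>-algebra, characterised by its averages over events.
  The kernel is indexed by outcomes instead of histories, so that the laws at different times share
  one index space.\<close>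

definition cond_law :: "'a measure \<Rightarrow> 'a measure \<Rightarrow> ('a \<Rightarrow> real) \<Rightarrow> ('a \<Rightarrow> real measure) \<Rightarrow> bool" where
  "cond_law M F X k \<longleftrightarrow>
     X \<in> borel_measurable M \<and> k \<in> F \<rightarrow>\<^sub>M prob_algebra borel \<and>
     (\<forall>A\<in>sets F. \<forall>B\<in>sets borel.
        measure M (A \<inter> X -` B) = (\<integral>\<omega>. indicator A \<omega> * measure (k \<omega>) B \<partial>M))"

lemma subalgebra_vimage_algebra:
  assumes "V \<in> M \<rightarrow>\<^sub>M N"
  shows "subalgebra M (vimage_algebra (space M) V N)"
  unfolding subalgebra_def
  using sets_vimage_algebra2[OF measurable_space[OF assms, THEN funcsetI], of "space M"]
    measurable_sets[OF assms] by (auto simp: sets_vimage_algebra2 measurable_space[OF assms])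

lemma measurable_vimage_algebra_self:
  assumes "V \<in> M \<rightarrow>\<^sub>M N"
  shows "V \<in> vimage_algebra (space M) V N \<rightarrow>\<^sub>M N"
  by (rule measurable_vimage_algebra1) (use measurable_space[OF assms] in auto)

text \<open>For each \<open>B\<close>, a conditional probability is determined up to null sets by
  measurability and its integrals over events of the history.\<close>

lemma is_cond_distr_iff_cond_law:
  assumes "prob_space M"
  shows "is_cond_distr M N V X \<kappa> \<longleftrightarrow>
    V \<in> M \<rightarrow>\<^sub>M N \<and> \<kappa> \<in> N \<rightarrow>\<^sub>M prob_algebra borel \<and>
    cond_law M (vimage_algebra (space M) V N) X (\<lambda>\<omega>. \<kappa> (V \<omega>))"
proof -
  interpret prob_space M by fact
  let ?F = "vimage_algebra (space M) V N"
  have key: "(\<forall>B\<in>sets borel. AE \<omega> in M. measure (\<kappa> (V \<omega>)) B =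
        real_cond_exp M ?F (indicator (X -` B \<inter> space M)) \<omega>) \<longleftrightarrow>
     (\<forall>A\<in>sets ?F. \<forall>B\<in>sets borel.
        measure M (A \<inter> X -` B) = (\<integral>\<omega>. indicator A \<omega> * measure (\<kappa> (V \<omega>)) B \<partial>M))"
    if V: "V \<in> M \<rightarrow>\<^sub>M N" and k: "\<kappa> \<in> N \<rightarrow>\<^sub>M prob_algebra borel" and X[measurable]: "X \<in> borel_measurable M"
  proof -
    have sub: "subalgebra M ?F" by (rule subalgebra_vimage_algebra[OF V])
    interpret finite_measure_subalgebra M ?F by unfold_locales (rule sub)
    have mF: "(\<lambda>\<omega>. measure (\<kappa> (V \<omega>)) B) \<in> borel_measurable ?F" if "B \<in> sets borel" for B
      by (rule measurable_compose[OF measurable_vimage_algebra_self[OF V]])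
        (use that in \<open>auto intro!: measurable_compose[OF measurable_prob_algebraD[OF k]
          measurable_measure_subprob_algebra]\<close>)
    have int: "integrable M (\<lambda>\<omega>. measure (\<kappa> (V \<omega>)) B)" if "B \<in> sets borel" for B
    proof (rule integrable_const_bound[where B = 1])
      show "AE \<omega> in M. norm (measure (\<kappa> (V \<omega>)) B) \<le> 1"
      proof (rule AE_I2)
        fix \<omega> assume "\<omega> \<in> space M"
        then have "\<kappa> (V \<omega>) \<in> space (prob_algebra borel)"
          using measurable_space[OF k] measurable_space[OF V] by auto
        then interpret p: prob_space "\<kappa> (V \<omega>)" by (simp add: space_prob_algebra)
        show "norm (measure (\<kappa> (V \<omega>)) B) \<le> 1" by simp
      qed
      show "(\<lambda>\<omega>. measure (\<kappa> (V \<omega>)) B) \<in> borel_measurable M"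
        by (rule measurable_from_subalg[OF sub mF[OF that]])
    qed
    have ind: "integrable M (indicator (X -` B \<inter> space M) :: 'a \<Rightarrow> real)" if "B \<in> sets borel" for B
      using that by (auto intro!: integrable_real_indicator simp: less_top[symmetric])
    have meas: "(\<integral>\<omega>\<in>A. indicator (X -` B \<inter> space M) \<omega> \<partial>M) = measure M (A \<inter> X -` B)"
      if "A \<in> sets ?F" for A and B :: "real set"
    proof -
      have "A \<subseteq> space M" using sets.sets_into_space[OF that] by simp
      then have "(\<integral>\<omega>\<in>A. indicator (X -` B \<inter> space M) \<omega> \<partial>M) = (\<integral>\<omega>. indicator (A \<inter> X -` B) \<omega> \<partial>M)"
        unfolding set_lebesgue_integral_def
        by (intro Bochner_Integration.integral_cong) (auto simp: indicator_def)
      also have "\<dots> = measure M (A \<inter> X -` B)"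
        using \<open>A \<subseteq> space M\<close> by (simp add: Int_absorb2 le_infI1)
      finally show ?thesis .
    qed
    show ?thesis
    proof (intro iffI ballI)
      fix A and B :: "real set" assume *: "\<forall>B\<in>sets borel. AE \<omega> in M. measure (\<kappa> (V \<omega>)) B =
          real_cond_exp M ?F (indicator (X -` B \<inter> space M)) \<omega>"
        and A: "A \<in> sets ?F" and B: "B \<in> sets borel"
      have "measure M (A \<inter> X -` B) = (\<integral>\<omega>\<in>A. indicator (X -` B \<inter> space M) \<omega> \<partial>M)"
        using meas[OF A] by simp
      also have "\<dots> = (\<integral>\<omega>\<in>A. real_cond_exp M ?F (indicator (X -` B \<inter> space M)) \<omega> \<partial>M)"
        by (rule real_cond_exp_intA[OF ind[OF B] A])
      also have "\<dots> = (\<integral>\<omega>\<in>A. measure (\<kappa> (V \<omega>)) B \<partial>M)"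
      proof (rule set_lebesgue_integral_cong_AE)
        show "A \<in> sets M" using A sub by (auto simp: subalgebra_def)
        show "AE \<omega>\<in>A in M. real_cond_exp M ?F (indicator (X -` B \<inter> space M)) \<omega> = measure (\<kappa> (V \<omega>)) B"
          using *[rule_format, OF B] by eventually_elim simp
      qed (use int[OF B] in auto)
      finally show "measure M (A \<inter> X -` B) = (\<integral>\<omega>. indicator A \<omega> * measure (\<kappa> (V \<omega>)) B \<partial>M)"
        by (simp add: set_lebesgue_integral_def)
    next
      fix B :: "real set" assume *: "\<forall>A\<in>sets ?F. \<forall>B\<in>sets borel.
        measure M (A \<inter> X -` B) = (\<integral>\<omega>. indicator A \<omega> * measure (\<kappa> (V \<omega>)) B \<partial>M)"
        and B: "B \<in> sets borel"
      have "AE \<omega> in M. real_cond_exp M ?F (indicator (X -` B \<inter> space M)) \<omega> = measure (\<kappa> (V \<omega>)) B"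
      proof (rule real_cond_exp_charact[OF _ ind[OF B] int[OF B] mF[OF B]])
        fix A assume A: "A \<in> sets ?F"
        show "(\<integral>\<omega>\<in>A. indicator (X -` B \<inter> space M) \<omega> \<partial>M) = (\<integral>\<omega>\<in>A. measure (\<kappa> (V \<omega>)) B \<partial>M)"
          unfolding meas[OF A] *[rule_format, OF A B] by (simp add: set_lebesgue_integral_def)
      qed
      then show "AE \<omega> in M. measure (\<kappa> (V \<omega>)) B =
          real_cond_exp M ?F (indicator (X -` B \<inter> space M)) \<omega>"
        by eventually_elim simp
    qed
  qed
  have kV: "(\<lambda>\<omega>. \<kappa> (V \<omega>)) \<in> ?F \<rightarrow>\<^sub>M prob_algebra borel"
    if "V \<in> M \<rightarrow>\<^sub>M N" "\<kappa> \<in> N \<rightarrow>\<^sub>M prob_algebra borel"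
    by (rule measurable_compose[OF measurable_vimage_algebra_self[OF that(1)] that(2)])
  show ?thesis
    unfolding is_cond_distr_def cond_law_def using key kV by blast
qed

text \<open>On \<open>borel \<Otimes>\<^sub>M F\<close> the joint law of \<open>X\<close> and the
  outcome is a mixture of the kernels, because both agree on rectangles, an intersection-stable
  generator. This allows integrands depending on state and path at once.\<close>

lemma disintegration:
  fixes q :: "real \<Rightarrow> 'a \<Rightarrow> real"
  assumes M: "prob_space M" and sub: "subalgebra M F" and law: "cond_law M F X k"
    and q: "(\<lambda>p. q (fst p) (snd p)) \<in> borel_measurable (borel \<Otimes>\<^sub>M F)"
    and q_bd: "\<And>y \<omega>. 0 \<le> q y \<omega> \<and> q y \<omega> \<le> 1"
  shows "(\<lambda>\<omega>. \<integral>y. q y \<omega> \<partial>k \<omega>) \<in> borel_measurable F"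
    and "(\<integral>\<omega>. q (X \<omega>) \<omega> \<partial>M) = (\<integral>\<omega>. (\<integral>y. q y \<omega> \<partial>k \<omega>) \<partial>M)"
proof -
  interpret prob_space M by fact
  have spF: "space F = space M" using sub by (simp add: subalgebra_def)
  have X[measurable]: "X \<in> borel_measurable M" and k: "k \<in> F \<rightarrow>\<^sub>M prob_algebra borel"
    and rect: "\<And>A B. A \<in> sets F \<Longrightarrow> B \<in> sets borel \<Longrightarrow>
      measure M (A \<inter> X -` B) = (\<integral>\<omega>. indicator A \<omega> * measure (k \<omega>) B \<partial>M)"
    using law by (auto simp: cond_law_def)
  have k': "k \<in> F \<rightarrow>\<^sub>M subprob_algebra borel" by (rule measurable_prob_algebraD[OF k])
  have kp: "prob_space (k \<omega>)" "sets (k \<omega>) = sets borel" "space (k \<omega>) = UNIV" if "\<omega> \<in> space M" for \<omega>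
    using measurable_space[OF k, of \<omega>] that spF sets_eq_imp_space_eq[of "k \<omega>" borel]
    by (auto simp: space_prob_algebra)
  let ?P = "borel \<Otimes>\<^sub>M F :: (real \<times> 'a) measure"
  \<comment> \<open>\<open>N \<omega>\<close> is the kernel placed on the slice over
    \<open>\<omega>\<close>; averaging these measures over \<open>M\<close> gives the candidate for
    the joint law.\<close>
  define N where "N \<omega> = distr (k \<omega>) ?P (\<lambda>y. (y, \<omega>))" for \<omega>
  have NF: "N \<in> F \<rightarrow>\<^sub>M subprob_algebra ?P"
    unfolding N_def by (rule measurable_distr2[OF _ k']) simp
  have NM: "N \<in> M \<rightarrow>\<^sub>M subprob_algebra ?P"
    by (rule measurable_from_subalg[OF sub NF])
  have Pk: "(\<lambda>y. (y, \<omega>)) \<in> k \<omega> \<rightarrow>\<^sub>M ?P" if "\<omega> \<in> space M" for \<omega>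
    unfolding measurable_cong_sets[OF kp(2)[OF that] refl]
    by (rule measurable_Pair2') (use that spF in simp)
  have Nq: "(\<integral>p. q (fst p) (snd p) \<partial>N \<omega>) = (\<integral>y. q y \<omega> \<partial>k \<omega>)" if "\<omega> \<in> space M" for \<omega>
    unfolding N_def using integral_distr[OF Pk[OF that] q] by simp
  show meas: "(\<lambda>\<omega>. \<integral>y. q y \<omega> \<partial>k \<omega>) \<in> borel_measurable F"
    using measurable_compose[OF NF integral_measurable_subprob_algebra[OF q]]
    by (rule measurable_cong[THEN iffD1, rotated]) (simp add: Nq spF)
  have idm: "(\<lambda>\<omega>. (X \<omega>, \<omega>)) \<in> M \<rightarrow>\<^sub>M ?P"
    using sub by (intro measurable_Pair X) (auto simp: measurable_def subalgebra_def dest: sets.sets_into_space)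
  have eq: "distr M ?P (\<lambda>\<omega>. (X \<omega>, \<omega>)) = M \<bind> N"
  proof (rule measure_eqI_generator_eq[OF Int_stable_pair_measure_generator[of borel F]])
    have ne: "space M \<noteq> {}" by (rule not_empty)
    show "sets (distr M ?P (\<lambda>\<omega>. (X \<omega>, \<omega>)))
        = sigma_sets (space borel \<times> space F) {a \<times> b |a b. a \<in> sets borel \<and> b \<in> sets F}"
      by (simp add: sets_pair_measure)
    show "sets (M \<bind> N) = sigma_sets (space borel \<times> space F) {a \<times> b |a b. a \<in> sets borel \<and> b \<in> sets F}"
      using sets_bind[OF _ ne, of N ?P] sets_kernel[OF NM] by (simp add: sets_pair_measure)
    show "{a \<times> b |a b. a \<in> sets borel \<and> b \<in> sets F} \<subseteq> Pow (space borel \<times> space F)"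
      by (auto dest: sets.sets_into_space)
    show "range (\<lambda>i::nat. space borel \<times> space F) \<subseteq> {a \<times> b |a b. a \<in> sets borel \<and> b \<in> sets F}"
      by (auto intro!: exI[of _ UNIV] exI[of _ "space F"])
    show "emeasure (distr M ?P (\<lambda>\<omega>. (X \<omega>, \<omega>))) (space borel \<times> space F) \<noteq> \<infinity>" for i :: nat
      using prob_space.emeasure_le_1[OF prob_space_distr[OF idm]] by (metis ennreal_one_less_top infinity_ennreal_def leD)
    fix R assume "R \<in> {a \<times> b |a b. a \<in> sets (borel :: real measure) \<and> b \<in> sets F}"
    then obtain B A where R: "R = B \<times> A" and B: "B \<in> sets borel" and A: "A \<in> sets F" by auto
    have RP: "R \<in> sets ?P" unfolding R using A B by (rule pair_measureI[rotated])
    have AM: "A \<in> sets M" "A \<subseteq> space M"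
      using A sub sets.sets_into_space[OF A] by (auto simp: subalgebra_def)
    have intAB: "integrable M (\<lambda>\<omega>. indicator A \<omega> * measure (k \<omega>) B)"
    proof (rule integrable_const_bound[where B = 1])
      show "AE \<omega> in M. norm (indicator A \<omega> * measure (k \<omega>) B) \<le> 1"
        using kp(1)[THEN prob_space.prob_le_1] by (auto simp: indicator_def)
      have "(\<lambda>\<omega>. indicator A \<omega> * measure (k \<omega>) B) \<in> borel_measurable F"
        using A measurable_compose[OF k' measurable_measure_subprob_algebra[OF B]] by measurable
      then show "(\<lambda>\<omega>. indicator A \<omega> * measure (k \<omega>) B) \<in> borel_measurable M"
        by (rule measurable_from_subalg[OF sub])
    qed
    have "emeasure (distr M ?P (\<lambda>\<omega>. (X \<omega>, \<omega>))) R = emeasure M (A \<inter> X -` B)"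
      unfolding R using AM idm RP by (subst emeasure_distr) (auto simp: R intro!: arg_cong[where f = "emeasure M"])
    also have "\<dots> = ennreal (measure M (A \<inter> X -` B))"
      by (rule emeasure_eq_measure)
    also have "\<dots> = (\<integral>\<^sup>+\<omega>. ennreal (indicator A \<omega> * measure (k \<omega>) B) \<partial>M)"
      unfolding rect[OF A B] by (rule nn_integral_eq_integral[OF intAB, symmetric]) simp
    also have "\<dots> = (\<integral>\<^sup>+\<omega>. emeasure (N \<omega>) R \<partial>M)"
    proof (rule nn_integral_cong)
      fix \<omega> assume w: "\<omega> \<in> space M"
      interpret p: prob_space "k \<omega>" by (rule kp[OF w])
      have "emeasure (N \<omega>) R = emeasure (k \<omega>) (if \<omega> \<in> A then B else {})"
        unfolding N_def using kp[OF w]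
        by (subst emeasure_distr[OF Pk[OF w] RP]) (auto simp: R intro!: arg_cong[where f = "emeasure (k \<omega>)"])
      then show "ennreal (indicator A \<omega> * measure (k \<omega>) B) = emeasure (N \<omega>) R"
        by (auto simp: p.emeasure_eq_measure)
    qed
    also have "\<dots> = emeasure (M \<bind> N) R"
      by (rule emeasure_bind[OF ne NM RP, symmetric])
    finally show "emeasure (distr M ?P (\<lambda>\<omega>. (X \<omega>, \<omega>))) R = emeasure (M \<bind> N) R" .
  qed auto
  have qX: "(\<lambda>\<omega>. q (X \<omega>) \<omega>) \<in> borel_measurable M"
    using measurable_compose[OF idm q] by simp
  have qk: "integrable (k \<omega>) (\<lambda>y. q y \<omega>)" if "\<omega> \<in> space M" for \<omega>
  proof -
    interpret p: prob_space "k \<omega>" by (rule kp[OF that])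
    have "(\<lambda>y. q y \<omega>) \<in> borel_measurable (k \<omega>)"
      using measurable_compose[OF Pk[OF that] q] by simp
    then show ?thesis using q_bd by (intro p.integrable_const_bound[where B = 1]) auto
  qed
  have inner: "0 \<le> (\<integral>y. q y \<omega> \<partial>k \<omega>) \<and> (\<integral>y. q y \<omega> \<partial>k \<omega>) \<le> 1" if "\<omega> \<in> space M" for \<omega>
  proof -
    interpret p: prob_space "k \<omega>" by (rule kp[OF that])
    show ?thesis
      using q_bd p.integral_le_const[OF qk[OF that], of 1] by (auto intro!: Bochner_Integration.integral_nonneg)
  qed
  have "ennreal (\<integral>\<omega>. q (X \<omega>) \<omega> \<partial>M) = (\<integral>\<^sup>+\<omega>. ennreal (q (X \<omega>) \<omega>) \<partial>M)"
    using q_bd qX by (intro nn_integral_eq_integral[symmetric] integrable_const_bound[where B = 1]) auto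
  also have "\<dots> = (\<integral>\<^sup>+p. ennreal (q (fst p) (snd p)) \<partial>distr M ?P (\<lambda>\<omega>. (X \<omega>, \<omega>)))"
    using q by (subst nn_integral_distr[OF idm]) auto
  also have "\<dots> = (\<integral>\<^sup>+\<omega>. (\<integral>\<^sup>+p. ennreal (q (fst p) (snd p)) \<partial>N \<omega>) \<partial>M)"
    unfolding eq using q by (subst nn_integral_bind[OF _ NM]) auto
  also have "\<dots> = (\<integral>\<^sup>+\<omega>. ennreal (\<integral>y. q y \<omega> \<partial>k \<omega>) \<partial>M)"
  proof (rule nn_integral_cong)
    fix \<omega> assume w: "\<omega> \<in> space M"
    have "(\<integral>\<^sup>+p. ennreal (q (fst p) (snd p)) \<partial>N \<omega>) = (\<integral>\<^sup>+y. ennreal (q y \<omega>) \<partial>k \<omega>)"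
      unfolding N_def using q by (subst nn_integral_distr[OF Pk[OF w]]) auto
    also have "\<dots> = ennreal (\<integral>y. q y \<omega> \<partial>k \<omega>)"
      using q_bd by (intro nn_integral_eq_integral qk[OF w]) auto
    finally show "(\<integral>\<^sup>+p. ennreal (q (fst p) (snd p)) \<partial>N \<omega>) = ennreal (\<integral>y. q y \<omega> \<partial>k \<omega>)" .
  qed
  also have "\<dots> = ennreal (\<integral>\<omega>. (\<integral>y. q y \<omega> \<partial>k \<omega>) \<partial>M)"
    using inner measurable_from_subalg[OF sub meas]
    by (intro nn_integral_eq_integral integrable_const_bound[where B = 1]) auto
  finally show "(\<integral>\<omega>. q (X \<omega>) \<omega> \<partial>M) = (\<integral>\<omega>. (\<integral>y. q y \<omega> \<partial>k \<omega>) \<partial>M)"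
    using q_bd inner by (simp add: Bochner_Integration.integral_nonneg integral_nonneg_AE)
qed

section \<open>Lipschitz functions as a determining class\<close>

lemma measure_eq_of_lipschitz_tests:
  fixes X X' :: "'a \<Rightarrow> real"
  assumes "prob_space M" and X[measurable]: "X \<in> borel_measurable M" and X'[measurable]: "X' \<in> borel_measurable M"
    and A[measurable]: "A \<in> sets M"
    and test: "\<And>\<psi> c. (\<And>y. 0 \<le> \<psi> y \<and> \<psi> y \<le> 1) \<Longrightarrow> (\<And>y z. \<bar>\<psi> y - \<psi> z\<bar> \<le> c * \<bar>y - z\<bar>) \<Longrightarrow>
      (\<integral>\<omega>. indicator A \<omega> * \<psi> (X \<omega>) \<partial>M) = (\<integral>\<omega>. indicator A \<omega> * \<psi> (X' \<omega>) \<partial>M)"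
    and B: "B \<in> sets borel"
  shows "measure M (A \<inter> X -` B) = measure M (A \<inter> X' -` B)"
proof -
  interpret prob_space M by fact
  let ?N = "\<lambda>X :: 'a \<Rightarrow> real. distr (density M (indicator A)) borel X"
  have em: "emeasure (?N U) B = emeasure M (A \<inter> U -` B)" if [measurable]: "U \<in> borel_measurable M" and B: "B \<in> sets borel"
    for U :: "'a \<Rightarrow> real" and B
  proof -
    have "emeasure (?N U) B = emeasure M ((U -` B \<inter> space M) \<inter> A)"
      using B by (simp add: emeasure_distr emeasure_density indicator_inter_arith[symmetric] Int_commute)
    also have "(U -` B \<inter> space M) \<inter> A = A \<inter> U -` B" using sets.sets_into_space[OF A] by auto
    finally show ?thesis .
  qed
  \<comment> \<open>Ramps with slope \<open>n\<close> increase to the indicator of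
    \<open>{x<..}\<close>, and open half-lines determine a finite measure.\<close>
  define \<psi> where "\<psi> x n y = min 1 (real n * max 0 (y - x))" for x n and y :: real
  have tail: "(\<lambda>n. \<integral>\<omega>. indicator A \<omega> * \<psi> x n (U \<omega>) \<partial>M) \<longlonglongrightarrow> measure M (A \<inter> U -` {x<..})"
    if [measurable]: "U \<in> borel_measurable M" for U x
  proof -
    have "(\<lambda>n. \<integral>\<omega>. indicator A \<omega> * \<psi> x n (U \<omega>) \<partial>M) \<longlonglongrightarrow> (\<integral>\<omega>. indicator (A \<inter> U -` {x<..}) \<omega> \<partial>M)"
    proof (rule integral_dominated_convergence[where w = "\<lambda>_. 1"])
      have "A \<inter> U -` {x<..} = A \<inter> (U -` {x<..} \<inter> space M)" using sets.sets_into_space[OF A] by auto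
      then show "indicator (A \<inter> U -` {x<..}) \<in> borel_measurable M" by simp
      show "AE \<omega> in M. (\<lambda>n. indicator A \<omega> * \<psi> x n (U \<omega>)) \<longlonglongrightarrow> indicator (A \<inter> U -` {x<..}) \<omega>"
      proof (rule AE_I2)
        fix \<omega>
        have "\<forall>\<^sub>F n in sequentially. indicator A \<omega> * \<psi> x n (U \<omega>) = indicator (A \<inter> U -` {x<..}) \<omega>"
        proof (cases "x < U \<omega>")
          case True
          have "\<forall>\<^sub>F n in sequentially. 1 / (U \<omega> - x) \<le> real n"
            using filterlim_real_sequentially by (auto simp: filterlim_at_top)
          then show ?thesis
          proof eventually_elim
            case (elim n)
            then have "1 \<le> real n * (U \<omega> - x)" using True by (simp add: pos_divide_le_eq)
            then show ?case using True by (auto simp: \<psi>_def indicator_def)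
          qed
        qed (auto simp: \<psi>_def indicator_def)
        then show "(\<lambda>n. indicator A \<omega> * \<psi> x n (U \<omega>)) \<longlonglongrightarrow> indicator (A \<inter> U -` {x<..}) \<omega>"
          by (rule tendsto_eventually)
      qed
    qed (auto simp: \<psi>_def indicator_def)
    then show ?thesis
      using sets.sets_into_space[OF A] by (simp add: Int_absorb2 le_infI1)
  qed
  have "?N X = ?N X'"
  proof (rule measure_eqI_lessThan)
    fix x :: real
    show "emeasure (?N X) {x<..} < \<infinity>"
      unfolding em[OF X greaterThan_borel] using emeasure_finite by (simp add: less_top[symmetric])
    have "(\<integral>\<omega>. indicator A \<omega> * \<psi> x n (X \<omega>) \<partial>M) = (\<integral>\<omega>. indicator A \<omega> * \<psi> x n (X' \<omega>) \<partial>M)" for n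
    proof (rule test[where c = "real n"])
      fix y z
      have "\<bar>\<psi> x n y - \<psi> x n z\<bar> \<le> \<bar>real n * max 0 (y - x) - real n * max 0 (z - x)\<bar>"
        unfolding \<psi>_def by (auto simp: min_def)
      also have "\<dots> = real n * \<bar>max 0 (y - x) - max 0 (z - x)\<bar>"
        by (simp add: abs_mult flip: right_diff_distrib)
      also have "\<dots> \<le> real n * \<bar>y - z\<bar>"
        by (intro mult_left_mono) auto
      finally show "\<bar>\<psi> x n y - \<psi> x n z\<bar> \<le> real n * \<bar>y - z\<bar>" .
    qed (auto simp: \<psi>_def)
    then have "measure M (A \<inter> X -` {x<..}) = measure M (A \<inter> X' -` {x<..})"
      using tail[OF X, of x] tail[OF X', of x] LIMSEQ_unique by auto
    then show "emeasure (?N X) {x<..} = emeasure (?N X') {x<..}"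
      unfolding em[OF X greaterThan_borel] em[OF X' greaterThan_borel] by (simp add: emeasure_eq_measure)
  qed auto
  then have "emeasure M (A \<inter> X -` B) = emeasure M (A \<inter> X' -` B)"
    using em[OF X B] em[OF X' B] by simp
  then show ?thesis by (simp add: measure_def)
qed

section \<open>Invariance along the flow\<close>

text \<open>For slope \<open>e > 0\<close> let \<open>m\<close> be the infimum of the times
  violating the linear bound. By continuity \<open>m\<close> itself satisfies it, and the right
  derivative at \<open>m\<close> extends the bound beyond \<open>m\<close>, a contradiction.\<close>

lemma right_derivative_zero_imp_eq:
  fixes U :: "real \<Rightarrow> real"
  assumes "a \<le> b" and cont: "continuous_on {a..b} U"
    and der: "\<And>s. s \<in> {a..<b} \<Longrightarrow> ((\<lambda>h. (U (s + h) - U s) / h) \<longlongrightarrow> 0) (at_right 0)"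
  shows "U b = U a"
proof -
  have "\<bar>U b - U a\<bar> \<le> e * (b - a)" if "0 < e" for e
  proof (rule ccontr)
    assume b: "\<not> \<bar>U b - U a\<bar> \<le> e * (b - a)"
    define \<phi> where "\<phi> s = \<bar>U s - U a\<bar> - e * (s - a)" for s
    define N where "N = {s \<in> {a..b}. 0 < \<phi> s}"
    define m where "m = Inf N"
    have bN: "b \<in> N" using b \<open>a \<le> b\<close> by (simp add: N_def \<phi>_def)
    have bdd: "bdd_below N" by (auto simp: N_def intro!: bdd_belowI[of _ a])
    have mN: "m \<le> s" if "s \<in> N" for s
      unfolding m_def by (rule cInf_lower[OF that bdd])
    have am: "a \<le> m" unfolding m_def using bN by (intro cInf_greatest) (auto simp: N_def)
    have mb: "m \<le> b" by (rule mN[OF bN])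
    have cphi: "continuous_on {a..b} \<phi>"
      unfolding \<phi>_def by (intro continuous_intros cont)
    have phim: "\<phi> m \<le> 0"
    proof (rule ccontr)
      assume "\<not> \<phi> m \<le> 0"
      then have pos: "0 < \<phi> m" by simp
      then have "a \<noteq> m" by (auto simp: \<phi>_def)
      then have "a < m" using am by simp
      obtain d where d: "0 < d" "\<And>s. s \<in> {a..b} \<Longrightarrow> \<bar>s - m\<bar> < d \<Longrightarrow> \<bar>\<phi> s - \<phi> m\<bar> < \<phi> m"
        using cphi[unfolded continuous_on_iff, rule_format, of m "\<phi> m"] am mb pos
        unfolding dist_real_def by auto
      define s where "s = max a (m - d / 2)"
      have "s \<in> {a..b}" "\<bar>s - m\<bar> < d" "s < m"
        using \<open>a < m\<close> mb d(1) unfolding s_def by (auto simp: max_def)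
      with d(2)[of s] have "s \<in> N" by (auto simp: N_def)
      with mN[of s] \<open>s < m\<close> show False by simp
    qed
    have "m < b" using phim bN mb by (cases "m = b") (auto simp: N_def)
    then have "\<forall>\<^sub>F h in at_right 0. dist ((U (m + h) - U m) / h) 0 < e"
      using der[of m] am \<open>0 < e\<close> by (intro tendstoD) auto
    then obtain d where d: "0 < d" "\<And>h. 0 < h \<Longrightarrow> h < d \<Longrightarrow> \<bar>(U (m + h) - U m) / h\<bar> < e"
      unfolding eventually_at_right_field by (auto simp: dist_real_def)
    have "m + d \<le> s" if s: "s \<in> N" for s
    proof (rule ccontr)
      assume "\<not> m + d \<le> s"
      have "s \<noteq> m" using s phim by (auto simp: N_def)
      then have "0 < s - m" using mN[OF s] by simp
      moreover have "s - m < d" using \<open>\<not> m + d \<le> s\<close> by simp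
      ultimately have "\<bar>U s - U m\<bar> < e * (s - m)"
        using d(2)[of "s - m"] by (simp add: abs_divide pos_divide_less_eq)
      then have "\<phi> s \<le> 0"
        using phim unfolding \<phi>_def by (simp add: algebra_simps)
      then show False using s by (simp add: N_def)
    qed
    then have "m + d \<le> m" unfolding m_def using bN by (intro cInf_greatest) auto
    then show False using d(1) by simp
  qed
  note le = this
  have "\<bar>U b - U a\<bar> \<le> 0"
  proof (rule field_le_epsilon)
    fix e :: real assume "0 < e"
    then have "0 < e / (b - a + 1)" using \<open>a \<le> b\<close> by simp
    from le[OF this] have "\<bar>U b - U a\<bar> \<le> e * ((b - a) / (b - a + 1))" by simp
    also have "\<dots> \<le> e * 1" using \<open>a \<le> b\<close> \<open>0 < e\<close> by (intro mult_left_mono) auto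
    finally show "\<bar>U b - U a\<bar> \<le> 0 + e" by simp
  qed
  then show ?thesis by simp
qed

text \<open>A non-integrable function has integral 0 by convention, which also lies in the unit
  interval; measurability thus never has to be checked.\<close>

lemma (in prob_space) integral_unit_interval:
  fixes f :: "'a \<Rightarrow> real"
  assumes "\<And>x. 0 \<le> f x \<and> f x \<le> 1"
  shows "0 \<le> integral\<^sup>L M f \<and> integral\<^sup>L M f \<le> 1"
proof (cases "integrable M f")
  case True
  then show ?thesis
    using assms integral_le_const[OF True, of 1] Bochner_Integration.integral_nonneg[of M f] by simp
qed (simp add: not_integrable_integral_eq)

text \<open>Distribution functions are left behind: what counts is that \<open>T\<close> transports
  the kernels with a displacement of order \<open>h\<close> and derivative \<open>D\<close>, for
  almost every state. Continuity of \<open>D\<close> in the state is demanded on every path, since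
  measurability rests on it, whereas \<open>rc_field\<close> holds almost surely.\<close>

locale counterfactual_flow = prob_space M
  for M :: "'a measure" +
  fixes F :: "real \<Rightarrow> 'a measure" and D :: "'a \<Rightarrow> real \<Rightarrow> real \<Rightarrow> real"
    and \<tau> B L c\<^sub>T :: real and Yc :: "real \<Rightarrow> 'a \<Rightarrow> real" and k :: "real \<Rightarrow> real \<Rightarrow> 'a \<Rightarrow> real measure"
    and T :: "real \<Rightarrow> real \<Rightarrow> 'a \<Rightarrow> real \<Rightarrow> real"
  assumes subalg: "t \<in> {0..\<tau>} \<Longrightarrow> subalgebra M (F t)"
    and filtration: "0 \<le> r \<Longrightarrow> r \<le> t \<Longrightarrow> t \<le> \<tau> \<Longrightarrow> sets (F r) \<subseteq> sets (F t)"
    and D_adapted: "t \<in> {0..\<tau>} \<Longrightarrow> v \<le> t \<Longrightarrow> (\<lambda>\<omega>. D \<omega> v y) \<in> borel_measurable (F t)"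
    and D_cont: "\<omega> \<in> space M \<Longrightarrow> continuous_on UNIV (D \<omega> v)"
    and D_field: "AE \<omega> in M. rc_field (D \<omega>) B L"
    and law: "t \<in> {0..\<tau>} \<Longrightarrow> 0 \<le> h \<Longrightarrow> cond_law M (F t) (Yc (t + h)) (k t h)"
    and T_meas: "t \<in> {0..\<tau>} \<Longrightarrow> 0 \<le> h \<Longrightarrow> \<omega> \<in> space M \<Longrightarrow> T t h \<omega> \<in> borel_measurable borel"
    and T_distr: "t \<in> {0..\<tau>} \<Longrightarrow> 0 \<le> h \<Longrightarrow> \<omega> \<in> space M \<Longrightarrow> distr (k t 0 \<omega>) borel (T t h \<omega>) = k t h \<omega>"
    and T_close: "t \<in> {0..\<tau>} \<Longrightarrow> 0 \<le> h \<Longrightarrow> \<omega> \<in> space M \<Longrightarrow>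
      AE y in k t 0 \<omega>. \<bar>T t h \<omega> y - y\<bar> \<le> c\<^sub>T * h"
    and T_deriv: "t \<in> {0..\<tau>} \<Longrightarrow> \<omega> \<in> space M \<Longrightarrow>
      AE y in k t 0 \<omega>. ((\<lambda>h. (T t h \<omega> y - y) / h) \<longlongrightarrow> D \<omega> t y) (at_right 0)"
begin

section \<open>Measurability along the filtration\<close>

lemma space_F: "t \<in> {0..\<tau>} \<Longrightarrow> space (F t) = space M"
  using subalg[of t] by (simp add: subalgebra_def)

lemma Yc_measurable: "t \<in> {0..\<tau>} \<Longrightarrow> 0 \<le> h \<Longrightarrow> Yc (t + h) \<in> borel_measurable M"
  using law[of t h] by (simp add: cond_law_def)

lemma kernel:
  assumes "t \<in> {0..\<tau>}" "0 \<le> h" "\<omega> \<in> space M"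
  shows "prob_space (k t h \<omega>)" "sets (k t h \<omega>) = sets borel"
proof -
  have "k t h \<in> F t \<rightarrow>\<^sub>M prob_algebra borel"
    using law[OF assms(1,2)] by (simp add: cond_law_def)
  then have "k t h \<omega> \<in> space (prob_algebra borel)"
    by (rule measurable_space) (simp add: space_F[OF assms(1)] assms(3))
  then show "prob_space (k t h \<omega>)" "sets (k t h \<omega>) = sets borel"
    by (simp_all add: space_prob_algebra)
qed

lemma measurable_F_pair:
  fixes z :: "real \<times> 'a \<Rightarrow> real"
  assumes s: "s \<in> {0..\<tau>}" and z: "z \<in> borel_measurable (borel \<Otimes>\<^sub>M F s)"
  shows "(\<lambda>p. flow (D (snd p)) s t (z p)) \<in> borel_measurable (borel \<Otimes>\<^sub>M F s)"
    and "v \<le> s \<Longrightarrow> (\<lambda>p. D (snd p) v (z p)) \<in> borel_measurable (borel \<Otimes>\<^sub>M F s)"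
proof -
  have D: "(\<lambda>p :: real \<times> 'a. D (snd p) v y) \<in> borel_measurable (borel \<Otimes>\<^sub>M F s)" if "v \<le> s" for v y
    by (rule measurable_compose[OF measurable_snd D_adapted[OF s that]])
  have c: "continuous_on UNIV (D (snd p) v)" if "p \<in> space (borel \<Otimes>\<^sub>M F s)" for v and p :: "real \<times> 'a"
    by (rule D_cont) (use that space_F[OF s] in \<open>simp add: space_pair_measure mem_Times_iff\<close>)
  show "(\<lambda>p. flow (D (snd p)) s t (z p)) \<in> borel_measurable (borel \<Otimes>\<^sub>M F s)"
    by (rule borel_measurable_flow[where F = "\<lambda>p. D (snd p)", OF D c z])
  show "v \<le> s \<Longrightarrow> (\<lambda>p. D (snd p) v (z p)) \<in> borel_measurable (borel \<Otimes>\<^sub>M F s)"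
    by (rule borel_measurable_caratheodory[where F = "\<lambda>p. D (snd p) v", OF D c z])
qed

lemma measurable_pair_F:
  assumes "s \<in> {0..\<tau>}" "X \<in> borel_measurable M"
  shows "(\<lambda>\<omega>. (X \<omega>, \<omega>)) \<in> M \<rightarrow>\<^sub>M borel \<Otimes>\<^sub>M F s"
  by (intro measurable_Pair assms measurable_from_subalg[OF subalg[OF assms(1)]] measurable_ident_sets refl)

lemma flow_measurable_F:
  assumes "s \<in> {0..\<tau>}" "X \<in> borel_measurable M"
  shows "(\<lambda>\<omega>. flow (D \<omega>) s t (X \<omega>)) \<in> borel_measurable M"
proof -
  from measurable_compose[OF measurable_pair_F[OF assms] measurable_F_pair(1)[OF assms(1) measurable_fst]]
  show ?thesis by simp
qed

section \<open>The pulled-back test function and its mean\<close>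

context
  fixes t c :: real and A :: "'a set" and \<psi> :: "real \<Rightarrow> real"
  assumes t: "t \<in> {0..\<tau>}" and A: "A \<in> sets (F t)"
    and psi: "\<And>y. 0 \<le> \<psi> y \<and> \<psi> y \<le> 1"
    and psi_lip: "\<And>y z. \<bar>\<psi> y - \<psi> z\<bar> \<le> c * \<bar>y - z\<bar>"
begin

definition q :: "real \<Rightarrow> real \<Rightarrow> 'a \<Rightarrow> real" where
  "q s y \<omega> = indicator A \<omega> * \<psi> (flow (D \<omega>) s t y)"

text \<open>Euler substitute for \<open>q (s + h)\<close>; it depends on the path only up to
  \<open>s\<close>.\<close>

definition q_step :: "real \<Rightarrow> real \<Rightarrow> real \<Rightarrow> 'a \<Rightarrow> real" where
  "q_step s h y \<omega> = q s (y - h * D \<omega> s y) \<omega>"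

definition U :: "real \<Rightarrow> real" where
  "U s = (\<integral>\<omega>. q s (Yc s \<omega>) \<omega> \<partial>M)"

text \<open>Lipschitz constant of \<open>q s\<close> in the state: that of \<open>\<psi>\<close>
  times that of the flow over the longest possible duration \<open>\<tau>\<close>.\<close>

definition c\<^sub>q :: real where "c\<^sub>q = c * (2 * exp (2 * L * \<tau>))"

lemma q_bounds: "0 \<le> q s y \<omega> \<and> q s y \<omega> \<le> 1"
  using psi by (auto simp: q_def indicator_def)

lemma c_nonneg: "0 \<le> c"
  using order_trans[OF abs_ge_zero psi_lip[of 1 0]] by simp

lemma cq_nonneg: "0 \<le> c\<^sub>q"
  using c_nonneg by (simp add: c\<^sub>q_def)

lemma A_in: "t \<le> s \<Longrightarrow> s \<le> \<tau> \<Longrightarrow> A \<in> sets (F s)"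
  using filtration[of t s] A t by auto

lemma q_measurable_pair:
  fixes z :: "real \<times> 'a \<Rightarrow> real"
  assumes "t \<le> s" "s \<le> \<tau>" and z: "z \<in> borel_measurable (borel \<Otimes>\<^sub>M F s)"
  shows "(\<lambda>p. q s (z p) (snd p)) \<in> borel_measurable (borel \<Otimes>\<^sub>M F s)"
proof -
  have s: "s \<in> {0..\<tau>}" using assms t by auto
  have "\<psi> \<in> borel_measurable borel"
    using psi_lip by (intro borel_measurable_continuous_onI continuous_on_eq_continuous_at[THEN iffD2]
        lipschitz_on_continuous_on[of c] lipschitz_onI) (auto simp: dist_real_def c_nonneg)
  then have "(\<lambda>p. \<psi> (flow (D (snd p)) s t (z p))) \<in> borel_measurable (borel \<Otimes>\<^sub>M F s)"
    by (rule measurable_compose[OF measurable_F_pair(1)[OF s z]])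
  moreover have "(\<lambda>p. indicator A (snd p) :: real) \<in> borel_measurable (borel \<Otimes>\<^sub>M F s :: (real \<times> 'a) measure)"
    by (rule measurable_compose[OF measurable_snd]) (use A_in[OF assms(1,2)] in simp)
  ultimately show ?thesis
    unfolding q_def by (intro borel_measurable_times)
qed

lemma q_step_measurable_pair:
  assumes "t \<le> s" "s \<le> \<tau>"
  shows "(\<lambda>p. q_step s h (fst p) (snd p)) \<in> borel_measurable (borel \<Otimes>\<^sub>M F s)"
proof -
  have s: "s \<in> {0..\<tau>}" using assms t by auto
  have [measurable]: "(\<lambda>p. D (snd p) s (fst p)) \<in> borel_measurable (borel \<Otimes>\<^sub>M F s)"
    by (rule measurable_F_pair(2)[OF s measurable_fst order_refl])
  show ?thesis
    unfolding q_step_def by (intro q_measurable_pair[OF assms]) measurable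
qed

lemma q_lipschitz:
  assumes "rc_field (D \<omega>) B L" "t \<le> s" "s \<le> \<tau>"
  shows "\<bar>q s y \<omega> - q s z \<omega>\<bar> \<le> c\<^sub>q * \<bar>y - z\<bar>"
proof -
  interpret rc_field "D \<omega>" B L by fact
  have "\<bar>q s y \<omega> - q s z \<omega>\<bar> \<le> \<bar>\<psi> (flow (D \<omega>) s t y) - \<psi> (flow (D \<omega>) s t z)\<bar>"
    by (auto simp: q_def indicator_def)
  also have "\<dots> \<le> c * \<bar>flow (D \<omega>) s t y - flow (D \<omega>) s t z\<bar>" by (rule psi_lip)
  also have "\<dots> \<le> c * (2 * exp (2 * L * (s - t)) * \<bar>y - z\<bar>)"
    by (intro mult_left_mono flow_lipschitz assms c_nonneg)
  also have "\<dots> \<le> c * (2 * exp (2 * L * \<tau>) * \<bar>y - z\<bar>)"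
    using assms t L_pos by (intro mult_left_mono mult_right_mono c_nonneg) auto
  finally show ?thesis by (simp add: c\<^sub>q_def mult_ac)
qed

lemma q_flow: "rc_field (D \<omega>) B L \<Longrightarrow> t \<le> s \<Longrightarrow> 0 \<le> h \<Longrightarrow>
    q (s + h) y \<omega> = q s (flow (D \<omega>) (s + h) s y) \<omega>"
  by (simp add: q_def rc_field.flow_semigroup[of _ _ _ t s "s + h"])

text \<open>The semigroup property turns both terms into values of \<open>q s\<close>, so only two
  states at time \<open>s\<close> have to be compared.\<close>

lemma flow_step_error:
  assumes "rc_field (D \<omega>) B L" "t \<le> s" "s + h \<le> \<tau>" "0 \<le> h"
  shows "\<bar>q (s + h) y \<omega> - q_step s h y \<omega>\<bar> \<le> c\<^sub>q * \<bar>flow (D \<omega>) (s + h) s y - (y - h * D \<omega> s y)\<bar>"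
  unfolding q_flow[OF assms(1,2,4)] q_step_def
  by (rule q_lipschitz[OF assms(1,2)]) (use assms in auto)

text \<open>A crude bound for domination and for the Lipschitz continuity of \<open>U\<close>; the
  order o(h) comes from \<open>flow_step_tendsto\<close>.\<close>

lemma flow_step_bound:
  assumes "rc_field (D \<omega>) B L" "0 \<le> h"
  shows "\<bar>flow (D \<omega>) (s + h) s y - (y - h * D \<omega> s y)\<bar> \<le> 2 * B * h"
proof -
  interpret rc_field "D \<omega>" B L by fact
  have "\<bar>y - flow (D \<omega>) (s + h) s y\<bar> \<le> B * h"
    using flow_lipschitz_time[of s "s + h" "s + h" y] \<open>0 \<le> h\<close> by (simp add: flow_beyond)
  moreover have "\<bar>h * D \<omega> s y\<bar> \<le> h * B"
    using mult_left_mono[OF bound[of s y] \<open>0 \<le> h\<close>] \<open>0 \<le> h\<close> by (simp add: abs_mult)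
  ultimately show ?thesis by (simp add: mult.commute abs_le_iff algebra_simps)
qed

lemma q_random:
  assumes "t \<le> s" "s \<le> \<tau>" "X \<in> borel_measurable M"
  shows "(\<lambda>\<omega>. q s (X \<omega>) \<omega>) \<in> borel_measurable M"
    and "(\<lambda>\<omega>. q_step s h (X \<omega>) \<omega>) \<in> borel_measurable M"
proof -
  have "s \<in> {0..\<tau>}" using assms t by auto
  note * = measurable_pair_F[OF this assms(3)]
  show "(\<lambda>\<omega>. q s (X \<omega>) \<omega>) \<in> borel_measurable M"
    using measurable_compose[OF * q_measurable_pair[OF assms(1,2) measurable_fst]] by simp
  show "(\<lambda>\<omega>. q_step s h (X \<omega>) \<omega>) \<in> borel_measurable M"
    using measurable_compose[OF * q_step_measurable_pair[OF assms(1,2)]] by simp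
qed

lemma q_step_bounds: "0 \<le> q_step s h y \<omega> \<and> q_step s h y \<omega> \<le> 1"
  by (simp add: q_step_def q_bounds)

lemma q_integrable:
  assumes "t \<le> s" "s \<le> \<tau>" "X \<in> borel_measurable M"
  shows "integrable M (\<lambda>\<omega>. q s (X \<omega>) \<omega>)" "integrable M (\<lambda>\<omega>. q_step s h (X \<omega>) \<omega>)"
  using q_random[OF assms] q_bounds q_step_bounds by (auto intro!: integrable_const_bound[where B = 1])

text \<open>Conditional mean, given the history up to \<open>s\<close>, of the change from
  \<open>q s\<close> at \<open>Yc s\<close> to \<open>q_step s h\<close> at
  \<open>Yc (s + h)\<close>.\<close>

definition J :: "real \<Rightarrow> real \<Rightarrow> 'a \<Rightarrow> real" where
  "J s h \<omega> = (\<integral>y. q_step s h y \<omega> \<partial>k s h \<omega>) - (\<integral>y. q s y \<omega> \<partial>k s 0 \<omega>)"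

lemma J_measurable:
  assumes "t \<le> s" "s \<le> \<tau>" "0 \<le> h"
  shows "J s h \<in> borel_measurable M"
    and "(\<integral>\<omega>. J s h \<omega> \<partial>M) = (\<integral>\<omega>. q_step s h (Yc (s + h) \<omega>) \<omega> \<partial>M) - U s"
    and "integrable M (J s h)"
proof -
  have s: "s \<in> {0..\<tau>}" using assms t by auto
  note d1 = disintegration[OF prob_space_axioms subalg[OF s] law[OF s \<open>0 \<le> h\<close>]
      q_step_measurable_pair[OF assms(1,2)] q_step_bounds, of h]
  note d2 = disintegration[OF prob_space_axioms subalg[OF s] law[OF s order_refl]
      q_measurable_pair[OF assms(1,2) measurable_fst] q_bounds]
  note m = measurable_from_subalg[OF subalg[OF s]]
  have i1: "integrable M (\<lambda>\<omega>. \<integral>y. q_step s h y \<omega> \<partial>k s h \<omega>)"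
  proof (rule integrable_const_bound[where B = 1, OF AE_I2 m[OF d1(1)]])
    fix \<omega> assume w: "\<omega> \<in> space M"
    interpret p: prob_space "k s h \<omega>" by (rule kernel[OF s \<open>0 \<le> h\<close> w])
    show "norm (\<integral>y. q_step s h y \<omega> \<partial>k s h \<omega>) \<le> 1"
      using p.integral_unit_interval[OF q_step_bounds] by simp
  qed
  have i2: "integrable M (\<lambda>\<omega>. \<integral>y. q s y \<omega> \<partial>k s 0 \<omega>)"
  proof (rule integrable_const_bound[where B = 1, OF AE_I2 m[OF d2(1)]])
    fix \<omega> assume w: "\<omega> \<in> space M"
    interpret p: prob_space "k s 0 \<omega>" by (rule kernel[OF s order_refl w])
    show "norm (\<integral>y. q s y \<omega> \<partial>k s 0 \<omega>) \<le> 1"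
      using p.integral_unit_interval[OF q_bounds] by simp
  qed
  show "integrable M (J s h)" "J s h \<in> borel_measurable M"
    unfolding J_def using i1 i2 by (auto intro: borel_measurable_integrable)
  show "(\<integral>\<omega>. J s h \<omega> \<partial>M) = (\<integral>\<omega>. q_step s h (Yc (s + h) \<omega>) \<omega> \<partial>M) - U s"
    unfolding J_def U_def Bochner_Integration.integral_diff[OF i1 i2] d1(2) using d2(2) by simp
qed

text \<open>Transport by \<open>T\<close> brings both kernel integrals under the law
  \<open>k s 0 \<omega>\<close>, where they can be compared state by state.\<close>

lemma J_eq:
  assumes "t \<le> s" "s \<le> \<tau>" "0 \<le> h" "\<omega> \<in> space M"
  shows "J s h \<omega> = (\<integral>y. (q_step s h (T s h \<omega> y) \<omega> - q s y \<omega>) \<partial>k s 0 \<omega>)"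
    and "(\<lambda>y. q_step s h (T s h \<omega> y) \<omega> - q s y \<omega>) \<in> borel_measurable (k s 0 \<omega>)"
proof -
  have s: "s \<in> {0..\<tau>}" using assms t by auto
  interpret p: prob_space "k s 0 \<omega>" by (rule kernel[OF s order_refl assms(4)])
  have sets0: "sets (k s 0 \<omega>) = sets borel" by (rule kernel[OF s order_refl assms(4)])
  have pair: "(\<lambda>y. (y, \<omega>)) \<in> borel \<rightarrow>\<^sub>M borel \<Otimes>\<^sub>M F s"
    by (rule measurable_Pair2') (use assms(4) space_F[OF s] in simp)
  have m1: "(\<lambda>y. q_step s h y \<omega>) \<in> borel_measurable borel"
    using measurable_compose[OF pair q_step_measurable_pair[OF assms(1,2)]] by simp
  have m2: "(\<lambda>y. q s y \<omega>) \<in> borel_measurable (k s 0 \<omega>)"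
    unfolding measurable_cong_sets[OF sets0 refl]
    using measurable_compose[OF pair q_measurable_pair[OF assms(1,2) measurable_fst]] by simp
  have T: "T s h \<omega> \<in> k s 0 \<omega> \<rightarrow>\<^sub>M borel"
    unfolding measurable_cong_sets[OF sets0 refl] by (rule T_meas[OF s assms(3,4)])
  have m3: "(\<lambda>y. q_step s h (T s h \<omega> y) \<omega>) \<in> borel_measurable (k s 0 \<omega>)"
    by (rule measurable_compose[OF T m1])
  show "(\<lambda>y. q_step s h (T s h \<omega> y) \<omega> - q s y \<omega>) \<in> borel_measurable (k s 0 \<omega>)"
    using m2 m3 by measurable
  have "(\<integral>y. q_step s h y \<omega> \<partial>k s h \<omega>) = (\<integral>y. q_step s h (T s h \<omega> y) \<omega> \<partial>k s 0 \<omega>)"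
    unfolding T_distr[OF s assms(3,4), symmetric] by (rule integral_distr[OF T m1])
  moreover have "integrable (k s 0 \<omega>) (\<lambda>y. q s y \<omega>)"
    "integrable (k s 0 \<omega>) (\<lambda>y. q_step s h (T s h \<omega> y) \<omega>)"
    using m2 m3 q_bounds q_step_bounds by (auto intro!: p.integrable_const_bound[where B = 1])
  ultimately show "J s h \<omega> = (\<integral>y. (q_step s h (T s h \<omega> y) \<omega> - q s y \<omega>) \<partial>k s 0 \<omega>)"
    unfolding J_def by simp
qed

text \<open>With \<open>z = T s h \<omega> y\<close> the displacement \<open>z - y\<close> is about
  \<open>h * D \<omega> s y\<close>, and the Euler step takes back
  \<open>h * D \<omega> s z\<close>. The mismatch between the two field values is settled by
  continuity in the state.\<close>

lemma transform_step_error: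
  assumes "rc_field (D \<omega>) B L" "t \<le> s" "s \<le> \<tau>"
  shows "\<bar>q_step s h z \<omega> - q s y \<omega>\<bar> \<le> c\<^sub>q * \<bar>z - y - h * D \<omega> s z\<bar>"
  unfolding q_step_def using q_lipschitz[OF assms, of "z - h * D \<omega> s z" y] by (simp add: algebra_simps)

lemma transform_step_bound:
  assumes "rc_field (D \<omega>) B L" "t \<le> s" "s \<le> \<tau>" "0 \<le> h" and z: "\<bar>z - y\<bar> \<le> c\<^sub>T * h"
  shows "\<bar>q_step s h z \<omega> - q s y \<omega>\<bar> \<le> c\<^sub>q * (c\<^sub>T + B) * h"
proof -
  interpret rc_field "D \<omega>" B L by fact
  have "\<bar>h * D \<omega> s z\<bar> \<le> h * B"
    using mult_left_mono[OF bound[of s z] \<open>0 \<le> h\<close>] \<open>0 \<le> h\<close> by (simp add: abs_mult)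
  then have "\<bar>z - y - h * D \<omega> s z\<bar> \<le> (c\<^sub>T + B) * h"
    using z by (simp add: algebra_simps)
  then have "c\<^sub>q * \<bar>z - y - h * D \<omega> s z\<bar> \<le> c\<^sub>q * ((c\<^sub>T + B) * h)"
    by (rule mult_left_mono[OF _ cq_nonneg])
  then show ?thesis
    using transform_step_error[OF assms(1-3), of h z y] by (simp add: mult.assoc)
qed

lemma J_bound:
  assumes "rc_field (D \<omega>) B L" "t \<le> s" "s \<le> \<tau>" "0 \<le> h" "\<omega> \<in> space M"
  shows "\<bar>J s h \<omega>\<bar> \<le> c\<^sub>q * (c\<^sub>T + B) * h"
proof -
  have s: "s \<in> {0..\<tau>}" using assms t by auto
  interpret p: prob_space "k s 0 \<omega>" by (rule kernel[OF s order_refl assms(5)])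
  let ?g = "\<lambda>y. q_step s h (T s h \<omega> y) \<omega> - q s y \<omega>"
  have ae: "AE y in k s 0 \<omega>. \<bar>?g y\<bar> \<le> c\<^sub>q * (c\<^sub>T + B) * h"
    using T_close[OF s assms(4,5)] by eventually_elim (rule transform_step_bound[OF assms(1-4)])
  have int: "integrable (k s 0 \<omega>) ?g"
    using ae by (intro p.integrable_const_bound[OF _ J_eq(2)[OF assms(2-5)]]) auto
  have "\<bar>integral\<^sup>L (k s 0 \<omega>) ?g\<bar> \<le> (\<integral>y. \<bar>?g y\<bar> \<partial>k s 0 \<omega>)"
    by (rule integral_abs_bound)
  also have "\<dots> \<le> c\<^sub>q * (c\<^sub>T + B) * h"
    using ae int by (intro p.integral_le_const) auto
  finally show ?thesis unfolding J_eq(1)[OF assms(2-5)] .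
qed

section \<open>Increments and right derivative of the functional \<open>U\<close>\<close>

lemma U_increment:
  assumes "t \<le> s" "s + h \<le> \<tau>" "0 \<le> h"
  shows "U (s + h) - U s = (\<integral>\<omega>. (q (s + h) (Yc (s + h) \<omega>) \<omega> - q_step s h (Yc (s + h) \<omega>) \<omega>) \<partial>M)
    + (\<integral>\<omega>. J s h \<omega> \<partial>M)"
proof -
  have s: "s \<in> {0..\<tau>}" "t \<le> s + h" "s \<le> \<tau>" using assms t by auto
  have Y: "Yc (s + h) \<in> borel_measurable M" by (rule Yc_measurable[OF s(1) assms(3)])
  show ?thesis
    unfolding J_measurable(2)[OF assms(1) s(3) assms(3)]
      Bochner_Integration.integral_diff[OF q_integrable(1)[OF s(2) assms(2) Y] q_integrable(2)[OF assms(1) s(3) Y]]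
    by (simp add: U_def)
qed

text \<open>Of the constant, \<open>2 * B\<close> comes from replacing the flow by an Euler step and
  \<open>c\<^sub>T + B\<close> from the transform of the law.\<close>

lemma U_lipschitz:
  assumes "t \<le> s" "s + h \<le> \<tau>" "0 \<le> h"
  shows "\<bar>U (s + h) - U s\<bar> \<le> c\<^sub>q * (c\<^sub>T + 3 * B) * h"
proof -
  have s: "s \<in> {0..\<tau>}" "t \<le> s + h" "s \<le> \<tau>" using assms t by auto
  have Y: "Yc (s + h) \<in> borel_measurable M" by (rule Yc_measurable[OF s(1) assms(3)])
  let ?g = "\<lambda>\<omega>. q (s + h) (Yc (s + h) \<omega>) \<omega> - q_step s h (Yc (s + h) \<omega>) \<omega>"
  have gi: "integrable M ?g"
    using q_integrable(1)[OF s(2) assms(2) Y] q_integrable(2)[OF assms(1) s(3) Y] by simp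
  have "\<bar>integral\<^sup>L M ?g\<bar> \<le> (\<integral>\<omega>. \<bar>?g \<omega>\<bar> \<partial>M)" by (rule integral_abs_bound)
  also have "\<dots> \<le> c\<^sub>q * (2 * B * h)"
  proof (rule integral_le_const)
    show "AE \<omega> in M. \<bar>?g \<omega>\<bar> \<le> c\<^sub>q * (2 * B * h)"
      using D_field
    proof eventually_elim
      case (elim \<omega>)
      show ?case
        using flow_step_error[OF elim assms, of "Yc (s + h) \<omega>"]
          mult_left_mono[OF flow_step_bound[OF elim assms(3), of s "Yc (s + h) \<omega>"] cq_nonneg]
        by linarith
    qed
  qed (use gi in simp)
  finally have 1: "\<bar>integral\<^sup>L M ?g\<bar> \<le> c\<^sub>q * (2 * B * h)" .
  have "\<bar>integral\<^sup>L M (J s h)\<bar> \<le> (\<integral>\<omega>. \<bar>J s h \<omega>\<bar> \<partial>M)" by (rule integral_abs_bound)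
  also have "\<dots> \<le> c\<^sub>q * (c\<^sub>T + B) * h"
  proof (rule integral_le_const)
    show "AE \<omega> in M. \<bar>J s h \<omega>\<bar> \<le> c\<^sub>q * (c\<^sub>T + B) * h"
      using D_field AE_space
      by eventually_elim (rule J_bound[OF _ assms(1) s(3) assms(3)])
  qed (use J_measurable(3)[OF assms(1) s(3) assms(3)] in simp)
  finally have "\<bar>integral\<^sup>L M (J s h)\<bar> \<le> c\<^sub>q * (c\<^sub>T + B) * h" .
  with 1 show ?thesis
    unfolding U_increment[OF assms] by (simp add: algebra_simps)
qed

text \<open>The states \<open>y n\<close> are arbitrary: they will be values of
  \<open>Yc (s + h n)\<close>, for which no continuity in time is assumed. Uniformity of the
  right-continuity in the state is essential here.\<close>

lemma flow_step_tendsto: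
  assumes "rc_field (D \<omega>) B L" and h: "h \<longlonglongrightarrow> 0" "\<And>n. 0 < h n"
  shows "(\<lambda>n. (flow (D \<omega>) (s + h n) s (y n) - (y n - h n * D \<omega> s (y n))) / h n) \<longlonglongrightarrow> 0"
proof (rule tendstoI)
  interpret rc_field "D \<omega>" B L by fact
  fix e :: real assume "0 < e"
  then have "\<forall>\<^sub>F v in at_right s. \<forall>y. \<bar>D \<omega> v y - D \<omega> s y\<bar> \<le> e / 3"
    by (intro right_cont) simp
  then obtain b where b: "s < b" "\<And>v y. s < v \<Longrightarrow> v < b \<Longrightarrow> \<bar>D \<omega> v y - D \<omega> s y\<bar> \<le> e / 3"
    unfolding eventually_at_right_field by blast
  have "(\<lambda>n. L * B * h n) \<longlonglongrightarrow> L * B * 0" by (intro tendsto_intros h)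
  then have "\<forall>\<^sub>F n in sequentially. L * B * h n < e / 3"
    using \<open>0 < e\<close> by (intro order_tendstoD) auto
  moreover have "\<forall>\<^sub>F n in sequentially. h n < b - s"
    by (rule order_tendstoD[OF h(1)]) (use b in simp)
  ultimately show "\<forall>\<^sub>F n in sequentially.
      dist ((flow (D \<omega>) (s + h n) s (y n) - (y n - h n * D \<omega> s (y n))) / h n) 0 < e"
  proof eventually_elim
    case (elim n)
    have "\<bar>flow (D \<omega>) (s + h n) s (y n) - (y n - h n * D \<omega> s (y n))\<bar> \<le> (L * B * h n + e / 3) * h n"
      using elim b \<open>0 < e\<close> h(2)[of n] by (intro flow_expansion) auto
    also have "\<dots> < e * h n"
      using elim \<open>0 < e\<close> h(2)[of n] by (intro mult_strict_right_mono) auto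
    finally show ?case
      using h(2)[of n] by (simp add: dist_real_def abs_divide pos_divide_less_eq)
  qed
qed

lemma J_tendsto:
  assumes field: "rc_field (D \<omega>) B L" and s: "t \<le> s" "s < \<tau>" and w: "\<omega> \<in> space M"
    and h: "h \<longlonglongrightarrow> 0" "\<And>n. 0 < h n"
  shows "(\<lambda>n. J s (h n) \<omega> / h n) \<longlonglongrightarrow> 0"
proof -
  interpret rc_field "D \<omega>" B L by (rule field)
  have s': "s \<in> {0..\<tau>}" "s \<le> \<tau>" using s t by auto
  have h0: "0 \<le> h n" for n using h(2)[of n] by simp
  interpret p: prob_space "k s 0 \<omega>" by (rule kernel[OF s'(1) order_refl w])
  have hr: "filterlim h (at_right 0) sequentially"
    using h by (auto simp: filterlim_at less_imp_neq[THEN not_sym])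
  let ?T = "\<lambda>n. T s (h n) \<omega>"
  let ?g = "\<lambda>n y. (q_step s (h n) (?T n y) \<omega> - q s y \<omega>) / h n"
  \<comment> \<open>Along a sequence of steps the exceptional sets of states are countably many, so
    one null set serves all \<open>n\<close>.\<close>
  have close: "AE y in k s 0 \<omega>. \<forall>n. \<bar>?T n y - y\<bar> \<le> c\<^sub>T * h n"
    unfolding AE_all_countable using T_close[OF s'(1) h0 w] by blast
  have "(\<lambda>n. \<integral>y. ?g n y \<partial>k s 0 \<omega>) \<longlonglongrightarrow> (\<integral>y. 0 \<partial>k s 0 \<omega>)"
  proof (rule integral_dominated_convergence[where w = "\<lambda>_. c\<^sub>q * (c\<^sub>T + B)"])
    show "?g n \<in> borel_measurable (k s 0 \<omega>)" for n
      using J_eq(2)[OF s(1) s'(2) h0 w] by (intro borel_measurable_divide) auto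
    show "AE y in k s 0 \<omega>. norm (?g n y) \<le> c\<^sub>q * (c\<^sub>T + B)" for n
      using close
    proof eventually_elim
      case (elim y)
      have "\<bar>q_step s (h n) (?T n y) \<omega> - q s y \<omega>\<bar> \<le> c\<^sub>q * (c\<^sub>T + B) * h n"
        by (rule transform_step_bound[OF field s(1) s'(2) h0 elim[rule_format]])
      then show ?case using h(2)[of n] by (simp add: abs_divide pos_divide_le_eq)
    qed
    show "AE y in k s 0 \<omega>. (\<lambda>n. ?g n y) \<longlonglongrightarrow> 0"
      using close T_deriv[OF s'(1) w]
    proof eventually_elim
      case (elim y)
      have d: "(\<lambda>n. (?T n y - y) / h n) \<longlonglongrightarrow> D \<omega> s y"
        by (rule filterlim_compose[OF elim(2) hr])
      have "(\<lambda>n. (?T n y - y) / h n * h n) \<longlonglongrightarrow> D \<omega> s y * 0"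
        by (intro tendsto_mult d h)
      then have "(\<lambda>n. ?T n y - y) \<longlonglongrightarrow> 0" using h(2) by (simp add: less_imp_neq[THEN not_sym])
      then have "(\<lambda>n. ?T n y) \<longlonglongrightarrow> y" by (rule LIM_zero_cancel)
      then have "(\<lambda>n. D \<omega> s (?T n y)) \<longlonglongrightarrow> D \<omega> s y"
        by (rule continuous_on_tendsto_compose[OF continuous_D[of UNIV]]) auto
      with d have "(\<lambda>n. (?T n y - y) / h n - D \<omega> s (?T n y)) \<longlonglongrightarrow> D \<omega> s y - D \<omega> s y"
        by (intro tendsto_diff)
      then have "(\<lambda>n. c\<^sub>q * \<bar>(?T n y - y) / h n - D \<omega> s (?T n y)\<bar>) \<longlonglongrightarrow> c\<^sub>q * \<bar>0\<bar>"
        by (intro tendsto_intros) simp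
      then have lim: "(\<lambda>n. c\<^sub>q * \<bar>(?T n y - y) / h n - D \<omega> s (?T n y)\<bar>) \<longlonglongrightarrow> 0" by simp
      show ?case
      proof (rule Lim_null_comparison[OF always_eventually lim], rule allI)
        fix n
        have "\<bar>?T n y - y - h n * D \<omega> s (?T n y)\<bar> = h n * \<bar>(?T n y - y) / h n - D \<omega> s (?T n y)\<bar>"
          using h(2)[of n] by (simp add: field_simps flip: abs_mult_pos)
        then have "\<bar>q_step s (h n) (?T n y) \<omega> - q s y \<omega>\<bar>
            \<le> c\<^sub>q * \<bar>(?T n y - y) / h n - D \<omega> s (?T n y)\<bar> * h n"
          using transform_step_error[OF field s(1) s'(2), of "h n" "?T n y" y] by (simp add: mult_ac)
        then show "norm (?g n y) \<le> c\<^sub>q * \<bar>(?T n y - y) / h n - D \<omega> s (?T n y)\<bar>"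
          using h(2)[of n] by (simp add: abs_divide pos_divide_le_eq)
      qed
    qed
  qed auto
  then show ?thesis
    unfolding J_eq(1)[OF s(1) s'(2) h0 w] by simp
qed

lemma U_right_derivative:
  assumes s: "s \<in> {t..<\<tau>}"
  shows "((\<lambda>h. (U (s + h) - U s) / h) \<longlongrightarrow> 0) (at_right 0)"
\<comment> \<open>Passing to sequences makes dominated convergence applicable, over states inside
  \<open>J\<close> and over paths outside.\<close>
proof (rule tendsto_at_right_sequentially[where b = "\<tau> - s"])
  show "0 < \<tau> - s" using s by simp
  fix h :: "nat \<Rightarrow> real"
  assume h: "\<And>n. 0 < h n" "\<And>n. h n < \<tau> - s" "h \<longlonglongrightarrow> 0"
  have s': "s \<in> {0..\<tau>}" "t \<le> s" "s \<le> \<tau>" "s < \<tau>" using s t by auto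
  have h0: "0 \<le> h n" and sh: "s + h n \<le> \<tau>" "t \<le> s + h n" for n
    using h(1)[of n] h(2)[of n] s' by auto
  have Y: "Yc (s + h n) \<in> borel_measurable M" for n by (rule Yc_measurable[OF s'(1) h0])
  let ?g = "\<lambda>n \<omega>. (q (s + h n) (Yc (s + h n) \<omega>) \<omega> - q_step s (h n) (Yc (s + h n) \<omega>) \<omega>) / h n"
  have "(\<lambda>n. \<integral>\<omega>. ?g n \<omega> \<partial>M) \<longlonglongrightarrow> (\<integral>\<omega>. 0 \<partial>M)"
  proof (rule integral_dominated_convergence[where w = "\<lambda>_. c\<^sub>q * (2 * B)"])
    show "?g n \<in> borel_measurable M" for n
      using q_random(1)[OF sh(2,1) Y] q_random(2)[OF s'(2,3) Y] by (intro borel_measurable_divide) auto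
    show "AE \<omega> in M. norm (?g n \<omega>) \<le> c\<^sub>q * (2 * B)" for n
      using D_field
    proof eventually_elim
      case (elim \<omega>)
      show ?case
        using flow_step_error[OF elim s'(2) sh(1) h0, of n "Yc (s + h n) \<omega>"]
          mult_left_mono[OF flow_step_bound[OF elim h0, of s n "Yc (s + h n) \<omega>"] cq_nonneg] h(1)[of n]
        by (simp add: abs_divide pos_divide_le_eq mult.assoc)
    qed
    show "AE \<omega> in M. (\<lambda>n. ?g n \<omega>) \<longlonglongrightarrow> 0"
      using D_field
    proof eventually_elim
      case (elim \<omega>)
      let ?e = "\<lambda>n. (flow (D \<omega>) (s + h n) s (Yc (s + h n) \<omega>)
        - (Yc (s + h n) \<omega> - h n * D \<omega> s (Yc (s + h n) \<omega>))) / h n"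
      have "(\<lambda>n. c\<^sub>q * \<bar>?e n\<bar>) \<longlonglongrightarrow> c\<^sub>q * \<bar>0\<bar>"
        by (intro tendsto_intros flow_step_tendsto[OF elim h(3,1)])
      then have lim: "(\<lambda>n. c\<^sub>q * \<bar>?e n\<bar>) \<longlonglongrightarrow> 0" by simp
      show ?case
      proof (rule Lim_null_comparison[OF always_eventually lim], rule allI)
        fix n
        show "norm (?g n \<omega>) \<le> c\<^sub>q * \<bar>?e n\<bar>"
          using flow_step_error[OF elim s'(2) sh(1) h0, of n "Yc (s + h n) \<omega>"] h(1)[of n]
          by (simp add: abs_divide divide_right_mono)
      qed
    qed
  qed auto
  moreover have "(\<lambda>n. \<integral>\<omega>. J s (h n) \<omega> / h n \<partial>M) \<longlonglongrightarrow> (\<integral>\<omega>. 0 \<partial>M)"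
  proof (rule integral_dominated_convergence[where w = "\<lambda>_. c\<^sub>q * (c\<^sub>T + B)"])
    show "(\<lambda>\<omega>. J s (h n) \<omega> / h n) \<in> borel_measurable M" for n
      using J_measurable(1)[OF s'(2,3) h0] by (intro borel_measurable_divide) auto
    show "AE \<omega> in M. norm (J s (h n) \<omega> / h n) \<le> c\<^sub>q * (c\<^sub>T + B)" for n
      using D_field AE_space
    proof eventually_elim
      case (elim \<omega>)
      then show ?case
        using J_bound[OF elim(1) s'(2,3) h0 elim(2), of n] h(1)[of n]
        by (simp add: abs_divide pos_divide_le_eq)
    qed
    show "AE \<omega> in M. (\<lambda>n. J s (h n) \<omega> / h n) \<longlonglongrightarrow> 0"
      using D_field AE_space by eventually_elim (rule J_tendsto[OF _ s'(2,4) _ h(3,1)])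
  qed auto
  ultimately have "(\<lambda>n. (\<integral>\<omega>. ?g n \<omega> \<partial>M) + (\<integral>\<omega>. J s (h n) \<omega> / h n \<partial>M)) \<longlonglongrightarrow> 0 + 0"
    by (intro tendsto_add) simp_all
  then show "(\<lambda>n. (U (s + h n) - U s) / h n) \<longlonglongrightarrow> 0"
    unfolding U_increment[OF s'(2) sh(1) h0] by (simp add: add_divide_distrib)
qed

lemma continuous_U: "continuous_on {t..\<tau>} U"
\<comment> \<open>The absolute value provides a nonnegative Lipschitz constant, since no sign of
  \<open>c\<^sub>T\<close> is assumed.\<close>
proof (rule lipschitz_on_continuous_on[of "c\<^sub>q * \<bar>c\<^sub>T + 3 * B\<bar>"], rule lipschitz_onI)
  have *: "\<bar>U r - U s\<bar> \<le> c\<^sub>q * \<bar>c\<^sub>T + 3 * B\<bar> * (r - s)" if "t \<le> s" "s \<le> r" "r \<le> \<tau>" for r s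
  proof -
    have "c\<^sub>q * (c\<^sub>T + 3 * B) * (r - s) \<le> c\<^sub>q * \<bar>c\<^sub>T + 3 * B\<bar> * (r - s)"
      using that by (intro mult_right_mono mult_left_mono cq_nonneg) auto
    then show ?thesis using U_lipschitz[of s "r - s"] that by simp
  qed
  show "dist (U r) (U s) \<le> c\<^sub>q * \<bar>c\<^sub>T + 3 * B\<bar> * dist r s" if "r \<in> {t..\<tau>}" "s \<in> {t..\<tau>}" for r s
    using *[of r s] *[of s r] that by (cases "r \<le> s") (auto simp: dist_real_def abs_minus_commute)
qed (simp add: cq_nonneg)

lemma U_invariant: "U \<tau> = U t"
  using t by (intro right_derivative_zero_imp_eq continuous_U U_right_derivative) auto

end

theorem test_invariant:
  assumes t: "t \<in> {0..\<tau>}" and A: "A \<in> sets (F t)"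
    and psi: "\<And>y. 0 \<le> \<psi> y \<and> \<psi> y \<le> 1"
    and psi_lip: "\<And>y z. \<bar>\<psi> y - \<psi> z\<bar> \<le> c * \<bar>y - z\<bar>"
  shows "(\<integral>\<omega>. indicator A \<omega> * \<psi> (flow (D \<omega>) \<tau> t (Yc \<tau> \<omega>)) \<partial>M) = (\<integral>\<omega>. indicator A \<omega> * \<psi> (Yc t \<omega>) \<partial>M)"
proof -
  note defs = U_def[OF assms] q_def[OF assms]
  have "(\<integral>\<omega>. indicator A \<omega> * \<psi> (flow (D \<omega>) t t (Yc t \<omega>)) \<partial>M) = (\<integral>\<omega>. indicator A \<omega> * \<psi> (Yc t \<omega>) \<partial>M)"
  proof (rule integral_cong_AE)
    have Y: "Yc t \<in> borel_measurable M" using Yc_measurable[OF t order_refl] by simp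
    have [measurable]: "\<psi> \<in> borel_measurable borel" "A \<in> sets M"
      using psi_lip[of 1 0] psi_lip A subalg[OF t]
      by (auto intro!: borel_measurable_continuous_onI lipschitz_on_continuous_on[of c] lipschitz_onI
          simp: dist_real_def subalgebra_def)
    show "(\<lambda>\<omega>. indicator A \<omega> * \<psi> (Yc t \<omega>)) \<in> borel_measurable M" using Y by measurable
    show "(\<lambda>\<omega>. indicator A \<omega> * \<psi> (flow (D \<omega>) t t (Yc t \<omega>))) \<in> borel_measurable M"
      using flow_measurable_F[OF t Y] by measurable
    show "AE \<omega> in M. indicator A \<omega> * \<psi> (flow (D \<omega>) t t (Yc t \<omega>)) = indicator A \<omega> * \<psi> (Yc t \<omega>)"
      using D_field by eventually_elim (simp add: rc_field.flow_beyond)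
  qed
  then show ?thesis
    using U_invariant[OF assms] by (simp add: defs)
qed

end

section \<open>From test functions to conditional laws\<close>

context counterfactual_flow
begin

text \<open>Consistency enters here. The flow from \<open>\<tau>\<close> is a function of the final
  value and of the history up to \<open>\<tau>\<close>, so equal conditional laws at
  \<open>\<tau>\<close> allow \<open>Y\<close> to be replaced by \<open>Yc \<tau>\<close> under the
  test integral. Invariance then transfers the kernel of \<open>Yc t\<close>.\<close>

theorem law_invariant:
  assumes t: "t \<in> {0..\<tau>}"
    and law1: "cond_law M (F \<tau>) (Yc \<tau>) k1" and law2: "cond_law M (F \<tau>) Y k2"
    and eq: "AE \<omega> in M. k1 \<omega> = k2 \<omega>"
  shows "cond_law M (F t) (\<lambda>\<omega>. flow (D \<omega>) \<tau> t (Y \<omega>)) (k t 0)"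
proof -
  have tau: "\<tau> \<in> {0..\<tau>}" using t by simp
  have Y: "Y \<in> borel_measurable M" using law2 by (simp add: cond_law_def)
  have X: "(\<lambda>\<omega>. flow (D \<omega>) \<tau> t (Y \<omega>)) \<in> borel_measurable M"
    by (rule flow_measurable_F[OF tau Y])
  have Yt: "Yc t \<in> borel_measurable M" using Yc_measurable[OF t order_refl] by simp
  have "measure M (A \<inter> (\<lambda>\<omega>. flow (D \<omega>) \<tau> t (Y \<omega>)) -` B) = measure M (A \<inter> Yc t -` B)"
    if A: "A \<in> sets (F t)" and B: "B \<in> sets borel" for A and B :: "real set"
  proof (rule measure_eq_of_lipschitz_tests[OF prob_space_axioms X Yt _ _ B])
    show "A \<in> sets M" using A subalg[OF t] by (auto simp: subalgebra_def)
    fix \<psi> :: "real \<Rightarrow> real" and c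
    assume psi: "\<And>y. 0 \<le> \<psi> y \<and> \<psi> y \<le> 1" and lip: "\<And>y z. \<bar>\<psi> y - \<psi> z\<bar> \<le> c * \<bar>y - z\<bar>"
    note psi_lip = psi lip
    let ?q = "\<lambda>y \<omega>. indicator A \<omega> * \<psi> (flow (D \<omega>) \<tau> t y)"
    have "(\<lambda>p. q t A \<psi> \<tau> (fst p) (snd p)) \<in> borel_measurable (borel \<Otimes>\<^sub>M F \<tau>)"
      using q_measurable_pair[OF t A psi_lip, of \<tau> fst] t by simp
    then have qm: "(\<lambda>p. ?q (fst p) (snd p)) \<in> borel_measurable (borel \<Otimes>\<^sub>M F \<tau>)"
      by (simp add: q_def[OF t A psi_lip])
    have qb: "0 \<le> ?q y \<omega> \<and> ?q y \<omega> \<le> 1" for y \<omega>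
      using psi by (auto simp: indicator_def)
    note dis = disintegration[OF prob_space_axioms subalg[OF tau] _ qm qb]
    have "(\<integral>\<omega>. ?q (Y \<omega>) \<omega> \<partial>M) = (\<integral>\<omega>. (\<integral>y. ?q y \<omega> \<partial>k2 \<omega>) \<partial>M)"
      by (rule dis(2)[OF law2])
    also have "\<dots> = (\<integral>\<omega>. (\<integral>y. ?q y \<omega> \<partial>k1 \<omega>) \<partial>M)"
    proof (rule integral_cong_AE)
      show "(\<lambda>\<omega>. \<integral>y. ?q y \<omega> \<partial>k1 \<omega>) \<in> borel_measurable M"
        "(\<lambda>\<omega>. \<integral>y. ?q y \<omega> \<partial>k2 \<omega>) \<in> borel_measurable M"
        using dis(1)[OF law1] dis(1)[OF law2] measurable_from_subalg[OF subalg[OF tau]] by blast+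
      show "AE \<omega> in M. (\<integral>y. ?q y \<omega> \<partial>k2 \<omega>) = (\<integral>y. ?q y \<omega> \<partial>k1 \<omega>)"
        using eq by eventually_elim simp
    qed
    also have "\<dots> = (\<integral>\<omega>. ?q (Yc \<tau> \<omega>) \<omega> \<partial>M)"
      by (rule dis(2)[OF law1, symmetric])
    also have "\<dots> = (\<integral>\<omega>. indicator A \<omega> * \<psi> (Yc t \<omega>) \<partial>M)"
      by (rule test_invariant[OF t A psi lip])
    finally show "(\<integral>\<omega>. ?q (Y \<omega>) \<omega> \<partial>M) = (\<integral>\<omega>. indicator A \<omega> * \<psi> (Yc t \<omega>) \<partial>M)" .
  qed
  then show ?thesis
    using law[OF t order_refl] X unfolding cond_law_def by simp
qed

end

section \<open>The differential equation along one sample path\<close>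

text \<open>Clipping the time gives a field on the whole line, as \<open>rc_field\<close> requires.
  For \<open>0 \<le> t\<close> and \<open>v \<le> t\<close> the clipped \<open>v\<close> is still at
  most \<open>t\<close>, so adaptedness is kept.\<close>

definition path_field :: "real \<Rightarrow> (real \<Rightarrow> real \<Rightarrow> real measure) \<Rightarrow> real \<Rightarrow> real \<Rightarrow> real" where
  "path_field T \<mu> u y = D_shift (\<mu> (max 0 (min T u))) y"

locale shift_path =
  fixes \<tau> :: real and mu :: "real \<Rightarrow> real \<Rightarrow> real measure" and J :: "real set"
    and y1 y2 \<epsilon> C L1 L2 :: real and f :: "real \<Rightarrow> real \<Rightarrow> real \<Rightarrow> real"
  assumes tau: "0 \<le> \<tau>"
    and family: "t \<in> {0..\<tau>} \<Longrightarrow> shift_family (mu t) y1 y2 \<epsilon> C L1 L2 (f t)"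
    and finite_J: "finite J" and J_sub: "J \<subseteq> {0<..\<tau>}"
    and extendable: "0 \<le> t1 \<Longrightarrow> t1 < t2 \<Longrightarrow> t2 \<le> \<tau> \<Longrightarrow> {t1<..<t2} \<inter> J = {} \<Longrightarrow>
      continuous_extendable ({y1..y2} \<times> {t1..<t2}) ({y1..y2} \<times> {t1..t2}) (\<lambda>(y, t). dcdf_h (mu t) 0 y) \<and>
      continuous_extendable ({y1..y2} \<times> {t1..<t2}) ({y1..y2} \<times> {t1..t2}) (\<lambda>(y, t). dcdf_y y1 y2 (mu t) 0 y)"
begin

abbreviation clip :: "real \<Rightarrow> real" where "clip y \<equiv> max y1 (min y2 y)"

section \<open>Regularity of the field between jumps\<close>

lemma y1_less_y2: "y1 < y2"
  using shift_family.y1_less_y2[OF family[of 0]] tau by simp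

lemma eps: "0 < \<epsilon>"
  using shift_family.eps[OF family[of 0]] tau by simp

lemma path_field_eq: "u \<in> {0..\<tau>} \<Longrightarrow> path_field \<tau> mu u y = D_shift (mu u) y"
  by (simp add: path_field_def)

text \<open>The quotient of the extended partial derivatives extends the field to \<open>t2\<close>.
  The denominator stays away from zero because the lower bound \<open>\<epsilon>\<close> passes to
  the left limit; clamping covers states outside the support.\<close>

lemma gap_extension:
  assumes gap: "0 \<le> t1" "t1 < t2" "t2 \<le> \<tau>" "{t1<..<t2} \<inter> J = {}"
  shows "\<exists>G. continuous_on ({t1..t2} \<times> UNIV) (\<lambda>(u, y). G u y) \<and>
    (\<forall>u\<in>{t1..<t2}. \<forall>y. G u y = D_shift (mu u) y) \<and> (\<forall>u y. G u y = G u (clip y))"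
proof -
  obtain Gh Gy where Gh: "continuous_on ({y1..y2} \<times> {t1..t2}) Gh"
    "\<And>y t. y \<in> {y1..y2} \<Longrightarrow> t \<in> {t1..<t2} \<Longrightarrow> Gh (y, t) = dcdf_h (mu t) 0 y"
    and Gy: "continuous_on ({y1..y2} \<times> {t1..t2}) Gy"
    "\<And>y t. y \<in> {y1..y2} \<Longrightarrow> t \<in> {t1..<t2} \<Longrightarrow> Gy (y, t) = dcdf_y y1 y2 (mu t) 0 y"
    using extendable[OF gap] unfolding continuous_extendable_def by fastforce
  have t: "t \<in> {0..\<tau>}" if "t \<in> {t1..<t2}" for t using that gap by auto
  have ge: "\<epsilon> \<le> Gy (y, t)" if y: "y \<in> {y1..y2}" and "t \<in> {t1..<t2}" for y t
    using shift_family.dcdf_y_ge[OF family[OF t] y] that by (simp add: Gy(2))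
  have ge': "\<epsilon> \<le> Gy (y, t)" if y: "y \<in> {y1..y2}" and "t \<in> {t1..t2}" for y t
  proof (cases "t = t2")
    case True
    have "continuous_on {t1..t2} (\<lambda>t. Gy (y, t))"
      by (rule continuous_on_compose2[OF Gy(1)]) (use y in \<open>auto intro!: continuous_intros\<close>)
    then have "((\<lambda>t. Gy (y, t)) \<longlongrightarrow> Gy (y, t2)) (at t2 within {t1..t2})"
      using gap by (simp add: continuous_on_def)
    then have "((\<lambda>t. Gy (y, t)) \<longlongrightarrow> Gy (y, t2)) (at_left t2)"
      using gap by (simp add: at_within_Icc_at_left)
    moreover have "\<forall>\<^sub>F t in at_left t2. \<epsilon> \<le> Gy (y, t)"
      using eventually_at_left_real[OF gap(2)] by eventually_elim (auto intro: ge[OF y])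
    ultimately show ?thesis
      unfolding True by (rule tendsto_lowerbound) simp
  qed (use that ge in auto)
  define G where "G u y = - Gh (clip y, u) / Gy (clip y, u)" for u y
  have "continuous_on ({t1..t2} \<times> UNIV) (\<lambda>p. - Gh (clip (snd p), fst p) / Gy (clip (snd p), fst p))"
  proof (intro continuous_on_divide continuous_on_minus ballI)
    show "continuous_on ({t1..t2} \<times> UNIV) (\<lambda>p. Gh (clip (snd p), fst p))"
      by (rule continuous_on_compose2[OF Gh(1)])
        (use y1_less_y2 in \<open>auto intro!: continuous_intros\<close>)
    show "continuous_on ({t1..t2} \<times> UNIV) (\<lambda>p. Gy (clip (snd p), fst p))"
      by (rule continuous_on_compose2[OF Gy(1)])
        (use y1_less_y2 in \<open>auto intro!: continuous_intros\<close>)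
    fix p assume "p \<in> {t1..t2} \<times> (UNIV :: real set)"
    then have "\<epsilon> \<le> Gy (clip (snd p), fst p)"
      using y1_less_y2 by (intro ge') auto
    then show "Gy (clip (snd p), fst p) \<noteq> 0" using eps by linarith
  qed
  then have "continuous_on ({t1..t2} \<times> UNIV) (\<lambda>(u, y). G u y)"
    by (simp add: G_def case_prod_beta)
  moreover have "G u y = D_shift (mu u) y" if u: "u \<in> {t1..<t2}" for u y
  proof -
    interpret shift_family "mu u" y1 y2 \<epsilon> C L1 L2 "f u" by (rule family[OF t[OF u]])
    have c: "clip y \<in> {y1..y2}" using y1_less_y2 by auto
    show ?thesis
      unfolding G_def D_shift_clamp[of y] by (simp only: D_shift_eq c if_True Gh(2)[OF c u] Gy(2)[OF c u])
  qed
  moreover have "G u y = G u (clip y)" for u y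
    unfolding G_def using y1_less_y2 by (simp add: max_def min_def)
  ultimately show ?thesis by blast
qed

lemma next_gap:
  assumes "0 \<le> u" "u < \<tau>"
  obtains t2 where "u < t2" "t2 \<le> \<tau>" "{u<..<t2} \<inter> J = {}"
proof -
  define t2 where "t2 = Min (insert \<tau> {j \<in> J. u < j})"
  have fin: "finite (insert \<tau> {j \<in> J. u < j})" using finite_J by simp
  have "u < t2" unfolding t2_def using fin assms by (subst Min_gr_iff) auto
  moreover have "t2 \<le> \<tau>" unfolding t2_def using fin by (intro Min_le) auto
  moreover have "{u<..<t2} \<inter> J = {}"
  proof -
    have "t2 \<le> j" if "j \<in> J" "u < j" for j
      unfolding t2_def using fin that by (intro Min_le) auto
    then show ?thesis by fastforce
  qed
  ultimately show ?thesis using that by blast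
qed

text \<open>Clipping makes the field constant to the right of any time outside
  \<open>[0, \<tau>)\<close>. Within a gap the extension is uniformly continuous on a compact box,
  and clamping carries the uniformity from the support to all states.\<close>

lemma path_field_right_continuous:
  assumes "0 < e"
  shows "\<forall>\<^sub>F v in at_right u. \<forall>y. \<bar>path_field \<tau> mu v y - path_field \<tau> mu u y\<bar> \<le> e"
proof -
  consider "u < 0" | "\<tau> \<le> u" | "0 \<le> u" "u < \<tau>" by linarith
  then show ?thesis
  proof cases
    case 1
    have eq: "path_field \<tau> mu v = path_field \<tau> mu u" if "v < 0" for v
      using that 1 tau by (simp add: path_field_def fun_eq_iff max_def min_def)
    show ?thesis
    proof (rule eventually_mono[OF eventually_at_right_real[OF 1]])
      show "\<forall>y. \<bar>path_field \<tau> mu v y - path_field \<tau> mu u y\<bar> \<le> e" if "v \<in> {u<..<0}" for v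
        using assms that by (simp add: eq[of v])
    qed
  next
    case 2
    have eq: "path_field \<tau> mu v = path_field \<tau> mu u" if "u < v" for v
      using that 2 by (simp add: path_field_def fun_eq_iff min_absorb1)
    show ?thesis
    proof (rule eventually_mono[OF eventually_at_right_less[of u]])
      show "\<forall>y. \<bar>path_field \<tau> mu v y - path_field \<tau> mu u y\<bar> \<le> e" if "u < v" for v
        using assms that by (simp add: eq[of v])
    qed
  next
    case 3
    then obtain t2 where t2: "u < t2" "t2 \<le> \<tau>" "{u<..<t2} \<inter> J = {}" by (rule next_gap)
    obtain G where G: "continuous_on ({u..t2} \<times> UNIV) (\<lambda>(u, y). G u y)"
      "\<And>v y. v \<in> {u..<t2} \<Longrightarrow> G v y = D_shift (mu v) y" and G_clip: "\<And>v y. G v y = G v (clip y)"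
      using gap_extension[OF 3(1) t2] by metis
    have "uniformly_continuous_on ({u..t2} \<times> {y1..y2}) (\<lambda>(u, y). G u y)"
      by (rule compact_uniformly_continuous[OF continuous_on_subset[OF G(1)]])
        (auto intro: compact_Times)
    then obtain d where d: "0 < d" and
      D: "\<And>p p'. p \<in> {u..t2} \<times> {y1..y2} \<Longrightarrow> p' \<in> {u..t2} \<times> {y1..y2} \<Longrightarrow> dist p' p < d \<Longrightarrow>
        dist (case p' of (u, y) \<Rightarrow> G u y) (case p of (u, y) \<Rightarrow> G u y) < e"
      using assms unfolding uniformly_continuous_on_def by meson
    have "\<bar>path_field \<tau> mu v y - path_field \<tau> mu u y\<bar> \<le> e" if v: "v \<in> {u<..<min t2 (u + d)}" for v y
    proof -
      have c: "clip y \<in> {y1..y2}" using y1_less_y2 by auto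
      have "dist (G v (clip y)) (G u (clip y)) < e"
        using D[of "(u, clip y)" "(v, clip y)"] v c t2(1) by (simp add: dist_Pair_Pair dist_real_def)
      then have "\<bar>G v y - G u y\<bar> < e"
        unfolding G_clip[of v y] G_clip[of u y] dist_real_def .
      then show ?thesis
        using v t2 3 G(2)[of v y] G(2)[of u y] by (simp add: path_field_eq)
    qed
    moreover have "u < min t2 (u + d)" using t2 d by simp
    ultimately show ?thesis
      by (intro eventually_mono[OF eventually_at_right_real[of u "min t2 (u + d)"]]) blast+
  qed
qed

text \<open>The added 1 makes the Lipschitz constant strictly positive, as dividing by it in the
  weighted estimates requires.\<close>

lemma lipschitz_path_field:
  "\<bar>path_field \<tau> mu u y - path_field \<tau> mu u z\<bar> \<le> (L2 / \<epsilon> + C * L1 / \<epsilon>\<^sup>2 + 1) * \<bar>y - z\<bar>"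
proof -
  have "max 0 (min \<tau> u) \<in> {0..\<tau>}" using tau by auto
  then interpret shift_family "mu (max 0 (min \<tau> u))" y1 y2 \<epsilon> C L1 L2 "f (max 0 (min \<tau> u))"
    by (rule family)
  have "\<bar>path_field \<tau> mu u y - path_field \<tau> mu u z\<bar> \<le> (L2 / \<epsilon> + C * L1 / \<epsilon>\<^sup>2) * \<bar>y - z\<bar>"
    unfolding path_field_def by (rule D_shift_lipschitz)
  then show ?thesis by (simp add: algebra_simps)
qed

sublocale rc_field "path_field \<tau> mu" "C / \<epsilon>" "L2 / \<epsilon> + C * L1 / \<epsilon>\<^sup>2 + 1"
proof
  have "max 0 (min \<tau> u) \<in> {0..\<tau>}" for u using tau by auto
  then show "\<bar>path_field \<tau> mu u y\<bar> \<le> C / \<epsilon>" for u y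
    unfolding path_field_def by (rule shift_family.D_shift_bound[OF family])
  show "0 < L2 / \<epsilon> + C * L1 / \<epsilon>\<^sup>2 + 1"
    using shift_family.lipschitz_constant_nonneg[OF family[of 0]] tau by simp
  show "\<forall>\<^sub>F v in at_right u. \<forall>y. \<bar>path_field \<tau> mu v y - path_field \<tau> mu u y\<bar> \<le> e" if "0 < e" for e u
    by (rule path_field_right_continuous[OF that])
qed (rule lipschitz_path_field)

section \<open>Existence and uniqueness of continuous solutions\<close>

lemma continuous_solution_flow:
  "continuous_solution \<tau> J mu y (\<lambda>t. flow (path_field \<tau> mu) \<tau> t y)"
  unfolding continuous_solution_def
proof (intro conjI ballI impI)
  let ?x = "\<lambda>t. flow (path_field \<tau> mu) \<tau> t y"
  show "continuous_on {0..\<tau>} ?x" by (rule continuous_flow_Icc) simp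
  show "?x \<tau> = y" by (rule flow_beyond) simp
  fix t1 t2 assume "t1 \<in> insert 0 (insert \<tau> J)" "t2 \<in> insert 0 (insert \<tau> J)"
    and gap: "t1 < t2" "{t1<..<t2} \<inter> J = {}"
  then have t: "0 \<le> t1" "t2 \<le> \<tau>" using J_sub tau by auto
  obtain G where G: "continuous_on ({t1..t2} \<times> UNIV) (\<lambda>(u, y). G u y)"
      "\<And>v y. v \<in> {t1..<t2} \<Longrightarrow> G v y = D_shift (mu v) y"
    using gap_extension[OF t(1) gap(1) t(2) gap(2)] by metis
  have der: "(?x has_real_derivative G u (?x u)) (at u within {t1..t2})" if "u \<in> {t1..t2}" for u
    by (rule flow_derivative[OF gap(1) t(2) G(1) _ that]) (use G(2) t in \<open>simp add: path_field_eq\<close>)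
  show "(?x has_real_derivative D_shift (mu u) (?x u)) (at u within {t1..t2})" if "u \<in> {t1..<t2}" for u
    using der[of u] G(2)[OF that] that by simp
  \<comment> \<open>The witness is \<open>G t2 (?x t2)\<close>: it is the left limit of the field at
    the fixed state \<open>?x t2\<close> and also the one-sided derivative of the flow.\<close>
  show "\<exists>d. ((\<lambda>t. D_shift (mu t) (?x t2)) \<longlongrightarrow> d) (at_left t2) \<and>
      (?x has_real_derivative d) (at t2 within {t1..t2})"
  proof (intro exI conjI)
    show "(?x has_real_derivative G t2 (?x t2)) (at t2 within {t1..t2})"
      using der[of t2] gap by simp
    have "continuous_on {t1..t2} (\<lambda>u. (\<lambda>(u, y). G u y) (u, ?x t2))"
      by (rule continuous_on_compose2[OF G(1)]) (auto intro!: continuous_intros)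
    then have "((\<lambda>u. G u (?x t2)) \<longlongrightarrow> G t2 (?x t2)) (at t2 within {t1..t2})"
      using gap by (simp add: continuous_on_def)
    then have lim: "((\<lambda>u. G u (?x t2)) \<longlongrightarrow> G t2 (?x t2)) (at_left t2)"
      using gap by (simp add: at_within_Icc_at_left)
    have "\<forall>\<^sub>F u in at_left t2. G u (?x t2) = D_shift (mu u) (?x t2)"
      using eventually_at_left_real[OF gap(1)] by eventually_elim (auto intro: G(2))
    from tendsto_cong[OF this] lim
    show "((\<lambda>t. D_shift (mu t) (?x t2)) \<longlongrightarrow> G t2 (?x t2)) (at_left t2)" by simp
  qed
qed

lemma continuous_solution_unique:
  assumes sol: "continuous_solution \<tau> J mu y x" and t: "t \<in> {0..\<tau>}"
  shows "x t = flow (path_field \<tau> mu) \<tau> t y"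
proof -
  have cont: "continuous_on {0..\<tau>} x" and final: "x \<tau> = y"
    using sol by (auto simp: continuous_solution_def)
  have "(x has_real_derivative path_field \<tau> mu u (x u)) (at u)" if u: "u \<in> {0<..<\<tau>} - J" for u
  proof -
    let ?P = "insert 0 (insert \<tau> J)"
    \<comment> \<open>The partition points next to \<open>u\<close>; as \<open>u\<close> is interior
      to the gap between them, the derivative within that gap is a two-sided one.\<close>
    define t1 where "t1 = Max {p \<in> ?P. p < u}"
    define t2 where "t2 = Min {p \<in> ?P. u < p}"
    have fin: "finite {p \<in> ?P. p < u}" "finite {p \<in> ?P. u < p}" using finite_J by auto
    have "t1 \<in> {p \<in> ?P. p < u}" unfolding t1_def using u by (intro Max_in fin(1)) auto
    moreover have "t2 \<in> {p \<in> ?P. u < p}" unfolding t2_def using u by (intro Min_in fin(2)) auto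
    moreover have "{t1<..<t2} \<inter> J = {}"
    proof -
      have "p \<le> t1 \<or> t2 \<le> p" if "p \<in> J" for p
      proof (cases "p < u")
        case True
        then show ?thesis unfolding t1_def using that by (intro disjI1 Max_ge fin(1)) auto
      next
        case False
        with that u have "u < p" by (cases "p = u") auto
        then show ?thesis unfolding t2_def using that by (intro disjI2 Min_le fin(2)) auto
      qed
      then show ?thesis by fastforce
    qed
    ultimately have "(x has_real_derivative D_shift (mu u) (x u)) (at u within {t1..t2})"
      and "t1 < u" "u < t2"
      using sol unfolding continuous_solution_def by fastforce+
    then show ?thesis
      using u by (simp add: at_within_Icc_at path_field_eq)
  qed
  from flow_unique[OF cont finite_J this t] show ?thesis by (simp add: final)
qed

end

section \<open>Histories and adaptedness\<close>

text \<open>Coordinates of the earlier history are coordinates of the later one. Both the filtration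
  property and the adaptedness of the field rest on this.\<close>

lemma measurable_history_vimage_algebra:
  assumes r: "0 \<le> r" "r \<le> t"
    and Vt: "history Z t \<in> M \<rightarrow>\<^sub>M cadlag_space t" and Vr: "history Z r \<in> M \<rightarrow>\<^sub>M cadlag_space r"
  shows "history Z r \<in> vimage_algebra (space M) (history Z t) (cadlag_space t) \<rightarrow>\<^sub>M cadlag_space r"
proof -
  let ?F = "vimage_algebra (space M) (history Z t) (cadlag_space t)"
  have coord: "Z s \<in> borel_measurable ?F" if s: "s \<in> {0..r}" for s
  proof -
    have "(\<lambda>z. z s) \<in> cadlag_space t \<rightarrow>\<^sub>M borel"
      unfolding cadlag_space_def
      by (rule measurable_restrict_space1[OF measurable_component_singleton]) (use s r in auto)
    from measurable_compose[OF measurable_vimage_algebra_self[OF Vt] this]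
    have "(\<lambda>\<omega>. history Z t \<omega> s) \<in> borel_measurable ?F" .
    then show ?thesis using s r by (simp add: history_def)
  qed
  have "(\<lambda>\<omega>. restrict (\<lambda>s. Z s \<omega>) {0..r}) \<in> ?F \<rightarrow>\<^sub>M PiM {0..r} (\<lambda>_. borel)"
    by (rule measurable_restrict) (rule coord)
  then have 1: "history Z r \<in> ?F \<rightarrow>\<^sub>M PiM {0..r} (\<lambda>_. borel)"
    by (simp add: history_def[abs_def])
  have "history Z r \<in> space ?F \<rightarrow> {z. cadlag_on 0 r z}"
    using measurable_space[OF Vr] by (auto simp: cadlag_space_def space_restrict_space)
  then show ?thesis
    unfolding cadlag_space_def[of r] by (rule measurable_restrict_space2[OF _ 1])
qed

lemma borel_measurable_cdf_kernel:
  assumes V: "V \<in> F \<rightarrow>\<^sub>M N" and k: "k \<in> N \<rightarrow>\<^sub>M prob_algebra borel"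
  shows "(\<lambda>\<omega>. cdf (k (V \<omega>)) y) \<in> borel_measurable F"
proof -
  have "(\<lambda>\<omega>. measure (k (V \<omega>)) {..y}) \<in> borel_measurable F"
    by (rule measurable_compose[OF V measurable_compose[OF measurable_prob_algebraD[OF k]
          measurable_measure_subprob_algebra]]) simp
  then show ?thesis by (simp add: cdf_def)
qed

text \<open>One process \<open>X\<close> serves all claims, with consistency as a premise of the
  last one only. The equation is stated on paths with finitely many jumps, almost all of them, since
  otherwise the intervals between successive jumps need not exhaust the time interval.\<close>

theorem theorem7p5:
  fixes M :: "'a measure" and \<tau> y1 y2 :: real
    and Z :: "real \<Rightarrow> 'a \<Rightarrow> real ^ 'm"
    and Y :: "'a \<Rightarrow> real"
    and Yc :: "real \<Rightarrow> 'a \<Rightarrow> real"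
    and K :: "real \<Rightarrow> real \<Rightarrow> (real \<Rightarrow> real ^ 'm) \<Rightarrow> real measure"
    and f :: "real \<Rightarrow> real \<Rightarrow> (real \<Rightarrow> real ^ 'm) \<Rightarrow> real \<Rightarrow> real"
    and law :: "'a \<Rightarrow> real \<Rightarrow> real \<Rightarrow> real measure"
    and jumps :: "'a \<Rightarrow> real set"
  defines "law \<equiv> \<lambda>\<omega> t h. K t h (history Z t \<omega>)"
    and "jumps \<equiv> \<lambda>\<omega>. jump_times \<tau> (\<lambda>t. Z t \<omega>)"
  assumes prob: "prob_space M" and tau: "0 \<le> \<tau>"
    and Z_rv: "\<And>t. t \<in> {0..\<tau>} \<Longrightarrow> Z t \<in> borel_measurable M"
    and Z_cadlag: "\<And>\<omega>. \<omega> \<in> space M \<Longrightarrow> cadlag_on 0 \<tau> (\<lambda>t. Z t \<omega>)"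
    and Z_finite_jumps: "AE \<omega> in M. finite (jumps \<omega>)"
    and Z_fixed_jumps: "finite {t \<in> {0..\<tau>}. \<not> (AE \<omega> in M. t \<notin> jumps \<omega>)}"
    and Y_rv: "Y \<in> borel_measurable M"
    and Yc_rv: "\<And>s. 0 \<le> s \<Longrightarrow> Yc s \<in> borel_measurable M"
    and Y_support: "bounded (support_of (distr M borel Y))"
      "y1 = Inf (support_of (distr M borel Y))" "y2 = Sup (support_of (distr M borel Y))"
    and versions: "\<And>t h. t \<in> {0..\<tau>} \<Longrightarrow> 0 \<le> h \<Longrightarrow>
      is_cond_distr M (cadlag_space t) (history Z t) (Yc (t + h)) (K t h)"
    and support_a: "\<And>\<omega> t h. \<omega> \<in> space M \<Longrightarrow> t \<in> {0..\<tau>} \<Longrightarrow> 0 \<le> h \<Longrightarrow>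
      support_of (law \<omega> t h) = {y1..y2}"
    and support_b: "\<And>\<omega> t h. \<omega> \<in> space M \<Longrightarrow> t \<in> {0..\<tau>} \<Longrightarrow> 0 \<le> h \<Longrightarrow>
      continuous_on {y1..y2} (f t h (history Z t \<omega>)) \<and>
      (\<forall>y\<in>{y1..y2}. 0 < f t h (history Z t \<omega>) y) \<and>
      law \<omega> t h =
        density lborel (\<lambda>y. ennreal (indicator {y1..y2} y * f t h (history Z t \<omega>) y))"
    and support_c: "\<exists>\<epsilon>>0. \<forall>\<omega>\<in>space M. \<forall>t\<in>{0..\<tau>}. \<forall>y\<in>{y1..y2}.
      \<epsilon> \<le> f t 0 (history Z t \<omega>) y"
    and derivatives_a: "\<And>\<omega> t. \<omega> \<in> space M \<Longrightarrow> t \<in> {0..\<tau>} \<Longrightarrow> cdf_C1 y1 y2 (law \<omega> t)"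
    and derivatives_b: "\<And>\<omega> t1 t2. \<omega> \<in> space M \<Longrightarrow> 0 \<le> t1 \<Longrightarrow> t1 < t2 \<Longrightarrow> t2 \<le> \<tau> \<Longrightarrow>
      {t1<..<t2} \<inter> jumps \<omega> = {} \<Longrightarrow>
      continuous_extendable ({y1..y2} \<times> {t1..<t2}) ({y1..y2} \<times> {t1..t2})
        (\<lambda>(y, t). dcdf_h (law \<omega> t) 0 y) \<and>
      continuous_extendable ({y1..y2} \<times> {t1..<t2}) ({y1..y2} \<times> {t1..t2})
        (\<lambda>(y, t). dcdf_y y1 y2 (law \<omega> t) 0 y)"
    and bounded_derivatives:
      "\<exists>C1 C2. \<forall>\<omega>\<in>space M. \<forall>t\<in>{0..\<tau>}. \<forall>h\<ge>0. \<forall>y\<in>{y1..y2}.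
        dcdf_y y1 y2 (law \<omega> t) h y \<le> C1 \<and> \<bar>dcdf_h (law \<omega> t) h y\<bar> \<le> C2"
    and lipschitz:
      "\<exists>L1 L2. \<forall>\<omega>\<in>space M. \<forall>t\<in>{0..\<tau>}. \<forall>y\<in>{y1..y2}. \<forall>z\<in>{y1..y2}.
        \<bar>dcdf_y y1 y2 (law \<omega> t) 0 y - dcdf_y y1 y2 (law \<omega> t) 0 z\<bar> \<le> L1 * \<bar>y - z\<bar> \<and>
        \<bar>dcdf_h (law \<omega> t) 0 y - dcdf_h (law \<omega> t) 0 z\<bar> \<le> L2 * \<bar>y - z\<bar>"
  shows "(\<forall>\<omega>\<in>space M. \<forall>t\<in>{0..\<tau>}. \<forall>y.
            quantile_shift (law \<omega> t) y differentiable (at 0 within {0..})) \<and>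
         (\<exists>X. (\<forall>\<omega>\<in>space M. finite (jumps \<omega>) \<longrightarrow>
                 continuous_solution \<tau> (jumps \<omega>) (law \<omega>) (Y \<omega>) (\<lambda>t. X t \<omega>) \<and>
                 (\<forall>x. continuous_solution \<tau> (jumps \<omega>) (law \<omega>) (Y \<omega>) x \<longrightarrow>
                    (\<forall>t\<in>{0..\<tau>}. x t = X t \<omega>))) \<and>
              (same_cond_distr M (cadlag_space \<tau>) (history Z \<tau>) (Yc \<tau>) Y \<longrightarrow>
                 (\<forall>t\<in>{0..\<tau>}.
                    same_cond_distr M (cadlag_space t) (history Z t) (X t) (Yc t))))"
proof -
  interpret prob_space M by (rule prob)
  define F where "F t = vimage_algebra (space M) (history Z t) (cadlag_space t)" for t
  define D where "D \<omega> = path_field \<tau> (law \<omega>)" for \<omega>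
  obtain \<epsilon> where eps: "0 < \<epsilon>"
    "\<And>\<omega> t y. \<omega> \<in> space M \<Longrightarrow> t \<in> {0..\<tau>} \<Longrightarrow> y \<in> {y1..y2} \<Longrightarrow> \<epsilon> \<le> f t 0 (history Z t \<omega>) y"
    using support_c by blast
  obtain C where C: "\<And>\<omega> t h y. \<omega> \<in> space M \<Longrightarrow> t \<in> {0..\<tau>} \<Longrightarrow> 0 \<le> h \<Longrightarrow> y \<in> {y1..y2} \<Longrightarrow>
      \<bar>dcdf_h (law \<omega> t) h y\<bar> \<le> C"
    using bounded_derivatives by blast
  obtain L1 L2 where L: "\<And>\<omega> t y z. \<omega> \<in> space M \<Longrightarrow> t \<in> {0..\<tau>} \<Longrightarrow> y \<in> {y1..y2} \<Longrightarrow> z \<in> {y1..y2} \<Longrightarrow>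
      \<bar>dcdf_y y1 y2 (law \<omega> t) 0 y - dcdf_y y1 y2 (law \<omega> t) 0 z\<bar> \<le> L1 * \<bar>y - z\<bar> \<and>
      \<bar>dcdf_h (law \<omega> t) 0 y - dcdf_h (law \<omega> t) 0 z\<bar> \<le> L2 * \<bar>y - z\<bar>"
    using lipschitz by blast
  have V: "history Z t \<in> M \<rightarrow>\<^sub>M cadlag_space t" if "t \<in> {0..\<tau>}" for t
    using versions[OF that order_refl] by (simp add: is_cond_distr_def)
  have K: "K t h \<in> cadlag_space t \<rightarrow>\<^sub>M prob_algebra borel" if "t \<in> {0..\<tau>}" "0 \<le> h" for t h
    using versions[OF that] by (simp add: is_cond_distr_def)
  have family: "shift_family (law \<omega> t) y1 y2 \<epsilon> C L1 L2 (\<lambda>h. f t h (history Z t \<omega>))"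
    if w: "\<omega> \<in> space M" and t: "t \<in> {0..\<tau>}" for \<omega> t
  proof (rule shift_family.intro)
    fix h :: real assume h: "0 \<le> h"
    have "law \<omega> t h \<in> space (prob_algebra borel)"
      unfolding law_def by (rule measurable_space[OF K[OF t h] measurable_space[OF V[OF t] w]])
    then show "real_distribution (law \<omega> t h)"
      by (auto simp: space_prob_algebra real_distribution_def real_distribution_axioms_def)
    show "support_of (law \<omega> t h) = {y1..y2}" by (rule support_a[OF w t h])
    show "law \<omega> t h = density lborel (\<lambda>y. ennreal (indicator {y1..y2} y * f t h (history Z t \<omega>) y))"
      "continuous_on {y1..y2} (f t h (history Z t \<omega>))"
      using support_b[OF w t h] by blast+
  qed (use eps C[OF w t] L[OF w t] derivatives_a[OF w t] w t in auto)
  have path: "shift_path \<tau> (law \<omega>) (jumps \<omega>) y1 y2 \<epsilon> C L1 L2 (\<lambda>t h. f t h (history Z t \<omega>))"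
    if w: "\<omega> \<in> space M" and "finite (jumps \<omega>)" for \<omega>
  proof (rule shift_path.intro)
    show "jumps \<omega> \<subseteq> {0<..\<tau>}" by (auto simp: jumps_def jump_times_def)
  qed (use tau family[OF w] that(2) derivatives_b[OF w] in blast)+
  have F_le: "history Z r \<in> F t \<rightarrow>\<^sub>M cadlag_space r" if "0 \<le> r" "r \<le> t" "t \<le> \<tau>" for r t
    unfolding F_def by (rule measurable_history_vimage_algebra) (use that V in auto)
  have flow: "counterfactual_flow M F D \<tau> (C / \<epsilon>) (L2 / \<epsilon> + C * L1 / \<epsilon>\<^sup>2 + 1) (C / \<epsilon>) Yc
      (\<lambda>t h \<omega>. law \<omega> t h) (\<lambda>t h \<omega> y. quantile_shift (law \<omega> t) y h)"
  proof (rule counterfactual_flow.intro[OF prob counterfactual_flow_axioms.intro])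
    fix t assume t: "t \<in> {0..\<tau>}"
    show "subalgebra M (F t)" unfolding F_def by (rule subalgebra_vimage_algebra[OF V[OF t]])
    show "(\<lambda>\<omega>. D \<omega> v y) \<in> borel_measurable (F t)" if "v \<le> t" for v y
    proof -
      define u where "u = max 0 (min \<tau> v)"
      have u: "u \<in> {0..\<tau>}" "u \<le> t" using t that by (auto simp: u_def)
      have cdf_m: "(\<lambda>\<omega>. cdf (law \<omega> u h) y) \<in> borel_measurable (F t)" if "0 \<le> h" for h y
        unfolding law_def
        by (rule borel_measurable_cdf_kernel[OF F_le K[OF u(1) that]]) (use u t in auto)
      \<comment> \<open>The right-hand side of \<open>D_shift_lim\<close> at the clipped time
        \<open>u \<le> t\<close>: countably many distribution function values, each measurable in
        the history up to \<open>t\<close>.\<close>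
      have "(\<lambda>\<omega>. if y1 \<le> y \<and> y < y2 then
          - lim (\<lambda>n. (cdf (law \<omega> u (1 / real (Suc n))) y - cdf (law \<omega> u 0) y) * real (Suc n)) /
            lim (\<lambda>n. (cdf (law \<omega> u 0) (y + 1 / real (Suc n)) - cdf (law \<omega> u 0) y) * real (Suc n)) else 0)
          \<in> borel_measurable (F t)"
        by (cases "y1 \<le> y \<and> y < y2")
          (auto intro!: borel_measurable_divide borel_measurable_uminus borel_measurable_lim_metric
            borel_measurable_times borel_measurable_diff cdf_m simp del: of_nat_Suc)
      then show ?thesis
      proof (rule measurable_cong[THEN iffD1, rotated])
        fix \<omega> assume "\<omega> \<in> space (F t)"
        then have "\<omega> \<in> space M" by (simp add: F_def)
        from shift_family.D_shift_lim[OF family[OF this u(1)], of y]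
        show "(if y1 \<le> y \<and> y < y2 then
          - lim (\<lambda>n. (cdf (law \<omega> u (1 / real (Suc n))) y - cdf (law \<omega> u 0) y) * real (Suc n)) /
            lim (\<lambda>n. (cdf (law \<omega> u 0) (y + 1 / real (Suc n)) - cdf (law \<omega> u 0) y) * real (Suc n)) else 0)
          = D \<omega> v y"
          unfolding D_def path_field_def u_def[symmetric] by (rule sym)
      qed
    qed
    fix h :: real assume h: "0 \<le> h"
    show "cond_law M (F t) (Yc (t + h)) (\<lambda>\<omega>. law \<omega> t h)"
      using versions[OF t h] unfolding F_def law_def is_cond_distr_iff_cond_law[OF prob] by blast
    fix \<omega> assume w: "\<omega> \<in> space M"
    interpret shift_family "law \<omega> t" y1 y2 \<epsilon> C L1 L2 "\<lambda>h. f t h (history Z t \<omega>)"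
      by (rule family[OF w t])
    show "(\<lambda>y. quantile_shift (law \<omega> t) y h) \<in> borel_measurable borel" by (rule T_measurable[OF h])
    show "distr (law \<omega> t 0) borel (\<lambda>y. quantile_shift (law \<omega> t) y h) = law \<omega> t h" by (rule distr_T[OF h])
    show "AE y in law \<omega> t 0. \<bar>quantile_shift (law \<omega> t) y h - y\<bar> \<le> C / \<epsilon> * h"
      using AE_Icc by eventually_elim (rule T_lipschitz_h[OF h])
  next
    fix t \<omega> assume t: "t \<in> {0..\<tau>}" and w: "\<omega> \<in> space M"
    interpret shift_family "law \<omega> t" y1 y2 \<epsilon> C L1 L2 "\<lambda>h. f t h (history Z t \<omega>)"
      by (rule family[OF w t])
    show "AE y in law \<omega> t 0. ((\<lambda>h. (quantile_shift (law \<omega> t) y h - y) / h) \<longlongrightarrow> D \<omega> t y) (at_right 0)"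
      using AE_Icc
    proof eventually_elim
      case (elim y)
      have "D \<omega> t y = - dcdf_h (law \<omega> t) 0 y / dcdf_y y1 y2 (law \<omega> t) 0 y"
        using t elim by (simp add: D_def path_field_def D_shift_eq)
      then show ?case using T_derivative[OF elim] by simp
    qed
  next
    fix r t assume "0 \<le> r" "r \<le> t" "t \<le> \<tau>"
    from sets_image_in_sets[OF _ F_le[OF this], of "space M"]
    show "sets (F r) \<subseteq> sets (F t)" by (simp add: F_def)
  next
    fix \<omega> v assume w: "\<omega> \<in> space M"
    have u: "max 0 (min \<tau> v) \<in> {0..\<tau>}" using tau by auto
    interpret shift_family "law \<omega> (max 0 (min \<tau> v))" y1 y2 \<epsilon> C L1 L2
      "\<lambda>h. f (max 0 (min \<tau> v)) h (history Z (max 0 (min \<tau> v)) \<omega>)"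
      by (rule family[OF w u])
    show "continuous_on UNIV (D \<omega> v)"
      unfolding D_def path_field_def
      by (rule lipschitz_on_continuous_on, rule lipschitz_onI)
        (use D_shift_lipschitz lipschitz_constant_nonneg in \<open>auto simp: dist_real_def\<close>)
  next
    \<comment> \<open>Right-continuity uses a gap after each time, hence finitely many jumps; so it
      is available only almost surely.\<close>
    show "AE \<omega> in M. rc_field (D \<omega>) (C / \<epsilon>) (L2 / \<epsilon> + C * L1 / \<epsilon>\<^sup>2 + 1)"
      using Z_finite_jumps AE_space
    proof eventually_elim
      case (elim \<omega>)
      interpret shift_path \<tau> "law \<omega>" "jumps \<omega>" y1 y2 \<epsilon> C L1 L2 "\<lambda>t h. f t h (history Z t \<omega>)"
        by (rule path[OF elim(2,1)])
      show ?case unfolding D_def by (rule rc_field_axioms)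
    qed
  qed
  interpret flow: counterfactual_flow M F D \<tau> "C / \<epsilon>" "L2 / \<epsilon> + C * L1 / \<epsilon>\<^sup>2 + 1" "C / \<epsilon>" Yc
    "\<lambda>t h \<omega>. law \<omega> t h" "\<lambda>t h \<omega> y. quantile_shift (law \<omega> t) y h"
    by (rule flow)
  define X where "X t \<omega> = flow (D \<omega>) \<tau> t (Y \<omega>)" for t \<omega>
  have "same_cond_distr M (cadlag_space t) (history Z t) (X t) (Yc t)"
    if same: "same_cond_distr M (cadlag_space \<tau>) (history Z \<tau>) (Yc \<tau>) Y" and t: "t \<in> {0..\<tau>}" for t
  proof -
    obtain \<kappa> \<kappa>' where k: "is_cond_distr M (cadlag_space \<tau>) (history Z \<tau>) (Yc \<tau>) \<kappa>"
      "is_cond_distr M (cadlag_space \<tau>) (history Z \<tau>) Y \<kappa>'"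
      "AE \<omega> in M. \<kappa> (history Z \<tau> \<omega>) = \<kappa>' (history Z \<tau> \<omega>)"
      using same unfolding same_cond_distr_def by blast
    have "cond_law M (F \<tau>) (Yc \<tau>) (\<lambda>\<omega>. \<kappa> (history Z \<tau> \<omega>))" "cond_law M (F \<tau>) Y (\<lambda>\<omega>. \<kappa>' (history Z \<tau> \<omega>))"
      using k(1,2) unfolding F_def is_cond_distr_iff_cond_law[OF prob] by blast+
    from flow.law_invariant[OF t this k(3)]
    have "cond_law M (F t) (X t) (\<lambda>\<omega>. K t 0 (history Z t \<omega>))"
      unfolding X_def law_def by simp
    \<comment> \<open>The one kernel \<open>K t 0\<close> is a version for both \<open>X t\<close>
      and \<open>Yc t\<close>, so the required almost sure equality is reflexivity.\<close>
    then have "is_cond_distr M (cadlag_space t) (history Z t) (X t) (K t 0)"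
      unfolding is_cond_distr_iff_cond_law[OF prob] F_def using V[OF t] K[OF t order_refl] by blast
    moreover have "is_cond_distr M (cadlag_space t) (history Z t) (Yc t) (K t 0)"
      using versions[OF t order_refl] by simp
    ultimately show ?thesis unfolding same_cond_distr_def by blast
  qed
  moreover have "continuous_solution \<tau> (jumps \<omega>) (law \<omega>) (Y \<omega>) (\<lambda>t. X t \<omega>) \<and>
      (\<forall>x. continuous_solution \<tau> (jumps \<omega>) (law \<omega>) (Y \<omega>) x \<longrightarrow> (\<forall>t\<in>{0..\<tau>}. x t = X t \<omega>))"
    if "\<omega> \<in> space M" "finite (jumps \<omega>)" for \<omega>
  proof -
    interpret shift_path \<tau> "law \<omega>" "jumps \<omega>" y1 y2 \<epsilon> C L1 L2 "\<lambda>t h. f t h (history Z t \<omega>)"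
      by (rule path[OF that])
    show ?thesis
      unfolding X_def D_def using continuous_solution_flow continuous_solution_unique by blast
  qed
  moreover have "quantile_shift (law \<omega> t) y differentiable (at 0 within {0..})"
    if "\<omega> \<in> space M" "t \<in> {0..\<tau>}" for \<omega> t y
    using shift_family.T_differentiable[OF family[OF that]] by blast
  ultimately show ?thesis by blast
qed

end
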